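(* Let $(K,\mu)$ be a henselian valued field, let $L=K[x]/(P)$ be a finite simple extension of $K$ with $P\in K[x]$ monic and irreducible, and let $\mu'$ be the unique extension of $\mu$ to $L$, viewed also as a pseudo-valuation on $K[x]$. Let $\{Q_i\}_{i\in\Lambda}$ be the well-ordered set of key polynomials associated to $\mu'$ and let $n_0\in\mathbb N^*$ be the smallest integer such that $\Lambda\le\omega n_0$. Then $$\prod_{j=1}^{n_0}d_{\omega j}=d_{L|K}(\mu',\mu).$$
   Context: $\Gamma_\nu$ and $k_\nu$ denote the value group and residue field of a valuation $\nu$. No assumption is made on the rank. Since $K$ is henselian, the defect is $d_{L|K}(\mu',\mu)=[L:K]/\big([\Gamma_{\mu'}:\Gamma_\mu][k_{\mu'}:k_\mu]\big)$. Key polynomials: view $\mu'$ as a pseudo-valuation on $K[x]$ (so $\mu'(f)=\infty$ iff $P\mid f$). For a monic nonconstant $Q$, each $f\in K[x]$ has a unique $Q$-expansion $f=\sum_j c_jQ^j$ with $\deg c_j<\deg Q$; $d^{\circ}_Q(f)$ is the largest $j$ with $c_j\ne0$. The set of key polynomials associated to $\mu'$ is a well-ordered family $\{Q_i\}_{1\le i\le\Lambda}$ of monic polynomials, of order type at most $\omega\times\omega$, with last index $\Lambda$ (the symbol $\Lambda$ denotes both the index set and its last index). Put $\beta_i=\mu'(Q_i)$; then $\beta_i<\infty$ for $i<\Lambda$ and $\mu'(Q_\Lambda)=\infty$ (so $Q_\Lambda=P$). For $i<\Lambda$, the truncation is $\mu'_i(f)=\min_j\{j\beta_i+\mu'(c_j)\}$,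 where $f=\sum_jc_jQ_i^j$ is the $Q_i$-expansion. The family is built as follows: - $Q_1=x$; - $Q_{i+1}$ is a monic polynomial of least degree among the $f$ with $\mu'_i(f)<\mu'(f)$, and its $Q_i$-expansion $Q_{i+1}=Q_i^{\alpha_{i+1}}+\sum_{j<\alpha_{i+1}}c_jQ_i^j$ has all its nonzero terms of the same value $\alpha_{i+1}\beta_i$; - for a limit index $\lambda=\omega j\leq\Lambda$, $Q_{\omega j}$ (a limit key polynomial) is a monic polynomial of least degree among the $f$ with $\mu'_i(f)<\mu'(f)$ for all $i<\omega j$. Put $\alpha_{i+1}=d^\circ_{Q_i}(Q_{i+1})$, and let $\alpha_{\omega j}$ be the value of $d^\circ_{Q_{\omega(j-1)+i}}(Q_{\omega j})$ for $i$ large; the choices are made so that $\alpha_{\omega j}\ge2$ for limit indices $\omega j<\Lambda$. Effective degree: for $f=\sum_j c_jQ_i^j\neq0$, $\delta_i(f)=\max\{j: j\beta_i+\mu'(c_j)=\mu_i'(f)\}$. For a limit index $\omega j\le\Lambda$, the sequence $\delta_{\omega(j-1)+i}(Q_{\omega j})$ ($i\ge1$) is eventually constant and $\delta_{\omega j}$ denotes its eventual value. Numbers $d_{\omega j}$: for $j<n_0$, $d_{\omega j}=\delta_{\omega j}$. For $j=n_0$: $d_{\omega n_0}=\delta_{\omega n_0}$ if $\Lambda=\omega n_0$ and $\{i\ge1:\alpha_{\omega(n_0-1)+i}=1\}$ is infinite; $d_{\omega n_0}=1$ if $\Lambda<\omega n_0$, or if $\Lambda=\omega n_0$ and that set is finite.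 *)

theory Defs
  imports
    "HOL-Algebra.Algebraic_Closure_Type"
    "HOL-Library.Product_Lexorder"
    Complex_Main
begin

text \<open>An ordered abelian group with a largest, absorbing element \<open>Infty\<close> added. No assumption is made on its rank.\<close>

datatype 'g vval = Val 'g | Infty

instantiation vval :: (linorder) linorder
begin

fun less_eq_vval :: "'a vval \<Rightarrow> 'a vval \<Rightarrow> bool" where
  "less_eq_vval x Infty \<longleftrightarrow> True"
| "less_eq_vval Infty (Val b) \<longleftrightarrow> False"
| "less_eq_vval (Val a) (Val b) \<longleftrightarrow> a \<le> b"

definition less_vval :: "'a vval \<Rightarrow> 'a vval \<Rightarrow> bool" where
  "less_vval x y \<longleftrightarrow> x \<le> y \<and> \<not> y \<le> x"

instance
proof
  fix x y z :: "'a vval"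
  show "x < y \<longleftrightarrow> x \<le> y \<and> \<not> y \<le> x" by (rule less_vval_def)
  show "x \<le> x" by (cases x) auto
  show "x \<le> y \<Longrightarrow> y \<le> z \<Longrightarrow> x \<le> z" by (cases x; cases y; cases z) auto
  show "x \<le> y \<Longrightarrow> y \<le> x \<Longrightarrow> x = y" by (cases x; cases y) auto
  show "x \<le> y \<or> y \<le> x" by (cases x; cases y) auto
qed

end

instantiation vval :: (comm_monoid_add) comm_monoid_add
begin

definition zero_vval :: "'a vval" where "0 = Val 0"

fun plus_vval :: "'a vval \<Rightarrow> 'a vval \<Rightarrow> 'a vval" where
  "plus_vval (Val a) (Val b) = Val (a + b)"
| "plus_vval Infty y = Infty"
| "plus_vval x Infty = Infty"

instance
proof
  fix x y z :: "'a vval"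
  show "x + y + z = x + (y + z)" by (cases x; cases y; cases z) (auto simp: add.assoc)
  show "x + y = y + x" by (cases x; cases y) (auto simp: add.commute)
  show "0 + x = x" by (cases x) (auto simp: zero_vval_def)
qed

end

definition valuation :: "('k::field \<Rightarrow> 'g::linordered_ab_group_add vval) \<Rightarrow> bool" where
  "valuation \<nu> \<longleftrightarrow>
     (\<forall>x. \<nu> x = Infty \<longleftrightarrow> x = 0) \<and>
     (\<forall>x y. \<nu> (x * y) = \<nu> x + \<nu> y) \<and>
     (\<forall>x y. min (\<nu> x) (\<nu> y) \<le> \<nu> (x + y))"

definition value_group :: "('k::field \<Rightarrow> 'g::linordered_ab_group_add vval) \<Rightarrow> 'g set" where
  "value_group \<nu> = {g. \<exists>x. \<nu> x = Val g}"

definition integers :: "('k::field \<Rightarrow> 'g::linordered_ab_group_add vval) \<Rightarrow> 'k set" where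
  "integers \<nu> = {x. 0 \<le> \<nu> x}"

definition max_ideal :: "('k::field \<Rightarrow> 'g::linordered_ab_group_add vval) \<Rightarrow> 'k set" where
  "max_ideal \<nu> = {x. 0 < \<nu> x}"

definition valuation_ring :: "('k::field \<Rightarrow> 'g::linordered_ab_group_add vval) \<Rightarrow> 'k ring" where
  "valuation_ring \<nu> = ring_of_type_algebra \<lparr> carrier := integers \<nu> \<rparr>"

definition residue_field :: "('k::field \<Rightarrow> 'g::linordered_ab_group_add vval) \<Rightarrow> 'k set ring" where
  "residue_field \<nu> = valuation_ring \<nu> Quot max_ideal \<nu>"

definition residue_class :: "('k::field \<Rightarrow> 'g::linordered_ab_group_add vval) \<Rightarrow> 'k \<Rightarrow> 'k set" where
  "residue_class \<nu> x = max_ideal \<nu> +>\<^bsub>valuation_ring \<nu>\<^esub> x"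

definition polys_over :: "'k::field set \<Rightarrow> 'k poly set" where
  "polys_over S = {p. \<forall>i. Polynomial.coeff p i \<in> S}"

abbreviation monic :: "'k::field poly \<Rightarrow> bool" where
  "monic p \<equiv> Polynomial.lead_coeff p = 1"

text \<open>
  \<open>\<nu>\<close> is henselian if its valuation ring is a henselian local ring, i.e. Hensel's lemma holds:
  a factorization of the reduction of a monic \<open>f\<close> into coprime monic polynomials over the residue
  field lifts to a factorization of \<open>f\<close>. The factors over the residue field are given by monic
  lifts \<open>g\<^sub>0\<close>, \<open>h\<^sub>0\<close>; their coprimality is a Bezout identity modulo the maximal ideal.
\<close>

definition henselian :: "('k::field \<Rightarrow> 'g::linordered_ab_group_add vval) \<Rightarrow> bool" where
  "henselian \<nu> \<longleftrightarrow>
     (\<forall>f \<in> polys_over (integers \<nu>). \<forall>g\<^sub>0 \<in> polys_over (integers \<nu>). \<forall>h\<^sub>0 \<in> polys_over (integers \<nu>).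
        monic f \<and> monic g\<^sub>0 \<and> monic h\<^sub>0 \<and>
        f - g\<^sub>0 * h\<^sub>0 \<in> polys_over (max_ideal \<nu>) \<and>
        (\<exists>u \<in> polys_over (integers \<nu>). \<exists>w \<in> polys_over (integers \<nu>).
           u * g\<^sub>0 + w * h\<^sub>0 - 1 \<in> polys_over (max_ideal \<nu>)) \<longrightarrow>
        (\<exists>g \<in> polys_over (integers \<nu>). \<exists>h \<in> polys_over (integers \<nu>).
           monic g \<and> monic h \<and> f = g * h \<and>
           g - g\<^sub>0 \<in> polys_over (max_ideal \<nu>) \<and> h - h\<^sub>0 \<in> polys_over (max_ideal \<nu>)))"

text \<open>
  \<open>\<pi>\<close> exhibits the field \<open>'l\<close> as \<open>K[x]/(P)\<close>: a surjective ring homomorphism with kernel \<open>(P)\<close>.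
  The embedding of \<open>K\<close> is then \<open>\<lambda>a. \<pi> [:a:]\<close>, and a valuation \<open>\<nu>\<close> of \<open>'l\<close>, viewed as a
  pseudo-valuation on \<open>K[x]\<close>, is \<open>\<nu> \<circ> \<pi>\<close>.
\<close>

definition presents_quotient :: "'k::field poly \<Rightarrow> ('k poly \<Rightarrow> 'l::field) \<Rightarrow> bool" where
  "presents_quotient P \<pi> \<longleftrightarrow>
     (\<forall>f g. \<pi> (f + g) = \<pi> f + \<pi> g) \<and> (\<forall>f g. \<pi> (f * g) = \<pi> f * \<pi> g) \<and> \<pi> 1 = 1 \<and>
     surj \<pi> \<and> (\<forall>f. \<pi> f = 0 \<longleftrightarrow> P dvd f)"

definition extension_degree :: "('k::field \<Rightarrow> 'l::field) \<Rightarrow> nat" where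
  "extension_degree \<phi> = ring.dim (ring_of_type_algebra :: 'l ring) (range \<phi>) UNIV"

definition group_index :: "'g::ab_group_add set \<Rightarrow> 'g set \<Rightarrow> nat" where
  "group_index G H = card ((\<lambda>g. (+) g ` H) ` G)"

definition residue_degree ::
  "('k::field \<Rightarrow> 'l::field) \<Rightarrow> ('k \<Rightarrow> 'g::linordered_ab_group_add vval) \<Rightarrow> ('l \<Rightarrow> 'g vval) \<Rightarrow> nat"
where
  "residue_degree \<phi> \<mu> \<nu> =
     ring.dim (residue_field \<nu>) ((\<lambda>a. residue_class \<nu> (\<phi> a)) ` integers \<mu>)
       (carrier (residue_field \<nu>))"

definition defect ::
  "('k::field \<Rightarrow> 'l::field) \<Rightarrow> ('k \<Rightarrow> 'g::linordered_ab_group_add vval) \<Rightarrow> ('l \<Rightarrow> 'g vval) \<Rightarrow> rat"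
where
  "defect \<phi> \<mu> \<nu> =
     of_nat (extension_degree \<phi>) /
       (of_nat (group_index (value_group \<nu>) (value_group \<mu>)) * of_nat (residue_degree \<phi> \<mu> \<nu>))"

definition is_expansion :: "'k::field poly \<Rightarrow> 'k poly \<Rightarrow> (nat \<Rightarrow> 'k poly) \<Rightarrow> bool" where
  "is_expansion Q f c \<longleftrightarrow>
     (\<forall>j. Polynomial.degree (c j) < Polynomial.degree Q) \<and> finite {j. c j \<noteq> 0} \<and>
     f = (\<Sum>j | c j \<noteq> 0. c j * Q ^ j)"

definition expansion :: "'k::field poly \<Rightarrow> 'k poly \<Rightarrow> nat \<Rightarrow> 'k poly" where
  "expansion Q f = (THE c. is_expansion Q f c)"

text \<open>\<open>d\<^sup>\<circ>\<^sub>Q(f)\<close>; meaningful for \<open>f \<noteq> 0\<close>.\<close>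

definition expansion_degree :: "'k::field poly \<Rightarrow> 'k poly \<Rightarrow> nat" where
  "expansion_degree Q f = Max {j. expansion Q f j \<noteq> 0}"

text \<open>In the following, \<open>v\<close> is a pseudo-valuation on \<open>K[x]\<close>. The value of the \<open>j\<close>-th term is
  \<open>j \<beta> + v (c j)\<close> with \<open>\<beta> = v Q\<close>; the multiple \<open>j \<beta>\<close> is written as a constant sum.\<close>

definition term_value ::
  "('k::field poly \<Rightarrow> 'g::linordered_ab_group_add vval) \<Rightarrow> 'k poly \<Rightarrow> 'k poly \<Rightarrow> nat \<Rightarrow> 'g vval"
where
  "term_value v Q f j = (\<Sum>_<j. v Q) + v (expansion Q f j)"

text \<open>The minimum is over a finite set, as all but finitely many terms have value \<open>Infty\<close>.\<close>

definition truncation ::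
  "('k::field poly \<Rightarrow> 'g::linordered_ab_group_add vval) \<Rightarrow> 'k poly \<Rightarrow> 'k poly \<Rightarrow> 'g vval"
where
  "truncation v Q f = Min (range (term_value v Q f))"

definition effective_degree ::
  "('k::field poly \<Rightarrow> 'g::linordered_ab_group_add vval) \<Rightarrow> 'k poly \<Rightarrow> 'k poly \<Rightarrow> nat"
where
  "effective_degree v Q f = Max {j. term_value v Q f j = truncation v Q f}"

text \<open>
  Indices: the ordinal \<open>\<omega> a + i\<close> is the pair \<open>(a, i)\<close>, with the lexicographic order. The first
  index is \<open>(0, 1)\<close>, so \<open>(0, 0)\<close> is not used; the successor of \<open>(a, i)\<close> is \<open>(a, Suc i)\<close> and the
  limit indices are the \<open>(Suc a, 0)\<close>. A last index \<open>\<Lambda>\<close> with order type at most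
  \<open>\<omega> \<times> \<omega>\<close> is below \<open>\<omega> \<times> \<omega>\<close>, hence is such a pair.
\<close>

type_synonym index = "nat \<times> nat"

definition eventual_value :: "(nat \<Rightarrow> 'b) \<Rightarrow> 'b" where
  "eventual_value s = (THE n. \<forall>\<^sub>F i in sequentially. s i = n)"

text \<open>\<open>\<alpha>\<close> is not defined at the first index; the value below at \<open>(0, 1)\<close> is meaningless and
  does not influence anything.\<close>

fun key_alpha :: "(index \<Rightarrow> 'k::field poly) \<Rightarrow> index \<Rightarrow> nat" where
  "key_alpha Q (a, Suc i) = expansion_degree (Q (a, i)) (Q (a, Suc i))"
| "key_alpha Q (Suc a, 0) = eventual_value (\<lambda>i. expansion_degree (Q (a, i)) (Q (Suc a, 0)))"
| "key_alpha Q (0, 0) = 0"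

definition least_degree_monic_in :: "'k::field poly set \<Rightarrow> 'k poly \<Rightarrow> bool" where
  "least_degree_monic_in S q \<longleftrightarrow>
     q \<in> S \<and> monic q \<and> (\<forall>f \<in> S. Polynomial.degree q \<le> Polynomial.degree f)"

definition key_polynomials ::
  "('k::field poly \<Rightarrow> 'g::linordered_ab_group_add vval) \<Rightarrow> index \<Rightarrow> (index \<Rightarrow> 'k poly) \<Rightarrow> bool"
where
  "key_polynomials v \<Lambda> Q \<longleftrightarrow>
     (0, 1) \<le> \<Lambda> \<and>
     Q (0, 1) = [:0, 1:] \<and>
     (\<forall>i. (0, 1) \<le> i \<and> i < \<Lambda> \<longrightarrow> v (Q i) < Infty) \<and>
     v (Q \<Lambda>) = Infty \<and>
     (\<forall>a i. (0, 1) \<le> (a, i) \<and> (a, i) < \<Lambda> \<longrightarrow>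
        least_degree_monic_in {f. truncation v (Q (a, i)) f < v f} (Q (a, Suc i)) \<and>
        expansion (Q (a, i)) (Q (a, Suc i)) (key_alpha Q (a, Suc i)) = 1 \<and>
        (\<forall>j. expansion (Q (a, i)) (Q (a, Suc i)) j \<noteq> 0 \<longrightarrow>
           term_value v (Q (a, i)) (Q (a, Suc i)) j
             = (\<Sum>_<key_alpha Q (a, Suc i). v (Q (a, i))))) \<and>
     (\<forall>a. (Suc a, 0) \<le> \<Lambda> \<longrightarrow>
        least_degree_monic_in
          {f. \<forall>i. (0, 1) \<le> i \<and> i < (Suc a, 0) \<longrightarrow> truncation v (Q i) f < v f} (Q (Suc a, 0))) \<and>
     (\<forall>a. (Suc a, 0) < \<Lambda> \<longrightarrow> 2 \<le> key_alpha Q (Suc a, 0))"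

text \<open>\<open>\<delta>\<^sub>\<omega>\<^sub>j\<close>, for \<open>j \<ge> 1\<close>.\<close>

definition limit_delta ::
  "('k::field poly \<Rightarrow> 'g::linordered_ab_group_add vval) \<Rightarrow> (index \<Rightarrow> 'k poly) \<Rightarrow> nat \<Rightarrow> nat"
where
  "limit_delta v Q j = eventual_value (\<lambda>i. effective_degree v (Q (j - 1, i)) (Q (j, 0)))"

definition limit_count :: "index \<Rightarrow> nat" where
  "limit_count \<Lambda> = (LEAST n. 1 \<le> n \<and> \<Lambda> \<le> (n, 0))"

text \<open>\<open>d\<^sub>\<omega>\<^sub>j\<close>, for \<open>1 \<le> j \<le> limit_count \<Lambda>\<close>.\<close>

definition limit_d ::
  "('k::field poly \<Rightarrow> 'g::linordered_ab_group_add vval) \<Rightarrow> index \<Rightarrow> (index \<Rightarrow> 'k poly) \<Rightarrow> nat \<Rightarrow> nat"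
where
  "limit_d v \<Lambda> Q j =
     (if j < limit_count \<Lambda> then limit_delta v Q j
      else if \<Lambda> = (j, 0) \<and> infinite {i. 1 \<le> i \<and> key_alpha Q (j - 1, i) = 1}
      then limit_delta v Q j
      else 1)"

end

theory Submission
  imports Defs "Jordan_Normal_Form.Char_Poly"
begin

text \<open>
  Write \<open>v = \<mu>' \<circ> \<pi>\<close> and let \<open>V\<^sub>i\<close> be the space of polynomials of degree less than \<open>deg Q\<^sub>i\<close>; as
  \<open>Q\<^sub>\<Lambda> = P\<close>, the space \<open>V\<^sub>\<Lambda>\<close> is a copy of \<open>L\<close>. The idea is to compare the dimension of \<open>V\<^sub>i\<close> over \<open>K\<close>
  with the size of a \<^emph>\<open>graded basis\<close> of \<open>V\<^sub>i\<close>: a finite set \<open>S\<close> such that no cancellation of values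
  occurs in a linear combination of elements of \<open>S\<close>, and such that every nonzero element of \<open>V\<^sub>i\<close> agrees
  with such a combination up to terms of larger value. Equivalently, the initial forms of \<open>S\<close> are a
  basis of the graded module of \<open>V\<^sub>i\<close>.

  A graded basis of \<open>L\<close> has \<open>e f\<close> elements, with \<open>e\<close> the ramification index and \<open>f\<close> the residue degree:
  sorted by the cosets of the value group of \<open>K\<close>, each of the \<open>e\<close> classes becomes a basis of the
  residue field extension after rescaling (\<open>card_graded_basis\<close>). So it suffices to follow
  the quotient \<open>deg Q\<^sub>i / |S|\<close> along the family.

  At a successor it does not change (\<open>poly_graded_basis_step\<close>). On \<open>V\<close> for the next index, \<open>v\<close> coincides
  with the truncation at \<open>Q\<^sub>i\<close>, so the products \<open>s Q\<^sub>i\<^sup>j\<close> with \<open>s \<in> S\<close> and \<open>j < \<alpha>\<close> form a graded basis, and the degree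
  is multiplied by the same \<open>\<alpha>\<close>. At a limit, \<open>S\<close> stays a graded basis (\<open>poly_graded_basis_limit\<close>): once the
  truncation at \<open>Q\<^sub>i\<close> has the right value at \<open>f\<close>, the remainder of \<open>f\<close> modulo \<open>Q\<^sub>i\<^sub>+\<^sub>1\<close> agrees with \<open>f\<close> up to
  terms of larger value, and it lies in the space spanned before the limit. Hence the quotient is multiplied by
  \<open>deg Q\<^sub>\<omega>\<^sub>j / deg Q\<^sub>i\<close> with \<open>i\<close> large below \<open>\<omega>j\<close>, and the corollary amounts to the equality of
  this number with the effective degree \<open>\<delta>\<^sub>\<omega>\<^sub>j\<close> (\<open>limit_delta_eq\<close>).

  This equality is where henselianity enters. It says that the Newton polygon of \<open>Q\<^sub>\<omega>\<^sub>j\<close> with respect to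
  \<open>Q\<^sub>i\<close> has only one side. Both \<open>F = Q\<^sub>\<omega>\<^sub>j\<close> and \<open>G = Q\<^sub>i\<close> are irreducible and \<open>v\<close> induces valuations on
  \<open>K[x]/(F)\<close> and \<open>K[x]/(G)\<close>. For a henselian field these are determined by the norm, and computing the
  resultant of \<open>F\<close> and \<open>G\<close> in two ways gives \<open>deg F \<cdot> v(G mod F) = deg G \<cdot> v(F mod G)\<close> (\<open>value_reciprocity\<close>).
  As \<open>i\<close> varies, the left side is linear in \<open>\<beta>\<^sub>i\<close>, while the right side is \<open>deg G\<close> times the height of the
  Newton polygon at slope \<open>\<beta>\<^sub>i\<close> for all but finitely many \<open>i\<close>. This forces the polygon to be a single
  side (\<open>newton_polygon\<close>).

  The reciprocity is proved in the integral closure of the valuation ring in an algebraic closure of \<open>K\<close>: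
  an element of a finite extension with nonnegative value is integral (\<open>nonneg_integral\<close>), so the conjugates
  of an element of value zero, and their product, are units there.
\<close>

section \<open>Arithmetic of values\<close>

instance vval :: (linordered_ab_group_add) ordered_comm_monoid_add
proof
  fix a b c :: "'a vval"
  assume "a \<le> b"
  then show "c + a \<le> c + b"
    by (cases c; cases b; cases a) auto
qed

lemma less_vval_simps [simp]:
  "Val a < Val b \<longleftrightarrow> a < b" "Val a < Infty" "\<not> Infty < x"
  by (auto simp: less_vval_def)

lemma Infty_le_iff [simp]: "Infty \<le> x \<longleftrightarrow> x = Infty"
  by (cases x) auto

lemma less_Infty_iff [simp]: "x < Infty \<longleftrightarrow> x \<noteq> Infty"
  by (cases x) auto

lemma plus_Infty [simp]: "x + Infty = Infty" "Infty + x = Infty"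
  by (cases x, auto)+

lemma plus_eq_Infty_iff [simp]: "x + y = Infty \<longleftrightarrow> x = Infty \<or> y = Infty"
  by (cases x; cases y) auto

lemma zero_neq_Infty [simp]: "0 \<noteq> Infty" "Infty \<noteq> 0"
  by (auto simp: zero_vval_def)

lemma vval_add_left_cancel:
  fixes c :: "'g::linordered_ab_group_add vval"
  assumes "c \<noteq> Infty"
  shows "c + a \<le> c + b \<longleftrightarrow> a \<le> b" "c + a < c + b \<longleftrightarrow> a < b" "c + a = c + b \<longleftrightarrow> a = b"
  using assms by (cases a; cases b; cases c; auto)+

lemma vval_add_less_le_mono:
  fixes a b c d :: "'g::linordered_ab_group_add vval"
  assumes "a < b" "c \<le> d" "c \<noteq> Infty"
  shows "a + c < b + d" "c + a < d + b"
  using assms by (cases a; cases b; cases c; cases d; auto intro: add_less_le_mono add_le_less_mono)+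

text \<open>
  The multiples of values that occur as constant sums in \<open>term_value\<close>; a general ordered group
  carries no scalar multiplication by natural numbers.
\<close>

definition nmult :: "nat \<Rightarrow> 'b::comm_monoid_add \<Rightarrow> 'b" (infixr "\<star>" 75) where
  "n \<star> b = (\<Sum>_<n. b)"

lemma nmult_0 [simp]: "0 \<star> b = 0"
  by (simp add: nmult_def)

lemma nmult_Suc [simp]: "Suc n \<star> b = b + n \<star> b"
  by (simp add: nmult_def add.commute)

lemma nmult_zero [simp]: "n \<star> 0 = 0"
  by (simp add: nmult_def)

lemma nmult_add_left: "(m + n) \<star> b = m \<star> b + n \<star> b"
  by (induction m) (auto simp: add.assoc)

lemma nmult_mult: "(m * n) \<star> b = m \<star> n \<star> b"
  by (induction m) (auto simp: nmult_add_left)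

lemma nmult_minus: "n \<star> (a - b) = n \<star> a - n \<star> (b :: 'g::ab_group_add)"
  by (simp add: nmult_def sum_subtractf)

lemma nmult_Val: "n \<star> Val b = Val (n \<star> b)"
  by (induction n) (auto simp: zero_vval_def)

lemma nmult_eq_Infty_iff [simp]: "n \<star> b = Infty \<longleftrightarrow> 0 < n \<and> b = Infty"
  by (induction n) auto

lemma nmult_mono_right: "(a :: 'g::ordered_comm_monoid_add) \<le> b \<Longrightarrow> n \<star> a \<le> n \<star> b"
  by (simp add: nmult_def sum_mono)

lemma nmult_less:
  fixes b :: "'g::linordered_ab_group_add"
  assumes "0 < b" "m < n"
  shows "m \<star> b < n \<star> b"
proof -
  obtain k where k: "n = m + Suc k" using assms(2) less_imp_Suc_add by auto
  have "0 \<le> k \<star> b" using nmult_mono_right[of 0 b k] assms(1) by simp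
  then have "0 < Suc k \<star> b" using assms(1) by (simp add: add_pos_nonneg)
  then show ?thesis unfolding k nmult_add_left by simp
qed

lemma nmult_le:
  fixes b :: "'g::linordered_ab_group_add"
  assumes "0 \<le> b" "m \<le> n"
  shows "m \<star> b \<le> n \<star> b"
  using assms nmult_less[of b m n] by (cases "b = 0"; cases "m = n") (auto simp: order_le_less)

lemma nmult_pos:
  fixes b :: "'g::linordered_ab_group_add"
  assumes "0 < n"
  shows "0 < n \<star> b \<longleftrightarrow> 0 < b" "n \<star> b = 0 \<longleftrightarrow> b = 0"
proof -
  have pos: "0 < n \<star> c" if "0 < c" for c :: 'g
    using nmult_less[OF that assms] by simp
  have neg: "n \<star> c < 0" if "c < 0" for c :: 'g
    using pos[of "- c"] that nmult_minus[of n 0 c] by simp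
  show "0 < n \<star> b \<longleftrightarrow> 0 < b" "n \<star> b = 0 \<longleftrightarrow> b = 0"
    using pos[of b] neg[of b] by (cases "b < 0"; cases "b = 0"; force)+
qed

lemma nmult_left_cancel:
  fixes a b :: "'g::linordered_ab_group_add"
  assumes "0 < n" "n \<star> a = n \<star> b"
  shows "a = b"
  using assms nmult_pos(2)[of n "a - b"] by (simp add: nmult_minus)

lemma nmult_le_cancel_left:
  fixes b :: "'g::linordered_ab_group_add"
  assumes "0 < b" "m \<star> b \<le> n \<star> b"
  shows "m \<le> n"
  using assms nmult_less[of b n m] by (meson leD not_le_imp_less)

section \<open>Expansions in powers of a polynomial\<close>

lemma degree_mod_less_nz:
  assumes "0 < degree (Q :: 'k::field poly)"
  shows "degree (f mod Q) < degree Q"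
  by (cases "f mod Q = 0") (use assms in \<open>auto intro!: degree_mod_less'\<close>)

lemma degree_monic_mult_power:
  assumes "lead_coeff (Q :: 'k::field poly) = 1" "f \<noteq> 0"
  shows "degree (f * Q ^ n) = degree f + n * degree Q"
proof -
  have "Q \<noteq> 0" using assms(1) by auto
  then show ?thesis using assms(2) by (simp add: degree_mult_eq degree_power_eq)
qed

lemma adic_induct [consumes 1, case_names small step]:
  fixes Q :: "'k::field poly"
  assumes deg_pos: "0 < degree Q"
    and small: "\<And>f. degree f < degree Q \<Longrightarrow> R f"
    and step: "\<And>c h. degree c < degree Q \<Longrightarrow> R h \<Longrightarrow> h \<noteq> 0 \<Longrightarrow> R (c + Q * h)"
  shows "R f"
proof (induction "degree f" arbitrary: f rule: less_induct)
  case less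
  show ?case
  proof (cases "degree f < degree Q")
    case False
    have "f = f mod Q + Q * (f div Q)" by simp
    moreover have "f div Q \<noteq> 0"
      using False calculation degree_mod_less_nz[OF deg_pos, of f] by (metis add.right_neutral mult_zero_right)
    ultimately show ?thesis
      using step[OF degree_mod_less_nz[OF deg_pos, of f]] less[OF Polynomial.degree_div_less[of f Q]] False deg_pos
      by (metis gr_zeroI)
  qed (rule small)
qed

context
  fixes Q :: "'k::field poly"
  assumes deg_pos: "0 < degree Q"
begin

lemma adic_mod [simp]: "degree c < degree Q \<Longrightarrow> (c + Q * h) mod Q = c"
  by (simp add: poly_mod_add_left mod_poly_less)

lemma adic_div [simp]: "degree c < degree Q \<Longrightarrow> (c + Q * h) div Q = h"
proof -
  assume "degree c < degree Q"
  moreover have "Q \<noteq> 0" using deg_pos by auto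
  ultimately show ?thesis by (simp add: poly_div_add_left div_poly_less)
qed

text \<open>
  Splitting off the constant coefficient shows that the coefficients of any expansion are the digits
  obtained by division with remainder, which makes the description of \<open>expansion\<close> explicit.
\<close>

lemma is_expansion_unique:
  assumes "is_expansion Q f c"
  shows "c j = (f div Q ^ j) mod Q"
  using assms
proof (induction j arbitrary: f c)
  have split: "f = c 0 + Q * (\<Sum>j | c (Suc j) \<noteq> 0. c (Suc j) * Q ^ j)
      \<and> is_expansion Q (f div Q) (c \<circ> Suc)" if "is_expansion Q f c" for f c
  proof -
    from that have fin: "finite {j. c j \<noteq> 0}" and f: "f = (\<Sum>j | c j \<noteq> 0. c j * Q ^ j)"
      and d: "\<And>j. degree (c j) < degree Q"
      by (auto simp: is_expansion_def)
    have fin': "finite {j. c (Suc j) \<noteq> 0}"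
      using finite_vimageI[OF fin, of Suc] by (simp add: vimage_def)
    have "f = (\<Sum>j\<in>insert 0 (Suc ` {j. c (Suc j) \<noteq> 0}). c j * Q ^ j)"
      unfolding f using fin'
      by (intro sum.mono_neutral_left) (auto simp: image_iff, metis not0_implies_Suc)
    also have "\<dots> = c 0 + (\<Sum>j | c (Suc j) \<noteq> 0. c (Suc j) * Q ^ Suc j)"
      using fin' by (subst sum.insert) (auto simp: sum.reindex)
    also have "\<dots> = c 0 + Q * (\<Sum>j | c (Suc j) \<noteq> 0. c (Suc j) * Q ^ j)"
      by (simp add: sum_distrib_left algebra_simps)
    finally have eq: "f = c 0 + Q * (\<Sum>j | c (Suc j) \<noteq> 0. c (Suc j) * Q ^ j)" .
    then have "f div Q = (\<Sum>j | c (Suc j) \<noteq> 0. c (Suc j) * Q ^ j)"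
      using adic_div d by metis
    then show ?thesis using eq fin' d by (auto simp: is_expansion_def)
  qed
  {
    case 0
    then show ?case using split[OF 0] 0 adic_mod unfolding is_expansion_def
      by (metis div_by_1 power_0)
  next
    case (Suc j)
    have "c (Suc j) = (f div Q div Q ^ j) mod Q"
      using Suc.IH[of "f div Q" "c \<circ> Suc"] split[OF Suc.prems] by (metis comp_apply)
    then show ?case by (simp add: poly_div_mult_right)
  }
qed

lemma digit_eq_0: "degree f < j \<Longrightarrow> f div Q ^ j = 0"
proof -
  assume "degree f < j"
  moreover have "j * 1 \<le> j * degree Q" using deg_pos by (intro mult_le_mono2) auto
  moreover have "Q \<noteq> 0" using deg_pos by auto
  moreover from this have "degree (Q ^ j) = j * degree Q" by (rule Polynomial.degree_power_eq)
  ultimately show ?thesis by (intro div_poly_less) linarith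
qed

lemma digit_sum: "f = (\<Sum>j\<le>n. ((f div Q ^ j) mod Q) * Q ^ j) + (f div Q ^ Suc n) * Q ^ Suc n"
proof (induction n)
  case 0
  show ?case by simp
next
  case (Suc n)
  have "(f div Q ^ Suc n) * Q ^ Suc n
      = ((f div Q ^ Suc n) mod Q + (f div Q ^ Suc n div Q) * Q) * Q ^ Suc n"
    by (simp only: mod_div_mult_eq)
  also have "f div Q ^ Suc n div Q = f div Q ^ Suc (Suc n)"
    by (simp only: poly_div_mult_right[symmetric] power_Suc2)
  also have "((f div Q ^ Suc n) mod Q + (f div Q ^ Suc (Suc n)) * Q) * Q ^ Suc n
      = ((f div Q ^ Suc n) mod Q) * Q ^ Suc n + (f div Q ^ Suc (Suc n)) * Q ^ Suc (Suc n)"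
    by (simp only: distrib_right mult.assoc power_Suc)
  finally show ?case
    by (subst Suc.IH) (simp only: sum.atMost_Suc add.assoc)
qed

lemma expansion_eq: "expansion Q f j = (f div Q ^ j) mod Q"
proof -
  let ?c = "\<lambda>j. (f div Q ^ j) mod Q"
  have fin: "{j. ?c j \<noteq> 0} \<subseteq> {..degree f}"
    using digit_eq_0[of f] by (auto simp: not_less[symmetric])
  have 0: "(f div Q ^ Suc (degree f)) * Q ^ Suc (degree f) = 0"
    using digit_eq_0[of f "Suc (degree f)"] by (simp only: lessI mult_zero_left)
  have "f = (\<Sum>j\<le>degree f. ?c j * Q ^ j)"
    using digit_sum[of f "degree f"] unfolding 0 add_0_right .
  also have "\<dots> = (\<Sum>j | ?c j \<noteq> 0. ?c j * Q ^ j)"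
    using fin by (intro sum.mono_neutral_right) auto
  finally have "is_expansion Q f ?c"
    unfolding is_expansion_def using degree_mod_less_nz[OF deg_pos]
    by (blast intro: finite_subset[OF fin])
  then have "expansion Q f = ?c"
    unfolding expansion_def
    by (rule the_equality[of "is_expansion Q f"]) (rule ext, rule is_expansion_unique)
  then show ?thesis by simp
qed

lemma expansion_0: "expansion Q f 0 = f mod Q"
  by (simp add: expansion_eq)

lemma expansion_Suc: "expansion Q f (Suc j) = expansion Q (f div Q) j"
  by (simp add: expansion_eq poly_div_mult_right)

lemma expansion_bound: "degree f < j \<Longrightarrow> expansion Q f j = 0"
  by (simp add: expansion_eq digit_eq_0)

lemma expansion_degree_bound: "degree (expansion Q f j) < degree Q"
  by (simp add: expansion_eq degree_mod_less_nz[OF deg_pos])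

lemma expansion_add: "expansion Q (f + g) j = expansion Q f j + expansion Q g j"
  by (simp add: expansion_eq poly_div_add_left poly_mod_add_left)

lemma expansion_sum_eq:
  assumes "degree f \<le> n"
  shows "f = (\<Sum>j\<le>n. expansion Q f j * Q ^ j)"
proof -
  have "f div Q ^ Suc n = 0" using assms by (intro digit_eq_0) simp
  then have 0: "(f div Q ^ Suc n) * Q ^ Suc n = 0" by (simp only: mult_zero_left)
  have "f = (\<Sum>j\<le>n. expansion Q f j * Q ^ j) + (f div Q ^ Suc n) * Q ^ Suc n"
    unfolding expansion_eq by (rule digit_sum)
  then show ?thesis unfolding 0 add_0_right .
qed

end

section \<open>Pseudo-valuations and truncations\<close>

text \<open>
  The principal support \<open>P\<close> is kept as a parameter because one notion then covers all valuations that occur: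
  \<open>P = 0\<close> for the valuations of fields and the truncations, \<open>P\<close> itself for \<open>\<mu>' \<circ> \<pi>\<close>, and a key polynomial for
  the valuation it defines on its residue ring.
\<close>

locale ring_valuation =
  fixes v :: "'a::comm_ring_1 \<Rightarrow> 'g::linordered_ab_group_add vval" and P :: 'a
  assumes mult: "v (f * g) = v f + v g"
    and add: "min (v f) (v g) \<le> v (f + g)"
    and one: "v 1 = 0"
    and support: "v f = Infty \<longleftrightarrow> P dvd f"
begin

lemma zero [simp]: "v 0 = Infty"
  by (simp add: support)

lemma minus [simp]: "v (- f) = v f"
proof -
  have "v (- 1) + v (- 1) = 0" using mult[of "- 1" "- 1"] one by simp
  then have "v (- 1) = 0"
  proof (cases "v (- 1)")
    case (Val a)
    then have "2 \<star> a = 0" using \<open>v (- 1) + v (- 1) = 0\<close> by (simp add: zero_vval_def numeral_2_eq_2)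
    then show ?thesis using nmult_pos(2)[of 2 a] Val by (simp add: zero_vval_def)
  qed simp
  then show ?thesis using mult[of "- 1" f] by simp
qed

lemma diff: "min (v f) (v g) \<le> v (f - g)"
  using add[of f "- g"] by simp

lemma add_ge: "s \<le> v f \<Longrightarrow> s \<le> v g \<Longrightarrow> s \<le> v (f + g)"
  using add[of f g] by (metis min.boundedI order_trans)

lemma diff_ge: "s \<le> v f \<Longrightarrow> s \<le> v g \<Longrightarrow> s \<le> v (f - g)"
  using diff[of f g] by (metis min.boundedI order_trans)

lemma add_gr: "s < v f \<Longrightarrow> s < v g \<Longrightarrow> s < v (f + g)"
  using add[of f g] by (metis min_less_iff_conj not_le order_le_less_trans)

lemma add_eq_left: "v f < v g \<Longrightarrow> v (f + g) = v f"
proof (rule antisym)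
  assume l: "v f < v g"
  show "v f \<le> v (f + g)" using l by (intro add_ge) auto
  show "v (f + g) \<le> v f"
  proof (rule ccontr)
    assume "\<not> ?thesis"
    then have "v f < v (f + g)" by simp
    from add_gr[OF this, of "- g"] l show False by simp
  qed
qed

lemma sum_ge: "(\<And>i. i \<in> A \<Longrightarrow> s \<le> v (F i)) \<Longrightarrow> s \<le> v (\<Sum>i\<in>A. F i)"
  by (induction A rule: infinite_finite_induct) (auto intro!: add_ge)

lemma sum_gr: "s \<noteq> Infty \<Longrightarrow> (\<And>i. i \<in> A \<Longrightarrow> s < v (F i)) \<Longrightarrow> s < v (\<Sum>i\<in>A. F i)"
  by (induction A rule: infinite_finite_induct) (auto intro!: add_gr)

lemma power: "v (f ^ n) = n \<star> v f"
  by (induction n) (auto simp: mult one)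

lemma P_not_unit: "\<not> P dvd 1"
  using support[of 1] one by auto

end

locale pseudo_valuation = ring_valuation v P
  for v :: "'k::field poly \<Rightarrow> 'g::linordered_ab_group_add vval" and P :: "'k poly"
begin

lemma finite_value: "f \<noteq> 0 \<Longrightarrow> degree f < degree P \<Longrightarrow> v f \<noteq> Infty"
  using support[of f] dvd_imp_degree_le[of P f] by auto

end

lemma term_value_alt: "term_value v Q f j = j \<star> v Q + v (expansion Q f j)"
  by (simp add: term_value_def nmult_def)

context
  fixes v :: "'k::field poly \<Rightarrow> 'g::linordered_ab_group_add vval" and Q :: "'k poly"
  assumes deg_pos: "0 < degree Q"
    and v0: "v 0 = Infty"
begin

lemma term_value_0 [simp]: "term_value v Q f 0 = v (f mod Q)"
  by (simp add: term_value_def expansion_0[OF deg_pos])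

lemma term_value_Suc [simp]: "term_value v Q f (Suc j) = v Q + term_value v Q (f div Q) j"
  by (simp add: term_value_def expansion_Suc[OF deg_pos] ac_simps)

lemma finite_range_term_value: "finite (range (term_value v Q f))"
proof -
  have "range (term_value v Q f) \<subseteq> insert Infty (term_value v Q f ` {..degree f})"
  proof
    fix x assume "x \<in> range (term_value v Q f)"
    then obtain j where j: "x = term_value v Q f j" by auto
    show "x \<in> insert Infty (term_value v Q f ` {..degree f})"
      using expansion_bound[OF deg_pos, of f j] v0 j
      by (cases "j \<le> degree f") (auto simp: term_value_def)
  qed
  then show ?thesis by (rule finite_subset) auto
qed

lemma truncation_le: "truncation v Q f \<le> term_value v Q f j"
  unfolding truncation_def by (intro Min_le finite_range_term_value) auto

lemma truncation_ge_iff: "s \<le> truncation v Q f \<longleftrightarrow> (\<forall>j. s \<le> term_value v Q f j)"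
  unfolding truncation_def by (subst Min_ge_iff) (auto intro: finite_range_term_value)

lemma truncation_attained: "\<exists>j. truncation v Q f = term_value v Q f j"
  using Min_in[OF finite_range_term_value, of f] unfolding truncation_def by blast

text \<open>
  In this recursive form the minimum over all coefficients disappears, and facts about truncations can be
  proved by induction along the expansion.
\<close>

lemma truncation_rec:
  "truncation v Q f = min (v (f mod Q)) (v Q + truncation v Q (f div Q))"
proof (rule antisym)
  obtain j where j: "truncation v Q (f div Q) = term_value v Q (f div Q) j"
    using truncation_attained by blast
  show "truncation v Q f \<le> min (v (f mod Q)) (v Q + truncation v Q (f div Q))"
    using truncation_le[of f 0] truncation_le[of f "Suc j"] j by simp
  show "min (v (f mod Q)) (v Q + truncation v Q (f div Q)) \<le> truncation v Q f"
    unfolding truncation_ge_iff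
  proof
    fix j
    show "min (v (f mod Q)) (v Q + truncation v Q (f div Q)) \<le> term_value v Q f j"
      using truncation_le[of "f div Q" "j - 1"]
      by (cases j) (auto intro!: min.coboundedI2 add_left_mono)
  qed
qed

lemma truncation_0 [simp]: "truncation v Q 0 = Infty"
proof -
  have "Infty \<le> truncation v Q 0"
    unfolding truncation_ge_iff by (auto simp: term_value_def expansion_eq[OF deg_pos] v0)
  then show ?thesis by simp
qed

lemma truncation_step:
  assumes "degree c < degree Q"
  shows "truncation v Q (c + Q * h) = min (v c) (v Q + truncation v Q h)"
  unfolding truncation_rec[of "c + Q * h"] adic_mod[OF deg_pos assms] adic_div[OF deg_pos assms] ..

lemma truncation_small:
  assumes "degree f < degree Q"
  shows "truncation v Q f = v f"
  using truncation_step[OF assms, of 0] by (simp add: min_def)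

lemma truncation_mult_Q: "truncation v Q (Q * h) = v Q + truncation v Q h"
  using truncation_step[of 0 h] deg_pos v0 by (simp add: min_def)

lemma truncation_mult_power: "truncation v Q (Q ^ n * h) = n \<star> v Q + truncation v Q h"
  by (induction n) (auto simp: truncation_mult_Q mult.assoc add.assoc)

lemma truncation_Q:
  assumes "v 1 = 0"
  shows "truncation v Q Q = v Q"
  using truncation_mult_Q[of 1] truncation_small[of 1] deg_pos assms by simp

lemma truncation_le_mod: "truncation v Q f \<le> v (f mod Q)"
  using truncation_le[of f 0] by simp

lemma truncation_eq_Infty_iff:
  assumes "v Q \<noteq> Infty" "\<And>c. degree c < degree Q \<Longrightarrow> v c = Infty \<longleftrightarrow> c = 0"
  shows "truncation v Q f = Infty \<longleftrightarrow> f = 0"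
using deg_pos proof (induction f rule: adic_induct)
  case (small f)
  then show ?case using assms(2) by (simp add: truncation_small)
next
  case (step c h)
  have "c + Q * h \<noteq> 0"
    using step adic_div[OF deg_pos step(1), of h] by (metis div_0)
  then show ?case using step assms(1) by (auto simp: truncation_step min_def)
qed

end

context pseudo_valuation
begin

text \<open>
  The condition says that \<open>v\<close>, evaluated at remainders modulo \<open>Q\<close>, is multiplicative on \<open>K[x]/(Q)\<close>. It makes
  the truncation at \<open>Q\<close> a valuation, and it does not refer to the earlier members of a family.
\<close>

definition key_poly :: "'k poly \<Rightarrow> bool" where
  "key_poly Q \<longleftrightarrow> lead_coeff Q = 1 \<and> 0 < degree Q \<and>
     (\<forall>f g. degree f < degree Q \<longrightarrow> degree g < degree Q \<longrightarrow>
        v ((f * g) mod Q) = v (f * g))"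

lemma key_polyD:
  assumes "key_poly Q"
  shows "lead_coeff Q = 1" "0 < degree Q"
    "degree f < degree Q \<Longrightarrow> degree g < degree Q \<Longrightarrow>
       v ((f * g) mod Q) = v (f * g)"
  using assms unfolding key_poly_def by auto

lemma degree_quotient_less:
  fixes Q :: "'k poly"
  assumes "degree f < degree Q" "degree g < degree Q"
  shows "degree ((f * g) div Q) < degree Q"
proof (cases "(f * g) div Q = 0")
  case False
  have "Q \<noteq> 0" using assms by auto
  have "degree ((f * g) div Q) + degree Q = degree ((f * g) div Q * Q)"
    using False \<open>Q \<noteq> 0\<close> by (simp add: degree_mult_eq)
  also have "\<dots> = degree (f * g - (f * g) mod Q)"
    by (simp add: minus_mod_eq_div_mult)
  also have "\<dots> \<le> max (degree (f * g)) (degree ((f * g) mod Q))"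
    by (rule degree_diff_le_max)
  also have "\<dots> < degree Q + degree Q"
    using assms degree_mult_le[of f g] degree_mod_less_nz[of Q "f * g"] by auto
  finally show ?thesis by simp
qed (use assms in simp)

lemma min_add_le:
  fixes s x y z :: "'g vval"
  assumes "min x y \<le> z"
  shows "min (s + x) (s + y) \<le> s + z"
proof (cases "x \<le> y")
  case True
  then show ?thesis using assms by (intro min.coboundedI1 add_left_mono) (simp add: min_def)
next
  case False
  then show ?thesis using assms by (intro min.coboundedI2 add_left_mono) (simp add: min_def)
qed

lemma truncation_add:
  assumes "0 < degree Q"
  shows "min (truncation v Q f) (truncation v Q g) \<le> truncation v Q (f + g)"
  unfolding truncation_ge_iff[of Q v, OF assms zero]
proof
  fix j
  have "min (term_value v Q f j) (term_value v Q g j) \<le> term_value v Q (f + g) j"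
    unfolding term_value_def expansion_add[OF assms]
    using add[of "expansion Q f j" "expansion Q g j"] by (rule min_add_le)
  then show "min (truncation v Q f) (truncation v Q g) \<le> term_value v Q (f + g) j"
    using truncation_le[of Q v, OF assms zero, of f j] truncation_le[of Q v, OF assms zero, of g j]
    by (meson min.mono order_trans)
qed

lemma truncation_le_val:
  assumes "0 < degree Q"
  shows "truncation v Q f \<le> v f"
using assms proof (induction f rule: adic_induct)
  case (small f)
  then show ?case by (simp add: truncation_small assms)
next
  case (step c h)
  have "v Q + truncation v Q h \<le> v (Q * h)" using step by (auto simp: mult intro: add_left_mono)
  then show ?case unfolding truncation_step[of Q v, OF assms zero step.hyps(1)]
    by (intro add_ge) (auto intro: min.coboundedI2)
qed

context
  fixes Q :: "'k poly"
  assumes key_poly: "key_poly Q" and vQ: "v Q \<noteq> Infty"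
    and degP: "degree Q \<le> degree P"
begin

private abbreviation (input) T where "T \<equiv> truncation v Q"

lemma small_Infty: "degree c < degree Q \<Longrightarrow> v c = Infty \<longleftrightarrow> c = 0"
  using finite_value[of c] degP by auto

text \<open>
  By the ultrametric inequality it suffices to multiply two terms. There
  \<open>f g = r + q Q\<close> with \<open>v r = v (f g)\<close>, so \<open>q Q = f g - r\<close> has at least that value too.
\<close>

lemma truncation_mult_ge: "T f + T g \<le> T (f * g)"
proof -
  note dp = key_polyD(2)[OF key_poly]
  note step' = truncation_step[of Q v, OF dp zero]
  have 1: "v f + v g \<le> T (f * g)"
    if f: "degree f < degree Q" and g: "degree g < degree Q" for f g
  proof -
    have m: "v ((f * g) mod Q) = v f + v g" using key_polyD(3)[OF key_poly f g] by (simp add: mult)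
    have "Q * ((f * g) div Q) = f * g - (f * g) mod Q" by (simp add: minus_mod_eq_mult_div)
    then have "v f + v g \<le> v (Q * ((f * g) div Q))"
      using diff_ge[of "v f + v g" "f * g" "(f * g) mod Q"] m by (simp add: mult)
    moreover have "T ((f * g) div Q) = v ((f * g) div Q)"
      by (rule truncation_small[of Q v, OF dp zero degree_quotient_less[OF f g]])
    ultimately show ?thesis
      unfolding truncation_rec[of Q v, OF dp zero, of "f * g"] by (simp add: mult m)
  qed
  have 2: "T f + v g \<le> T (f * g)" if g: "degree g < degree Q" for f g
  using dp proof (induction f rule: adic_induct)
    case (small f)
    then show ?case using 1[OF small g] by (simp add: truncation_small dp)
  next
    case (step c h)
    have "min (v c) (v Q + T h) + v g \<le> T (c * g)"
      using 1[OF step(1) g] by (meson add_right_mono min.cobounded1 order_trans)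
    moreover have "min (v c) (v Q + T h) + v g \<le> T (Q * (h * g))"
    proof -
      have "min (v c) (v Q + T h) + v g \<le> (v Q + T h) + v g" by (intro add_right_mono) simp
      also have "\<dots> \<le> v Q + T (h * g)" using add_left_mono[OF step.IH, of "v Q"] by (simp add: add.assoc)
      finally show ?thesis unfolding truncation_mult_Q[of Q v, OF dp zero] .
    qed
    ultimately show ?case
      using truncation_add[OF dp, of "c * g" "Q * (h * g)"] unfolding step'[OF step(1)]
      by (simp add: algebra_simps) (meson min.boundedI order_trans)
  qed
  show ?thesis
  using dp proof (induction g rule: adic_induct)
    case (small g)
    then show ?case using 2[OF small] by (simp add: truncation_small dp)
  next
    case (step c h)
    have "T f + min (v c) (v Q + T h) \<le> T (f * c)"
      using 2[OF step(1), of f] by (meson add_left_mono min.cobounded1 order_trans)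
    moreover have "T f + min (v c) (v Q + T h) \<le> T (Q * (f * h))"
    proof -
      have "T f + min (v c) (v Q + T h) \<le> T f + (v Q + T h)" by (intro add_left_mono) simp
      also have "\<dots> \<le> v Q + T (f * h)"
        using add_left_mono[OF step.IH, of "v Q"] by (simp add: ac_simps)
      finally show ?thesis unfolding truncation_mult_Q[of Q v, OF dp zero] .
    qed
    ultimately show ?case
      using truncation_add[OF dp, of "f * c" "Q * (f * h)"] unfolding step'[OF step(1)]
      by (simp add: algebra_simps) (meson min.boundedI order_trans)
  qed
qed

text \<open>
  Cuts \<open>f\<close> at the first place \<open>j\<close> where the minimum is attained. As the part below has strictly larger
  value, it can be neglected in products.
\<close>

lemma truncation_initial:
  assumes "f \<noteq> 0"
  shows "\<exists>A j h. f = A + Q ^ j * h \<and> T f < T A \<and> T f = j \<star> v Q + v (h mod Q)"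
  using key_polyD(2)[OF key_poly] assms
proof (induction f rule: adic_induct)
  case (small f)
  then have "T f < T 0" using small_Infty key_polyD(2)[OF key_poly] by (simp add: truncation_small)
  then show ?case using small key_polyD(2)[OF key_poly]
    by (intro exI[of _ 0] exI[of _ 0] exI[of _ f]) (auto simp: truncation_small mod_poly_less)
next
  case (step c h)
  note dp = key_polyD(2)[OF key_poly]
  note st = truncation_step[of Q v, OF dp zero step(1)]
  have fin: "T (c + Q * h) \<noteq> Infty"
    using truncation_eq_Infty_iff[of Q v, OF dp zero vQ small_Infty] step(4) by blast
  show ?case
  proof (cases "v c \<le> v Q + T h")
    case True
    then have "T (c + Q * h) = v ((c + Q * h) mod Q)"
      using st[of h] adic_mod[OF dp step.hyps(1), of h] by (simp add: min_def)
    moreover have "T (c + Q * h) < T 0" using fin truncation_0[of Q v, OF dp zero] by simp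
    ultimately show ?thesis
      by (intro exI[of _ 0] exI[of _ 0] exI[of _ "c + Q * h"]) simp
  next
    case False
    obtain A j h' where IH: "h = A + Q ^ j * h'" "T h < T A" "T h = j \<star> v Q + v (h' mod Q)"
      using step by blast
    have "c + Q * h = (c + Q * A) + Q ^ Suc j * h'" by (simp add: IH(1) algebra_simps)
    moreover have "T (c + Q * h) < T (c + Q * A)"
      unfolding truncation_step[of Q v, OF dp zero step(1)] using False IH(2) vQ
      by (auto simp: min_def vval_add_left_cancel)
    moreover have "T (c + Q * h) = Suc j \<star> v Q + v (h' mod Q)"
      using st False IH(3) by (simp add: min_def add.assoc)
    ultimately show ?thesis by blast
  qed
qed

text \<open>
  Only the upper bound is left. Up to terms of larger value \<open>f g\<close> is \<open>Q\<^sup>j\<^sup>+\<^sup>k h l\<close>, and its truncation is bounded by the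
  value of the coefficient of \<open>Q\<^sup>j\<^sup>+\<^sup>k\<close>, the remainder of \<open>h l\<close>.
\<close>

lemma truncation_mult: "T (f * g) = T f + T g"
proof (cases "f = 0 \<or> g = 0")
  case True
  then show ?thesis using key_polyD(2)[OF key_poly] by (auto simp: truncation_0)
next
  case False
  note dp = key_polyD(2)[OF key_poly]
  note inf = truncation_eq_Infty_iff[of Q v, OF dp zero vQ small_Infty]
  obtain A j h where f: "f = A + Q ^ j * h" "T f < T A" "T f = j \<star> v Q + v (h mod Q)"
    using truncation_initial False by blast
  obtain B k l where g: "g = B + Q ^ k * l" "T g < T B" "T g = k \<star> v Q + v (l mod Q)"
    using truncation_initial False by blast
  have fin: "T f \<noteq> Infty" "T g \<noteq> Infty" using inf False by auto
  define U where "U = A * g + (Q ^ j * h) * B"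
  define W where "W = Q ^ (j + k) * (h * l)"
  have XY: "f * g = U + W" unfolding U_def W_def f(1) g(1) by (simp add: algebra_simps power_add)
  have "T f + T g < T (A * g)"
    using truncation_mult_ge[of A g] vval_add_less_le_mono(1)[OF f(2) order_refl fin(2)] by auto
  moreover have "T f \<le> T (Q ^ j * h)"
    using truncation_add[OF dp, of f "- A"] truncation_mult_ge[of "-1" A] f fin
      truncation_small[of Q v "-1", OF dp zero] dp
    by (auto simp: one min_def split: if_splits)
  then have "T f + T g < T (Q ^ j * h * B)"
    using truncation_mult_ge[of "Q ^ j * h" B] vval_add_less_le_mono(2)[OF g(2) _ fin(1)]
    by (meson order_less_le_trans)
  ultimately have U: "T f + T g < T U"
    using truncation_add[OF dp, of "A * g" "(Q ^ j * h) * B"] unfolding U_def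
    by (meson min_less_iff_conj order_less_le_trans)
  have "(h * l) mod Q = ((h mod Q) * (l mod Q)) mod Q" by (simp add: mod_mult_eq)
  then have "v ((h * l) mod Q) = v (h mod Q) + v (l mod Q)"
    using key_polyD(3)[OF key_poly degree_mod_less_nz[OF dp] degree_mod_less_nz[OF dp], of h l] by (simp add: mult)
  then have W: "T W \<le> T f + T g"
    unfolding W_def truncation_mult_power[of Q v, OF dp zero] f(3) g(3)
    using truncation_le_mod[of Q v, OF dp zero, of "h * l"]
    by (simp add: nmult_add_left ac_simps add_left_mono)
  have "T (f * g) \<le> T f + T g"
  proof (rule ccontr)
    assume "\<not> ?thesis"
    then have "T f + T g < min (T (f * g)) (T (-1 * U))"
      using U truncation_mult_ge[of "-1" U] truncation_small[of Q v "-1", OF dp zero] dp by (auto simp: one)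
    then have "T f + T g < T (f * g + -1 * U)" using truncation_add[OF dp, of "f * g" "-1 * U"]
      by (meson order_less_le_trans)
    then show False using W XY by simp
  qed
  then show ?thesis using truncation_mult_ge by (simp add: antisym)
qed

lemma truncation_pseudo_valuation: "pseudo_valuation T 0"
proof
  show "T (f * g) = T f + T g" for f g by (rule truncation_mult)
  show "min (T f) (T g) \<le> T (f + g)" for f g by (rule truncation_add[OF key_polyD(2)[OF key_poly]])
  show "T 1 = 0" using truncation_small[of Q v 1] key_polyD(2)[OF key_poly] one by simp
  show "T f = Infty \<longleftrightarrow> 0 dvd f" for f
    using truncation_eq_Infty_iff[of Q v, OF key_polyD(2)[OF key_poly] zero vQ small_Infty] by simp
qed

end

text \<open>
  If \<open>w c < w (c + Q a)\<close>, the two summands have the same value under \<open>w\<close>. Under \<open>v\<close> the second one is strictly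
  larger, since \<open>Q\<close> gains value when passing from \<open>w\<close> to \<open>v\<close>. Then \<open>v (c + Q a) = v c = w c < w (c + Q a)\<close>,
  against \<open>w \<le> v\<close>.
\<close>

lemma remainder_value:
  assumes w: "pseudo_valuation w 0" and le: "\<And>f. w f \<le> v f"
    and Q: "w Q < v Q" and c: "w c = v c"
  shows "w (c + Q * a) \<le> w c"
proof (rule ccontr)
  interpret w: pseudo_valuation w 0 by (rule w)
  assume "\<not> ?thesis"
  then have less: "w c < w (c + Q * a)" by simp
  have "w (Q * a) = w c"
    using w.add_eq_left[of "- c" "c + Q * a"] less by simp
  moreover have "a \<noteq> 0" using less by auto
  then have "w a \<noteq> Infty" using w.support[of a] by simp
  then have "w (Q * a) < v (Q * a)"
    unfolding w.mult mult by (intro vval_add_less_le_mono(1) Q le)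
  ultimately have "v (c + Q * a) = v c" using c by (intro add_eq_left) simp
  then show False using less le[of "c + Q * a"] c by simp
qed

text \<open>
  For the truncation \<open>w\<close> at an earlier key polynomial, this is how truncations increase along a family.
  The coefficients \<open>c\<close> of the expansion have value at least \<open>w f\<close> by \<open>remainder_value\<close>.
\<close>

lemma truncation_ge:
  assumes w: "pseudo_valuation w 0" and le: "\<And>f. w f \<le> v f"
    and Q: "w Q < v Q" "0 < degree Q"
    and c: "\<And>j. w (expansion Q f j) = v (expansion Q f j)"
  shows "w f \<le> truncation v Q f"
  using Q(2) c
proof (induction f rule: adic_induct)
  case (small f)
  then show ?case using le by (simp add: truncation_small Q)
next
  case (step c h)
  interpret w: pseudo_valuation w 0 by (rule w)
  have wc: "w c = v c" using step.prems[of 0] step.hyps(1) Q(2) by (simp add: expansion_0 mod_poly_less)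
  have wh: "w h \<le> truncation v Q h"
  proof (rule step.IH)
    show "w (expansion Q h j) = v (expansion Q h j)" for j
      using step.prems[of "Suc j"] step.hyps(1) Q(2) by (simp add: expansion_Suc adic_div)
  qed
  have 1: "w (c + Q * h) \<le> w c" by (rule remainder_value[OF w le Q(1) wc])
  then have "w (c + Q * h) \<le> w (Q * h)"
    using w.diff_ge[of "w (c + Q * h)" "c + Q * h" c] by simp
  also have "\<dots> \<le> v Q + truncation v Q h"
    unfolding w.mult using Q(1) by (intro add_mono wh) auto
  finally show ?case using 1 wc by (simp add: truncation_step Q step.hyps(1))
qed

text \<open>
  A polynomial of least degree among those gaining value over \<open>w\<close> (or over a directed family of such
  \<open>w\<close>, whence the finite set \<open>F\<close>) has this property. By \<open>remainder_value\<close>, the remainder of a product \<open>f g\<close> has at least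
  the value of \<open>f g\<close>. If it were larger, the quotient part \<open>Q a\<close> would have the value of \<open>f g\<close> under both \<open>v\<close> and \<open>w\<close>, although \<open>Q\<close>
  gains value.
\<close>

lemma key_polyI:
  assumes "lead_coeff Q = 1" "0 < degree Q"
    and ex: "\<And>F. finite F \<Longrightarrow> (\<And>f. f \<in> F \<Longrightarrow> degree f < degree Q) \<Longrightarrow>
       \<exists>w. pseudo_valuation w 0 \<and> (\<forall>f. w f \<le> v f) \<and> w Q < v Q \<and> (\<forall>f\<in>F. w f = v f)"
  shows "key_poly Q"
  unfolding key_poly_def
proof (intro conjI assms(1,2) allI impI)
  fix f g :: "'k poly"
  assume f: "degree f < degree Q" and g: "degree g < degree Q"
  define c a where "c = (f * g) mod Q" and "a = (f * g) div Q"
  have fg: "f * g = c + Q * a" by (simp add: c_def a_def)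
  obtain w where w: "pseudo_valuation w 0" "\<And>f. w f \<le> v f" "w Q < v Q"
    "w f = v f" "w g = v g" "w c = v c"
    using ex[of "{f, g, c}"] f g degree_mod_less_nz[OF assms(2), of "f * g"] unfolding c_def by auto
  interpret w: pseudo_valuation w 0 by (rule w)
  have wfg: "w (f * g) = v (f * g)" using w by (simp add: mult w.mult)
  have le: "v (f * g) \<le> v c"
    using remainder_value[OF w(1,2,3,6), of a] fg wfg w(6) by simp
  show "v ((f * g) mod Q) = v (f * g)"
  proof (rule ccontr)
    assume "v ((f * g) mod Q) \<noteq> v (f * g)"
    then have less: "v (f * g) < v c" using le by (simp add: c_def)
    have "v (Q * a) = v (f * g)"
      using add_eq_left[of "f * g" "- c"] less fg by simp
    moreover have "w (Q * a) = w (f * g)"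
      using w.add_eq_left[of "f * g" "- c"] less fg wfg w(6) by simp
    moreover have "a \<noteq> 0" using less fg by auto
    then have "w a \<noteq> Infty" using w.support[of a] by simp
    then have "w (Q * a) < v (Q * a)"
      unfolding w.mult mult by (intro vval_add_less_le_mono(1) w)
    ultimately show False using wfg by simp
  qed
qed

lemma residue_pseudo_valuation:
  assumes key_poly: "key_poly Q" and degP: "degree Q \<le> degree P"
  shows "pseudo_valuation (\<lambda>f. v (f mod Q)) Q"
proof
  note dp = key_polyD(2)[OF key_poly]
  fix f g
  have "(f * g) mod Q = ((f mod Q) * (g mod Q)) mod Q" by (simp add: mod_mult_eq)
  then show "v ((f * g) mod Q) = v (f mod Q) + v (g mod Q)"
    using key_polyD(3)[OF key_poly degree_mod_less_nz[OF dp] degree_mod_less_nz[OF dp], of f g] by (simp add: mult)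
  show "min (v (f mod Q)) (v (g mod Q)) \<le> v ((f + g) mod Q)"
    using add by (simp add: poly_mod_add_left)
  show "v (1 mod Q) = 0" using dp by (simp add: mod_poly_less one)
  show "v (f mod Q) = Infty \<longleftrightarrow> Q dvd f"
    using finite_value[of "f mod Q"] degree_mod_less_nz[OF dp, of f] degP
    by (auto simp: dvd_eq_mod_eq_0)
qed

lemma support_prime:
  assumes "P dvd f * g"
  shows "P dvd f \<or> P dvd g"
  using assms support mult by (metis plus_eq_Infty_iff)

end

section \<open>Integral elements\<close>

locale field_subring =
  fixes R :: "'e::field set"
  assumes one_in: "1 \<in> R" and diff_in: "x \<in> R \<Longrightarrow> y \<in> R \<Longrightarrow> x - y \<in> R"
    and mult_in: "x \<in> R \<Longrightarrow> y \<in> R \<Longrightarrow> x * y \<in> R"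
begin

lemma zero_in: "0 \<in> R"
  using diff_in[OF one_in one_in] by simp

lemma minus_in: "x \<in> R \<Longrightarrow> - x \<in> R"
  using diff_in[OF zero_in] by fastforce

lemma add_in: "x \<in> R \<Longrightarrow> y \<in> R \<Longrightarrow> x + y \<in> R"
  using diff_in[OF _ minus_in, of x y] by simp

lemma sum_in: "(\<And>i. i \<in> I \<Longrightarrow> f i \<in> R) \<Longrightarrow> (\<Sum>i\<in>I. f i) \<in> R"
  by (induction I rule: infinite_finite_induct) (auto intro: add_in zero_in)

lemma polys_const: "c \<in> R \<Longrightarrow> [:c:] \<in> polys_over R"
  by (auto simp: polys_over_def coeff_pCons zero_in split: nat.splits)

lemma polys_add: "p \<in> polys_over R \<Longrightarrow> q \<in> polys_over R \<Longrightarrow> p + q \<in> polys_over R"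
  by (auto simp: polys_over_def intro: add_in)

lemma polys_mult: "p \<in> polys_over R \<Longrightarrow> q \<in> polys_over R \<Longrightarrow> p * q \<in> polys_over R"
  by (auto simp: polys_over_def coeff_mult intro!: sum_in mult_in)

lemma polys_sum: "(\<And>i. i \<in> I \<Longrightarrow> f i \<in> polys_over R) \<Longrightarrow> (\<Sum>i\<in>I. f i) \<in> polys_over R"
  using polys_const[OF zero_in]
  by (induction I rule: infinite_finite_induct) (auto intro: polys_add)

lemma polys_prod: "(\<And>i. i \<in> I \<Longrightarrow> f i \<in> polys_over R) \<Longrightarrow> (\<Prod>i\<in>I. f i) \<in> polys_over R"
  using polys_const[OF one_in]
  by (induction I rule: infinite_finite_induct) (auto intro: polys_mult simp: one_pCons)

lemma polys_pCons: "c \<in> R \<Longrightarrow> p \<in> polys_over R \<Longrightarrow> pCons c p \<in> polys_over R"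
  by (auto simp: polys_over_def coeff_pCons split: nat.splits)

definition integral :: "'e \<Rightarrow> bool" where
  "integral z \<longleftrightarrow> (\<exists>p \<in> polys_over R. lead_coeff p = 1 \<and> poly p z = 0)"

lemma char_poly_over:
  assumes "A \<in> carrier_mat n n" "\<And>i j. i < n \<Longrightarrow> j < n \<Longrightarrow> A $$ (i, j) \<in> R"
  shows "char_poly A \<in> polys_over R"
proof -
  have entry: "char_poly_matrix A $$ (i, j) \<in> polys_over R" if "i < n" "j < n" for i j
  proof -
    have "pCons 0 1 \<in> polys_over R"
      unfolding one_pCons by (intro polys_pCons polys_const zero_in one_in)
    moreover have "[:- (A $$ (i, j)):] \<in> polys_over R"
      using assms(2)[OF that] by (intro polys_const minus_in)
    ultimately show ?thesis
      using that assms(1) unfolding char_poly_matrix_def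
      by (auto intro!: polys_add simp del: add_pCons)
  qed
  have sgn: "signof p \<in> polys_over R" for p :: "nat \<Rightarrow> nat"
    using polys_const[OF one_in] polys_const[OF minus_in[OF one_in]]
    by (cases p rule: sign_cases) (auto simp: one_pCons)
  show ?thesis
    unfolding char_poly_def det_def'[OF char_poly_matrix_closed[OF assms(1)]]
    by (intro polys_sum polys_mult polys_prod entry sgn) (auto simp: permutes_in_image)
qed

text \<open>
  An element \<open>u\<close> that maps a finitely generated module into itself is an eigenvalue of a matrix over \<open>R\<close>, hence a root
  of its characteristic polynomial.
\<close>

lemma integral_module:
  assumes fin: "finite I" and i0: "i0 \<in> I" "w i0 \<noteq> 0"
    and ex: "\<And>i. i \<in> I \<Longrightarrow> \<exists>a. (\<forall>j\<in>I. a j \<in> R) \<and> u * w i = (\<Sum>j\<in>I. a j * w j)"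
  shows "integral u"
proof -
  obtain n and e :: "nat \<Rightarrow> 'a" where e: "bij_betw e {0..<n} I"
    using ex_bij_betw_nat_finite[OF fin] by blast
  obtain a where a: "\<And>i j. i \<in> I \<Longrightarrow> j \<in> I \<Longrightarrow> a i j \<in> R"
    "\<And>i. i \<in> I \<Longrightarrow> u * w i = (\<Sum>j\<in>I. a i j * w j)"
    using ex by metis
  have eI: "i < n \<Longrightarrow> e i \<in> I" for i using e by (auto simp: bij_betw_def)
  define A where "A = mat n n (\<lambda>(i, j). a (e i) (e j))"
  define x where "x = vec n (\<lambda>i. w (e i))"
  have A: "A \<in> carrier_mat n n" by (simp add: A_def)
  have "A *\<^sub>v x = u \<cdot>\<^sub>v x"
  proof (rule eq_vecI)
    fix i assume "i < dim_vec (u \<cdot>\<^sub>v x)"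
    then have i: "i < n" by (simp add: x_def)
    have "(A *\<^sub>v x) $ i = (\<Sum>j\<in>{0..<n}. a (e i) (e j) * w (e j))"
      using i by (simp add: A_def x_def scalar_prod_def)
    also have "\<dots> = (\<Sum>j\<in>I. a (e i) j * w j)"
      by (rule sum.reindex_bij_betw[OF e])
    also have "\<dots> = u * w (e i)" using a(2)[OF eI[OF i]] by simp
    finally show "(A *\<^sub>v x) $ i = (u \<cdot>\<^sub>v x) $ i" using i by (simp add: x_def)
  qed (simp add: A_def x_def)
  moreover have "x \<noteq> 0\<^sub>v n"
  proof
    assume x0: "x = 0\<^sub>v n"
    obtain k where "k < n" "e k = i0" using e i0(1) by (auto simp: bij_betw_def)
    then show False using x0 i0(2) by (metis index_vec index_zero_vec(1) x_def)
  qed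
  ultimately have "eigenvalue A u"
    unfolding eigenvalue_def eigenvector_def using A by (intro exI[of _ x]) (auto simp: x_def)
  then have "poly (char_poly A) u = 0" using eigenvalue_root_char_poly[OF A] by simp
  moreover have "char_poly A \<in> polys_over R"
    by (rule char_poly_over[OF A]) (auto simp: A_def intro: a(1) eI)
  moreover have "lead_coeff (char_poly A) = 1" using degree_monic_char_poly[OF A] by simp
  ultimately show ?thesis unfolding integral_def by blast
qed

lemma integral_power_span:
  assumes "integral z"
  obtains d where "0 < d"
    "\<And>i. i < d \<Longrightarrow> \<exists>a. (\<forall>j<d. a j \<in> R) \<and> z * z ^ i = (\<Sum>j<d. a j * z ^ j)"
proof -
  obtain p where p: "p \<in> polys_over R" "lead_coeff p = 1" "poly p z = 0"
    using assms unfolding integral_def by blast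
  define d where "d = degree p"
  have "0 < d"
  proof (rule ccontr)
    assume "\<not> 0 < d"
    then obtain c where "p = [:c:]" by (metis d_def degree_eq_zeroE gr0I)
    then show False using p by simp
  qed
  have "(\<Sum>j\<le>d. coeff p j * z ^ j) = 0" using p(3) by (simp add: poly_altdef d_def)
  then have top: "z ^ d = (\<Sum>j<d. - coeff p j * z ^ j)"
    using p(2) by (simp add: lessThan_Suc_atMost[symmetric] d_def sum_negf eq_neg_iff_add_eq_0 add.commute)
  have "\<exists>a. (\<forall>j<d. a j \<in> R) \<and> z * z ^ i = (\<Sum>j<d. a j * z ^ j)" if "i < d" for i
  proof (cases "Suc i < d")
    case True
    have "z * z ^ i = (\<Sum>j<d. (if j = Suc i then 1 else 0) * z ^ j)"
      using True by (simp add: if_distrib[of "\<lambda>x. x * _"] cong: if_cong)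
    then show ?thesis by (intro exI[of _ "\<lambda>j. if j = Suc i then 1 else 0"]) (auto simp: one_in zero_in)
  next
    case False
    then have "d = Suc i" using that by simp
    then show ?thesis using top p(1)
      by (intro exI[of _ "\<lambda>j. - coeff p j"]) (auto simp: polys_over_def intro: minus_in)
  qed
  then show ?thesis using that[OF \<open>0 < d\<close>] by blast
qed

text \<open>
  The products \<open>y\<^sup>i z\<^sup>j\<close> span a module that multiplication by \<open>y z\<close> preserves.
\<close>

lemma integral_mult:
  assumes "integral y" "integral z"
  shows "integral (y * z)"
proof -
  obtain d where d: "0 < d"
    "\<And>i. i < d \<Longrightarrow> \<exists>a. (\<forall>j<d. a j \<in> R) \<and> y * y ^ i = (\<Sum>j<d. a j * y ^ j)"
    using integral_power_span[OF assms(1)] by blast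
  obtain e where e: "0 < e"
    "\<And>i. i < e \<Longrightarrow> \<exists>a. (\<forall>j<e. a j \<in> R) \<and> z * z ^ i = (\<Sum>j<e. a j * z ^ j)"
    using integral_power_span[OF assms(2)] by blast
  show ?thesis
  proof (rule integral_module[of "{..<d} \<times> {..<e}" "(0, 0)" "\<lambda>(i, j). y ^ i * z ^ j"])
    fix k assume "k \<in> {..<d} \<times> {..<e}"
    then obtain i j where k: "k = (i, j)" "i < d" "j < e" by auto
    obtain a where a: "\<forall>l<d. a l \<in> R" "y * y ^ i = (\<Sum>l<d. a l * y ^ l)" using d(2) k by blast
    obtain b where b: "\<forall>l<e. b l \<in> R" "z * z ^ j = (\<Sum>l<e. b l * z ^ l)" using e(2) k by blast
    have "(y * z) * (y ^ i * z ^ j) = (\<Sum>l<d. a l * y ^ l) * (\<Sum>m<e. b m * z ^ m)"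
      unfolding a(2)[symmetric] b(2)[symmetric] by (simp add: algebra_simps)
    also have "\<dots> = (\<Sum>(l, m)\<in>{..<d} \<times> {..<e}. (a l * y ^ l) * (b m * z ^ m))"
      by (simp add: sum_product sum.cartesian_product)
    also have "\<dots> = (\<Sum>lm\<in>{..<d} \<times> {..<e}. (case lm of (l, m) \<Rightarrow> a l * b m) *
        (case lm of (l, m) \<Rightarrow> y ^ l * z ^ m))"
      by (intro sum.cong) (auto simp: algebra_simps)
    finally show "\<exists>a. (\<forall>j\<in>{..<d} \<times> {..<e}. a j \<in> R) \<and>
        (y * z) * (case k of (i, j) \<Rightarrow> y ^ i * z ^ j) =
        (\<Sum>j\<in>{..<d} \<times> {..<e}. a j * (case j of (i, j) \<Rightarrow> y ^ i * z ^ j))"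
      using a(1) b(1) k by (intro exI[of _ "\<lambda>(l, m). a l * b m"]) (auto intro: mult_in)
  qed (use d(1) e(1) in auto)
qed

lemma integral_in: "c \<in> R \<Longrightarrow> integral c"
  unfolding integral_def
  by (intro bexI[of _ "[:- c, 1:]"]) (auto intro!: polys_pCons minus_in one_in polys_const zero_in)

lemma integral_prod_mset: "(\<And>z. z \<in># A \<Longrightarrow> integral (f z)) \<Longrightarrow> integral (prod_mset (image_mset f A))"
  by (induction A) (auto intro: integral_mult integral_in one_in)

lemma integral_power: "integral z \<Longrightarrow> integral (z ^ n)"
  by (induction n) (auto intro: integral_mult integral_in one_in)

text \<open>
  For a relation \<open>\<Sum> c\<^sub>j g\<^sup>j = 0\<close> that need not be monic, the tails \<open>y = \<Sum>\<^sub>j\<^sub>\<ge>\<^sub>k c\<^sub>j g\<^sup>j\<^sup>-\<^sup>k\<close> are integral: \<open>y g\<^sup>i\<close> is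
  visibly a combination of \<open>1, \<dots>, g\<^sup>n\<^sup>-\<^sup>1\<close> for \<open>i < k\<close>, and for \<open>i \<ge> k\<close> the relation rewrites it as one. As this works
  up to \<open>i = n\<close>, the product \<open>y g\<close> is integral as well, which exhibits \<open>g\<close> as a quotient of integral elements.
\<close>

lemma integral_tail:
  assumes c: "\<And>j. j \<le> n \<Longrightarrow> c j \<in> R" and rel: "(\<Sum>j\<le>n. c j * g ^ j) = 0"
    and k: "1 \<le> k" "k \<le> n"
  defines "y \<equiv> (\<Sum>j=k..n. c j * g ^ (j - k))"
  shows "integral y" "integral (y * g)"
proof -
  define N where "N = {x. \<exists>a. (\<forall>l<n. a l \<in> R) \<and> x = (\<Sum>l<n. a l * g ^ l)}"
  have N_add: "x + x' \<in> N" if xN: "x \<in> N" and x'N: "x' \<in> N" for x x'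
  proof -
    obtain a where "\<forall>l<n. a l \<in> R" "x = (\<Sum>l<n. a l * g ^ l)"
      using xN unfolding N_def by blast
    moreover obtain a' where "\<forall>l<n. a' l \<in> R" "x' = (\<Sum>l<n. a' l * g ^ l)"
      using x'N unfolding N_def by blast
    ultimately show ?thesis unfolding N_def
      by (auto intro!: exI[of _ "\<lambda>l. a l + a' l"] add_in simp: sum.distrib[symmetric] distrib_right)
  qed
  have N_single: "r * g ^ l \<in> N" if "r \<in> R" "l < n" for r l
  proof -
    have "r * g ^ l = (\<Sum>m<n. (if m = l then r else 0) * g ^ m)"
      using that by (simp add: if_distrib[of "\<lambda>x. x * _"] cong: if_cong)
    then show ?thesis unfolding N_def using that
      by (auto intro!: exI[of _ "\<lambda>m. if m = l then r else 0"] simp: zero_in)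
  qed
  have N_zero: "0 \<in> N" using N_single[of 0 0] zero_in k by simp
  have N_sum: "(\<Sum>i\<in>I. F i) \<in> N" if "\<And>i. i \<in> I \<Longrightarrow> F i \<in> N" for I and F :: "nat \<Rightarrow> 'e"
    using that by (induction I rule: infinite_finite_induct) (auto intro: N_add N_zero)
  have yN: "y * g ^ i \<in> N" if "i \<le> n" for i
  proof (cases "i < k")
    case True
    have "y * g ^ i = (\<Sum>j=k..n. c j * g ^ (j - k + i))"
      unfolding y_def sum_distrib_right by (simp only: power_add mult.assoc)
    then show ?thesis using True k by (auto intro!: N_sum N_single c)
  next
    case False
    have split: "{..n} = {..<k} \<union> {k..n}" using k by auto
    have "(\<Sum>j<k. c j * g ^ j) + (\<Sum>j=k..n. c j * g ^ j) = 0"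
      using rel unfolding split by (subst (asm) sum.union_disjoint) auto
    moreover have "(\<Sum>j=k..n. c j * g ^ j) = y * g ^ k"
      unfolding y_def sum_distrib_right by (intro sum.cong) (auto simp: mult.assoc simp flip: power_add)
    ultimately have "y * g ^ k = (\<Sum>j<k. - c j * g ^ j)"
      by (simp add: sum_negf eq_neg_iff_add_eq_0 add.commute)
    moreover have "y * g ^ i = y * g ^ k * g ^ (i - k)"
      using False by (simp add: mult.assoc flip: power_add)
    ultimately have "y * g ^ i = (\<Sum>j<k. - c j * g ^ (j + (i - k)))"
      by (simp add: sum_distrib_right power_add mult.assoc)
    moreover have "- c j * g ^ (j + (i - k)) \<in> N" if "j < k" for j
      using False that \<open>i \<le> n\<close> k by (intro N_single minus_in c) auto
    ultimately show ?thesis using N_sum[of "{..<k}" "\<lambda>j. - c j * g ^ (j + (i - k))"] by simp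
  qed
  have n: "0 < n" using k by simp
  show "integral y"
  proof (rule integral_module[of "{..<n}" 0 "\<lambda>i. g ^ i"])
    fix i assume "i \<in> {..<n}"
    then show "\<exists>a. (\<forall>j\<in>{..<n}. a j \<in> R) \<and> y * g ^ i = (\<Sum>j<n. a j * g ^ j)"
      using yN[of i] unfolding N_def by auto
  qed (use n in auto)
  show "integral (y * g)"
  proof (rule integral_module[of "{..<n}" 0 "\<lambda>i. g ^ i"])
    fix i assume "i \<in> {..<n}"
    then show "\<exists>a. (\<forall>j\<in>{..<n}. a j \<in> R) \<and> y * g * g ^ i = (\<Sum>j<n. a j * g ^ j)"
      using yN[of "Suc i"] unfolding N_def by (auto simp: mult.assoc)
  qed (use n in auto)
qed

text \<open>
  The inverse is a root of the reflected polynomial.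
\<close>

lemma integral_inverse:
  assumes h: "h \<in> polys_over R" "poly h z = 0" "z \<noteq> 0"
    and c: "coeff h 0 \<noteq> 0" "inverse (coeff h 0) \<in> R"
  shows "integral (inverse z)"
proof -
  let ?p = "smult (inverse (coeff h 0)) (reflect_poly h)"
  have "?p \<in> polys_over R"
    using h(1) c(2) by (auto simp: polys_over_def coeff_reflect_poly zero_in intro: mult_in)
  moreover have "lead_coeff ?p = 1" using c(1) by (simp add: coeff_reflect_poly)
  moreover have "poly ?p (inverse z) = 0"
    using h(2,3) by (simp add: poly_reflect_poly_nz)
  ultimately show ?thesis unfolding integral_def by blast
qed

end

section \<open>Minimal polynomials\<close>

interpretation to_ac: inj_comm_ring_hom to_ac
  by unfold_locales auto

interpretation map_ac: map_poly_inj_comm_ring_hom to_ac ..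

abbreviation ev :: "'k::field poly \<Rightarrow> 'k alg_closure \<Rightarrow> 'k alg_closure" where
  "ev f z \<equiv> poly (map_poly to_ac f) z"

lemma ev_simps [simp]:
  "ev (f + g) z = ev f z + ev g z" "ev (f * g) z = ev f z * ev g z" "ev (f ^ n) z = ev f z ^ n"
  "ev (smult c f) z = to_ac c * ev f z" "ev (pCons c f) z = to_ac c + z * ev f z" "ev 0 z = 0" "ev 1 z = 1"
  "ev (f - g) z = ev f z - ev g z" "ev (\<Sum>i\<in>I. F i) z = (\<Sum>i\<in>I. ev (F i) z)"
  by (simp_all add: hom_distribs map_ac.hom_mult map_ac.hom_power map_ac.hom_minus map_ac.hom_sum poly_sum)

lemma ev_pcompose: "ev (pcompose h y) z = ev h (ev y z)"
  by (induction h) (simp_all add: pcompose_pCons)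

lemma minimal_polynomial:
  fixes z :: "'k::field alg_closure"
  obtains h :: "'k poly" where "lead_coeff h = 1" "irreducible h"
    "\<And>f. ev f z = 0 \<longleftrightarrow> h dvd f"
proof -
  obtain p0 :: "'k poly" where p0: "p0 \<noteq> 0" "ev p0 z = 0"
    using alg_closure_algebraic by blast
  obtain p :: "'k poly" where p: "p \<noteq> 0 \<and> ev p z = 0"
    and least: "\<And>q. q \<noteq> 0 \<and> ev q z = 0 \<Longrightarrow> degree p \<le> degree q"
    using p0 ex_has_least_nat[of "\<lambda>q :: 'k poly. q \<noteq> 0 \<and> ev q z = 0" p0 degree] by blast
  define h where "h = smult (inverse (lead_coeff p)) p"
  have h: "h \<noteq> 0" "lead_coeff h = 1" "ev h z = 0" "degree h = degree p"
    using p by (auto simp: h_def)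
  have small: "q = 0" if "ev q z = 0" "degree q < degree h" for q
    using least[of q] that h(4) by auto
  have dvd: "ev f z = 0 \<longleftrightarrow> h dvd f" for f
  proof
    assume f: "ev f z = 0"
    have "ev (f mod h) z = ev (f - f div h * h) z" by (simp add: minus_div_mult_eq_mod)
    also have "\<dots> = 0" using f h(3) by simp
    finally have "f mod h = 0"
      using small[of "f mod h"] degree_mod_less[OF h(1), of f] by auto
    then show "h dvd f" by auto
  next
    assume "h dvd f"
    then show "ev f z = 0" using h(3) by auto
  qed
  have "irreducible h"
  proof (rule Factorial_Ring.irreducibleI)
    show "h \<noteq> 0" by (rule h)
    show "\<not> h dvd 1" using dvd[of 1] by simp
    fix a b assume ab: "h = a * b"
    then have "ev a z = 0 \<or> ev b z = 0" using h(3) by simp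
    moreover have nz: "a \<noteq> 0" "b \<noteq> 0" using ab h(1) by auto
    ultimately have "degree h \<le> degree a \<or> degree h \<le> degree b"
      using small[of a] small[of b] by (meson not_le)
    then have "degree b = 0 \<or> degree a = 0"
      unfolding ab using nz by (auto simp: degree_mult_eq)
    then show "a dvd 1 \<or> b dvd 1" using nz by (auto simp: is_unit_iff_degree)
  qed
  then show ?thesis using that h(2) dvd by blast
qed

text \<open>
  An irreducible polynomial is associated to the minimal polynomial of each of its roots.
\<close>

lemma irreducible_root_dvd_iff:
  fixes F :: "'k::field poly"
  assumes F: "irreducible F" "ev F a = 0"
  shows "ev f a = 0 \<longleftrightarrow> F dvd f"
proof -
  obtain h :: "'k poly" where "lead_coeff h = 1" and h: "irreducible h"
    "\<And>f. ev f a = 0 \<longleftrightarrow> h dvd f"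
    using minimal_polynomial[of a] by blast
  obtain q where q: "F = h * q" using h(2) F(2) by blast
  have "q dvd 1" using F(1) h(1) q by (meson Factorial_Ring.irreducibleD Factorial_Ring.irreducible_not_unit)
  then have "F dvd f \<longleftrightarrow> h dvd f" unfolding q by (simp add: mult_unit_dvd_iff)
  then show ?thesis using h(2) by simp
qed

context ring_valuation
begin

lemma sum_unique_min:
  assumes "finite I" "i0 \<in> I" "v (F i0) \<noteq> Infty" "\<And>i. i \<in> I \<Longrightarrow> i \<noteq> i0 \<Longrightarrow> v (F i0) < v (F i)"
  shows "v (\<Sum>i\<in>I. F i) = v (F i0)"
proof -
  have "v (F i0) < v (\<Sum>i\<in>I - {i0}. F i)"
    using assms by (intro sum_gr) auto
  then show ?thesis using assms(1,2) by (simp add: sum.remove add_eq_left)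
qed

end

section \<open>Valuations of henselian fields\<close>

locale valued_field =
  fixes \<mu> :: "'k::field \<Rightarrow> 'g::linordered_ab_group_add vval"
  assumes val: "valuation \<mu>"
begin

sublocale ring_valuation \<mu> 0
proof
  have z: "\<mu> x = Infty \<longleftrightarrow> x = 0" and m: "\<mu> (x * y) = \<mu> x + \<mu> y"
    and a: "min (\<mu> x) (\<mu> y) \<le> \<mu> (x + y)" for x y
    using val unfolding valuation_def by auto
  show "\<mu> (x * y) = \<mu> x + \<mu> y" "min (\<mu> x) (\<mu> y) \<le> \<mu> (x + y)" for x y by (fact m a)+
  show "\<mu> x = Infty \<longleftrightarrow> 0 dvd x" for x using z by simp
  have "\<mu> 1 + 0 = \<mu> 1 + \<mu> 1" "\<mu> 1 \<noteq> Infty" using m[of 1 1] z[of 1] by auto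
  then show "\<mu> 1 = 0" using vval_add_left_cancel(3)[of "\<mu> 1" 0 "\<mu> 1"] by simp
qed

lemma eq_Infty_iff [simp]: "\<mu> x = Infty \<longleftrightarrow> x = 0"
  using support[of x] by simp

lemma value_inverse: "x \<noteq> 0 \<Longrightarrow> \<mu> x + \<mu> (inverse x) = 0"
  using mult[of x "inverse x"] one by simp

lemma integral_inverse_iff: "x \<noteq> 0 \<Longrightarrow> 0 \<le> \<mu> (inverse x) \<longleftrightarrow> \<mu> x \<le> 0"
  using value_inverse[of x] vval_add_left_cancel(1)[of "\<mu> x" 0 "\<mu> (inverse x)"] by simp

lemma value_inverse_0: "\<mu> x = 0 \<Longrightarrow> \<mu> (inverse x) = 0"
  using value_inverse[of x] by (cases "x = 0") auto

sublocale O: field_subring "integers \<mu>"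
  by unfold_locales (auto simp: integers_def one mult intro: diff_ge add_nonneg_nonneg)

sublocale O_ac: field_subring "to_ac ` integers \<mu>"
proof
  show "1 \<in> to_ac ` integers \<mu>" using O.one_in by (metis image_eqI to_ac_1)
  fix x y assume "x \<in> to_ac ` integers \<mu>" "y \<in> to_ac ` integers \<mu>"
  then obtain a b where ab: "x = to_ac a" "y = to_ac b" "a \<in> integers \<mu>" "b \<in> integers \<mu>" by blast
  show "x - y \<in> to_ac ` integers \<mu>" "x * y \<in> to_ac ` integers \<mu>"
    using O.diff_in[OF ab(3,4)] O.mult_in[OF ab(3,4)] unfolding ab(1,2)
    by (metis image_eqI to_ac_diff, metis image_eqI to_ac_mult)
qed

abbreviation integral :: "'k alg_closure \<Rightarrow> bool" where
  "integral \<equiv> O_ac.integral"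

lemma polys_integers_iff: "p \<in> polys_over (integers \<mu>) \<longleftrightarrow> (\<forall>i. 0 \<le> \<mu> (coeff p i))"
  by (auto simp: polys_over_def integers_def)

lemma polys_max_ideal_iff: "p \<in> polys_over (max_ideal \<mu>) \<longleftrightarrow> (\<forall>i. 0 < \<mu> (coeff p i))"
  by (auto simp: polys_over_def max_ideal_def)

lemma lift_integral:
  assumes "p \<in> polys_over (to_ac ` integers \<mu>)"
  obtains p' where "p' \<in> polys_over (integers \<mu>)" "p = map_poly to_ac p'"
proof -
  define p' where "p' = map_poly of_ac p"
  have c: "to_ac (of_ac (coeff p i)) = coeff p i" for i
    using assms by (intro to_ac_of_ac) (auto simp: polys_over_def)
  have "p = map_poly to_ac p'"
    by (intro poly_eqI) (simp add: p'_def coeff_map_poly c)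
  moreover have "p' \<in> polys_over (integers \<mu>)"
    unfolding polys_over_def p'_def
  proof (intro CollectI allI)
    fix i
    obtain a where "a \<in> integers \<mu>" "coeff p i = to_ac a"
      using assms by (auto simp: polys_over_def)
    then show "coeff (map_poly of_ac p) i \<in> integers \<mu>" by (simp add: coeff_map_poly)
  qed
  ultimately show ?thesis using that by blast
qed

lemma integral_iff:
  "integral z \<longleftrightarrow> (\<exists>p \<in> polys_over (integers \<mu>). lead_coeff p = 1 \<and> ev p z = 0)"
proof
  assume "integral z"
  then obtain p where p: "p \<in> polys_over (to_ac ` integers \<mu>)" "lead_coeff p = 1" "poly p z = 0"
    unfolding O_ac.integral_def by blast
  obtain p' where p': "p' \<in> polys_over (integers \<mu>)" "p = map_poly to_ac p'"
    by (rule lift_integral[OF p(1)])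
  have "to_ac (lead_coeff p') = to_ac 1"
    using p(2) p'(2) by simp
  then have "lead_coeff p' = 1" unfolding to_ac_eq_iff .
  then show "\<exists>p \<in> polys_over (integers \<mu>). lead_coeff p = 1 \<and> ev p z = 0"
    using p' p by blast
next
  assume "\<exists>p \<in> polys_over (integers \<mu>). lead_coeff p = 1 \<and> ev p z = 0"
  then obtain p where p: "p \<in> polys_over (integers \<mu>)" "lead_coeff p = 1" "ev p z = 0" by blast
  have "map_poly to_ac p \<in> polys_over (to_ac ` integers \<mu>)"
    using p(1) by (auto simp: polys_over_def coeff_map_poly)
  moreover have "lead_coeff (map_poly to_ac p) = 1" using p(2) by simp
  ultimately show "integral z" unfolding O_ac.integral_def using p(3) by blast
qed

text \<open>
  The valuation ring is integrally closed: for \<open>\<mu> x < 0\<close> the leading term of a monic relation would be the only one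
  of least value.
\<close>

lemma integral_base:
  assumes "integral (to_ac x)"
  shows "0 \<le> \<mu> x"
proof (rule ccontr)
  assume "\<not> ?thesis"
  then have neg: "\<mu> x < 0" by simp
  then obtain a where a: "\<mu> x = Val a" "a < 0" by (cases "\<mu> x") (auto simp: zero_vval_def)
  obtain p where p: "p \<in> polys_over (integers \<mu>)" "lead_coeff p = 1" "ev p (to_ac x) = 0"
    using assms integral_iff by blast
  define d where "d = degree p"
  have "to_ac (poly p x) = 0" using p(3) by simp
  then have root: "(\<Sum>j\<le>d. coeff p j * x ^ j) = 0" by (simp add: poly_altdef d_def)
  have top: "\<mu> (coeff p d * x ^ d) = Val (d \<star> a)"
    using p(2) by (simp add: d_def power a nmult_Val)
  have "\<mu> (\<Sum>j\<le>d. coeff p j * x ^ j) = \<mu> (coeff p d * x ^ d)"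
  proof (rule sum_unique_min)
    fix j assume "j \<in> {..d}" "j \<noteq> d"
    then have "j \<star> (- a) < d \<star> (- a)" using a by (intro nmult_less) auto
    then have "Val (d \<star> a) < Val (j \<star> a)" using nmult_minus[of _ 0 a] by simp
    also have "\<dots> \<le> \<mu> (coeff p j * x ^ j)"
      using p(1) add_right_mono[of 0 "\<mu> (coeff p j)" "Val (j \<star> a)"]
      by (simp add: polys_integers_iff mult power a nmult_Val)
    finally show "\<mu> (coeff p d * x ^ d) < \<mu> (coeff p j * x ^ j)" using top by simp
  qed (use top in auto)
  then show False using root top by simp
qed

lemma content_attained:
  assumes "lead_coeff p = 1"
  obtains i where "\<And>l. \<mu> (coeff p i) \<le> \<mu> (coeff p l)"
    "\<And>l. l < i \<Longrightarrow> \<mu> (coeff p i) < \<mu> (coeff p l)" "\<mu> (coeff p i) \<le> 0"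
proof -
  define m where "m = Min ((\<lambda>i. \<mu> (coeff p i)) ` {..degree p})"
  have le: "m \<le> \<mu> (coeff p l)" for l
  proof (cases "l \<le> degree p")
    case True
    then show ?thesis unfolding m_def by (intro Min_le) auto
  qed (simp add: coeff_eq_0)
  have "m \<in> (\<lambda>i. \<mu> (coeff p i)) ` {..degree p}"
    unfolding m_def by (intro Min_in) auto
  then have ex: "\<exists>i. \<mu> (coeff p i) = m" by auto
  define i where "i = (LEAST i. \<mu> (coeff p i) = m)"
  have i: "\<mu> (coeff p i) = m" unfolding i_def by (rule LeastI_ex[OF ex])
  have "m < \<mu> (coeff p l)" if "l < i" for l
    using not_less_Least[OF that[unfolded i_def]] le[of l] by (simp add: order_less_le)
  moreover have "m \<le> 0" using le[of "degree p"] assms one by simp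
  ultimately show ?thesis using that[of i] le i by auto
qed

text \<open>
  The least value of the coefficients is additive in products: at the sum of the first
  indices where the two minima are attained, a single summand dominates.
\<close>

lemma gauss_monic:
  assumes "p * q \<in> polys_over (integers \<mu>)" "lead_coeff p = 1" "lead_coeff q = 1"
  shows "p \<in> polys_over (integers \<mu>)"
proof -
  obtain i where i: "\<And>l. \<mu> (coeff p i) \<le> \<mu> (coeff p l)"
    "\<And>l. l < i \<Longrightarrow> \<mu> (coeff p i) < \<mu> (coeff p l)" "\<mu> (coeff p i) \<le> 0"
    using content_attained[OF assms(2)] by metis
  obtain j where j: "\<And>l. \<mu> (coeff q j) \<le> \<mu> (coeff q l)"
    "\<And>l. l < j \<Longrightarrow> \<mu> (coeff q j) < \<mu> (coeff q l)" "\<mu> (coeff q j) \<le> 0"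
    using content_attained[OF assms(3)] by metis
  have fin: "\<mu> (coeff p i) \<noteq> Infty" "\<mu> (coeff q j) \<noteq> Infty"
    using i(3) j(3) by (auto simp del: eq_Infty_iff)
  have "\<mu> (coeff (p * q) (i + j)) = \<mu> (coeff p i * coeff q (i + j - i))"
    unfolding coeff_mult
  proof (rule sum_unique_min)
    show "\<mu> (coeff p i * coeff q (i + j - i)) \<noteq> Infty"
      using fin by (simp add: mult del: eq_Infty_iff)
    fix l assume l: "l \<in> {..i + j}" "l \<noteq> i"
    show "\<mu> (coeff p i * coeff q (i + j - i))
        < \<mu> (coeff p l * coeff q (i + j - l))"
    proof (cases "l < i")
      case True
      then show ?thesis unfolding mult using i(2)[OF True] j(1) fin
        by (intro vval_add_less_le_mono(1)) auto
    next
      case False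
      then have "i + j - l < j" using l by auto
      then show ?thesis unfolding mult using j(2) i(1) fin
        by (intro vval_add_less_le_mono(2)) auto
    qed
  qed auto
  then have "0 \<le> \<mu> (coeff p i) + \<mu> (coeff q j)"
    using assms(1) unfolding polys_integers_iff by (metis add_diff_cancel_left' mult)
  also have "\<dots> \<le> \<mu> (coeff p i) + 0" using j(3) by (rule add_left_mono)
  finally show ?thesis unfolding polys_integers_iff using i(1) by (auto intro: order_trans)
qed

text \<open>
  A polynomial whose constant coefficient is a unit is coprime to \<open>x\<close>, and the Bezout identity for \<open>x\<^sup>k\<close> follows by
  multiplying identities. It holds over the valuation ring, so also modulo the maximal ideal.
\<close>

lemma bezout_power_X:
  assumes q: "q \<in> polys_over (integers \<mu>)" "\<mu> (coeff q 0) = 0"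
  shows "\<exists>u \<in> polys_over (integers \<mu>). \<exists>w \<in> polys_over (integers \<mu>). u * monom 1 k + w * q = 1"
proof (induction k)
  case 0
  show ?case using O.polys_const[OF O.one_in] O.polys_const[OF O.zero_in]
    by (intro bexI[of _ "[:1:]"] bexI[of _ "[:0:]"]) (auto simp: one_pCons)
next
  case (Suc k)
  then obtain u w where uw: "u \<in> polys_over (integers \<mu>)" "w \<in> polys_over (integers \<mu>)"
    "u * monom 1 k + w * q = 1" by blast
  obtain c r where cr: "q = pCons c r" by (cases q)
  have c: "\<mu> c = 0" using q(2) cr by simp
  have r: "r \<in> polys_over (integers \<mu>)" using q(1) cr
    unfolding polys_over_def by (auto simp: coeff_pCons split: nat.splits)
  have c0: "c \<noteq> 0" using c eq_Infty_iff[of c] by auto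
  have ci: "[:inverse c:] \<in> polys_over (integers \<mu>)"
    using value_inverse_0[OF c] by (intro O.polys_const) (simp add: integers_def)
  have q_eq: "[:c:] = q - r * [:0, 1:]" unfolding cr by simp
  have "1 = [:inverse c:] * [:c:]" using c0 by (simp add: one_pCons)
  then have "1 = u * monom 1 k * ([:inverse c:] * [:c:]) + w * q" using uw(3) by simp
  also have "\<dots> = (- (u * [:inverse c:] * r)) * (monom 1 k * [:0, 1:]) + (u * monom 1 k * [:inverse c:] + w) * q"
    unfolding q_eq by (simp add: algebra_simps)
  also have "monom 1 k * [:0, 1:] = monom (1 :: 'k) (Suc k)"
    by (simp add: monom_altdef)
  finally have "(- (u * [:inverse c:] * r)) * monom 1 (Suc k) + (u * monom 1 k * [:inverse c:] + w) * q = 1" by simp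
  moreover have "monom 1 k \<in> polys_over (integers \<mu>)"
    using O.one_in O.zero_in by (auto simp: polys_over_def coeff_monom)
  moreover have "- (u * [:inverse c:] * r) \<in> polys_over (integers \<mu>)"
    using O.polys_mult[OF O.polys_mult[OF uw(1) ci] r] by (auto simp: polys_over_def intro: O.minus_in)
  ultimately show ?case
    using uw ci by (blast intro: O.polys_add O.polys_mult)
qed

end

locale henselian_field = valued_field \<mu>
  for \<mu> :: "'k::field \<Rightarrow> 'g::linordered_ab_group_add vval" +
  assumes hens: "henselian \<mu>"
begin

text \<open>
  Otherwise the reduction of \<open>h\<close> is \<open>x\<^sup>k q\<close> with \<open>0 < k < deg h\<close> and \<open>q\<close> not vanishing at \<open>0\<close>. Hensel's lemma lifts this
  factorization to a proper factorization of \<open>h\<close>.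
\<close>

lemma irreducible_reduction:
  assumes h: "h \<in> polys_over (integers \<mu>)" "lead_coeff h = 1" "irreducible h"
    and c0: "0 < \<mu> (coeff h 0)" and j: "j < degree h"
  shows "0 < \<mu> (coeff h j)"
proof -
  have ge: "0 \<le> \<mu> (coeff h i)" for i using h(1) by (simp add: polys_integers_iff)
  define k where "k = (LEAST k. \<mu> (coeff h k) = 0)"
  have k: "\<mu> (coeff h k) = 0"
    unfolding k_def by (rule LeastI[of _ "degree h"]) (simp add: h(2) one)
  have low: "0 < \<mu> (coeff h i)" if "i < k" for i
    using not_less_Least[OF that[unfolded k_def]] ge[of i] by (simp add: order_less_le)
  have kd: "k \<le> degree h"
    unfolding k_def by (rule Least_le) (simp add: h(2) one)
  have k0: "0 < k" using k c0 by (metis gr0I order_less_irrefl)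
  have "k = degree h"
  proof (rule ccontr)
    assume "k \<noteq> degree h"
    then have kd': "k < degree h" using kd by simp
    define h0 where "h0 = poly_shift k h"
    have h0: "coeff h0 i = coeff h (i + k)" for i by (simp add: h0_def coeff_poly_shift)
    have h0O: "h0 \<in> polys_over (integers \<mu>)" using ge by (simp add: polys_integers_iff h0)
    have degh0: "degree h0 = degree h - k"
    proof (rule antisym)
      show "degree h0 \<le> degree h - k"
        by (intro degree_le) (auto simp: h0 intro: coeff_eq_0)
      show "degree h - k \<le> degree h0"
        using kd h(2) by (intro le_degree) (simp add: h0)
    qed
    have h0m: "lead_coeff h0 = 1" using kd h(2) by (simp add: degh0 h0)
    have X: "monom 1 k \<in> polys_over (integers \<mu>)"
      using O.one_in O.zero_in by (auto simp: polys_over_def coeff_monom)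
    have diff: "h - monom 1 k * h0 \<in> polys_over (max_ideal \<mu>)"
      unfolding polys_max_ideal_iff
    proof
      fix i show "0 < \<mu> (coeff (h - monom 1 k * h0) i)"
        using low[of i] by (cases "i < k") (auto simp: coeff_monom_mult h0)
    qed
    obtain u w where "u \<in> polys_over (integers \<mu>)" "w \<in> polys_over (integers \<mu>)" "u * monom 1 k + w * h0 = 1"
      using bezout_power_X[OF h0O, of k] k by (auto simp: h0)
    then have bez: "\<exists>u \<in> polys_over (integers \<mu>). \<exists>w \<in> polys_over (integers \<mu>).
       u * monom 1 k + w * h0 - 1 \<in> polys_over (max_ideal \<mu>)"
      by (intro bexI[of _ u] bexI[of _ w]) (auto simp: polys_max_ideal_iff)
    have mm: "lead_coeff (monom (1::'k) k) = 1" by (simp add: degree_monom_eq)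
    obtain g h' where g: "lead_coeff g = 1" "lead_coeff h' = 1" "h = g * h'"
      "g - monom 1 k \<in> polys_over (max_ideal \<mu>)"
      using hens[unfolded henselian_def] h(1,2) X mm h0O h0m diff bez by blast
    have gk: "0 < \<mu> (coeff g i - coeff (monom 1 k) i)" for i
      using g(4) unfolding polys_max_ideal_iff by simp
    have "degree g = k"
    proof (cases rule: linorder_cases[of "degree g" k])
      case less
      then show ?thesis using gk[of k] by (simp add: coeff_eq_0 one)
    next
      case greater
      then show ?thesis using gk[of "degree g"] g(1) by (simp add: one)
    qed
    moreover have "g \<noteq> 0" "h' \<noteq> 0" using g by auto
    then have "degree h = degree g + degree h'"
      unfolding g(3) by (rule degree_mult_eq)
    moreover have "g dvd 1 \<or> h' dvd 1" using h(3) g(3) by (meson Factorial_Ring.irreducibleD)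
    ultimately show False using k0 kd' \<open>g \<noteq> 0\<close> \<open>h' \<noteq> 0\<close> by (auto simp: is_unit_iff_degree)
  qed
  then show ?thesis using low j by simp
qed

end

text \<open>
  The valued extension \<open>K[x]/(F)\<close>, given by a pseudo-valuation \<open>u\<close> of \<open>K[x]\<close> with support \<open>F\<close>. Its elements are represented by
  polynomials \<open>g\<close>, and \<open>ev g a\<close> is the image of \<open>g\<close> under the embedding into the algebraic closure of \<open>K\<close> that belongs
  to a root \<open>a\<close> of \<open>F\<close>.
\<close>

locale henselian_extension = K: henselian_field \<mu> + pseudo_valuation u F
  for \<mu> :: "'k::field \<Rightarrow> 'g::linordered_ab_group_add vval"
    and u :: "'k poly \<Rightarrow> 'g vval" and F :: "'k poly" +
  assumes F: "irreducible F" and const: "u [:c:] = \<mu> c"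
begin

lemma u_smult: "u (smult c f) = \<mu> c + u f"
  using mult[of "[:c:]" f] by (simp add: const)

lemma ev_eq_0_iff: "ev F a = 0 \<Longrightarrow> ev f a = 0 \<longleftrightarrow> F dvd f"
  by (rule irreducible_root_dvd_iff[OF F])

lemma pcompose_sum: "pcompose h y = (\<Sum>j\<le>degree h. smult (coeff h j) (y ^ j))"
  by (simp add: pcompose_altdef poly_altdef degree_map_poly coeff_map_poly)

text \<open>
  Let \<open>h\<close> be the minimal polynomial of \<open>y\<close>, which is integral by Gauss's lemma. If \<open>h\<close> had its constant coefficient in the maximal ideal, all
  coefficients but the leading one would lie there, and \<open>h(y) = 0\<close> is impossible for an element of value
  \<open>0\<close>. So the constant coefficient is a unit and \<open>y\<^sup>-\<^sup>1\<close> is integral.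
\<close>

lemma integral_unit:
  assumes a: "ev F a = 0" and y: "K.O_ac.integral (ev y a)" "u y = 0"
  shows "K.O_ac.integral (inverse (ev y a))"
proof -
  obtain p where p: "p \<in> polys_over (integers \<mu>)" "lead_coeff p = 1" "ev p (ev y a) = 0"
    using y(1) K.integral_iff by blast
  obtain h :: "'k poly" where h: "lead_coeff h = 1" "irreducible h"
    "\<And>f. ev f (ev y a) = 0 \<longleftrightarrow> h dvd f"
    using minimal_polynomial[of "ev y a"] by blast
  obtain q where q: "p = h * q" using h(3) p(3) by blast
  have "lead_coeff q = 1" using p(2) h(1) unfolding q by (simp add: lead_coeff_mult)
  then have hO: "h \<in> polys_over (integers \<mu>)" using K.gauss_monic[of h q] p(1) h(1) q by simp
  have ya: "ev y a \<noteq> 0" using ev_eq_0_iff[OF a, of y] support[of y] y(2) by auto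
  have hy: "ev h (ev y a) = 0" using h(3) by simp
  have root: "u (pcompose h y) = Infty"
    using ev_eq_0_iff[OF a, of "pcompose h y"] hy support by (simp add: ev_pcompose)
  have "\<mu> (coeff h 0) = 0"
  proof (rule ccontr)
    assume "\<mu> (coeff h 0) \<noteq> 0"
    then have pos: "0 < \<mu> (coeff h 0)"
      using hO by (simp add: K.polys_integers_iff order_less_le)
    let ?d = "degree h"
    have "u (\<Sum>j\<le>?d. smult (coeff h j) (y ^ j)) = u (smult (coeff h ?d) (y ^ ?d))"
      using K.irreducible_reduction[OF hO h(1,2) pos] h(1)
      by (intro sum_unique_min) (auto simp: u_smult power y(2) K.one)
    then show False using root h(1) by (simp add: pcompose_sum u_smult power y(2))
  qed
  then have c: "\<mu> (inverse (coeff h 0)) = 0" "coeff h 0 \<noteq> 0"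
    using K.value_inverse_0 by force+
  show ?thesis
  proof (rule K.O_ac.integral_inverse[of "map_poly to_ac h"])
    show "map_poly to_ac h \<in> polys_over (to_ac ` integers \<mu>)"
      using hO by (auto simp: polys_over_def coeff_map_poly)
    show "inverse (coeff (map_poly to_ac h) 0) \<in> to_ac ` integers \<mu>"
      using c(1) by (simp add: coeff_map_poly integers_def flip: to_ac_inverse)
  qed (use hy ya c(2) in \<open>auto simp: coeff_map_poly\<close>)
qed

lemma algebraic_relation:
  assumes a: "ev F a = 0"
  obtains p where "p \<noteq> 0" "ev p (ev g a) = 0" "u (pcompose p g) = Infty"
proof -
  obtain p :: "'k poly" where p: "p \<noteq> 0" "ev p (ev g a) = 0" using alg_closure_algebraic by blast
  then have "u (pcompose p g) = Infty"
    using ev_eq_0_iff[OF a, of "pcompose p g"] support by (simp add: ev_pcompose)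
  then show ?thesis using that p by blast
qed

text \<open>
  The last coefficient of value \<open>0\<close> is singled out because the tail starting there, divided by \<open>g\<^sup>k\<close>, is a unit for \<open>u\<close> whenever
  \<open>u g \<ge> 0\<close>.
\<close>

lemma primitive_relation:
  assumes a: "ev F a = 0"
  obtains p k where "p \<in> polys_over (integers \<mu>)" "ev p (ev g a) = 0" "u (pcompose p g) = Infty"
    "k \<le> degree p" "\<mu> (coeff p k) = 0" "\<And>j. k < j \<Longrightarrow> 0 < \<mu> (coeff p j)"
proof -
  obtain p where p: "p \<noteq> 0" "ev p (ev g a) = 0" "u (pcompose p g) = Infty"
    using algebraic_relation[OF a] by blast
  let ?d = "degree p"
  define c where "c i = coeff p i" for i
  obtain m where m: "m \<le> ?d" "\<And>i. i \<le> ?d \<Longrightarrow> \<mu> (c m) \<le> \<mu> (c i)"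
    using arg_min_if_finite[of "{..?d}" "\<lambda>i. \<mu> (c i)"]
    by (metis atMost_iff empty_iff finite_atMost linorder_not_le order_refl)
  have cm: "c m \<noteq> 0"
  proof
    assume "c m = 0"
    then have "\<mu> (c ?d) = Infty" using m(2)[of ?d] by simp
    then show False using p(1) by (simp add: c_def)
  qed
  have m': "\<mu> (c m) \<le> \<mu> (c i)" for i
    using m(2)[of i] by (cases "i \<le> ?d") (auto simp: c_def coeff_eq_0)
  define p' where "p' = smult (inverse (c m)) p"
  have coeff: "coeff p' i = inverse (c m) * c i" for i by (simp add: p'_def c_def)
  have "0 \<le> \<mu> (coeff p' i)" for i
    using K.value_inverse[OF cm] add_right_mono[OF m'[of i], of "\<mu> (inverse (c m))"]
    by (simp add: coeff K.mult add.commute)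
  then have O: "p' \<in> polys_over (integers \<mu>)" by (simp add: K.polys_integers_iff)
  have deg: "degree p' = ?d" using cm by (simp add: p'_def)
  define S where "S = {j. j \<le> ?d \<and> \<mu> (coeff p' j) = 0}"
  have "\<mu> (coeff p' m) = 0" using cm by (simp add: coeff K.one)
  then have S: "finite S" "S \<noteq> {}" using m(1) by (auto simp: S_def)
  define k where "k = Max S"
  have "k \<in> S" unfolding k_def by (rule Max_in[OF S])
  moreover have "0 < \<mu> (coeff p' j)" if "k < j" for j
  proof (cases "j \<le> ?d")
    case True
    have "j \<notin> S" using that S(1) unfolding k_def by (meson Max_ge leD)
    then show ?thesis using True O by (auto simp: S_def K.polys_integers_iff order_less_le)
  qed (simp add: deg coeff_eq_0)
  moreover have "pcompose p' g = smult (inverse (c m)) (pcompose p g)"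
    by (simp add: p'_def pcompose_smult)
  ultimately show ?thesis
    using that[of p' k] O p(2,3) deg by (auto simp: S_def p'_def u_smult)
qed

text \<open>
  The valuation ring of \<open>u\<close> is the integral closure of that of \<open>\<mu>\<close>. With \<open>y\<close> the tail of a primitive relation for \<open>g\<close>, both
  \<open>y\<close> and \<open>y g\<close> are integral, and \<open>u y = 0\<close> makes \<open>y\<^sup>-\<^sup>1\<close> integral; so \<open>g = y\<^sup>-\<^sup>1 (y g)\<close> is integral.
\<close>

lemma nonneg_integral:
  assumes a: "ev F a = 0" and g: "0 \<le> u g"
  shows "K.O_ac.integral (ev g a)"
proof -
  obtain p k where p: "p \<in> polys_over (integers \<mu>)" "ev p (ev g a) = 0" "u (pcompose p g) = Infty"
    and k: "k \<le> degree p" "\<mu> (coeff p k) = 0"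
    "\<And>j. k < j \<Longrightarrow> 0 < \<mu> (coeff p j)"
    using primitive_relation[OF a, of g] by metis
  let ?d = "degree p"
  define y where "y = (\<Sum>j=k..?d. smult (coeff p j) (g ^ (j - k)))"
  have "u y = u (smult (coeff p k) (g ^ (k - k)))"
    unfolding y_def
  proof (rule sum_unique_min)
    fix j assume j: "j \<in> {k..?d}" "j \<noteq> k"
    have "0 < \<mu> (coeff p j) + (j - k) \<star> u g"
      using k(3)[of j] j nmult_mono_right[OF g, of "j - k"] by (auto intro: add_pos_nonneg)
    then show "u (smult (coeff p k) (g ^ (k - k))) < u (smult (coeff p j) (g ^ (j - k)))"
      using k(2) by (simp add: u_smult power const)
  qed (use k in \<open>auto simp: u_smult const\<close>)
  then have uy: "u y = 0" using k(2) by (simp add: const)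
  have "k \<noteq> 0"
  proof
    assume "k = 0"
    then have "y = pcompose p g" by (simp add: y_def pcompose_sum atLeast0AtMost)
    then show False using uy p(3) by simp
  qed
  have evy: "ev y a = (\<Sum>j=k..?d. to_ac (coeff p j) * ev g a ^ (j - k))"
    by (simp add: y_def)
  have rel: "(\<Sum>j\<le>?d. to_ac (coeff p j) * ev g a ^ j) = 0"
    using p(2) by (simp add: poly_altdef)
  have O: "to_ac (coeff p j) \<in> to_ac ` integers \<mu>" for j
    using p(1) by (auto simp: polys_over_def)
  have int: "K.O_ac.integral (ev y a)" "K.O_ac.integral (ev y a * ev g a)"
    unfolding evy using K.O_ac.integral_tail[of ?d "\<lambda>j. to_ac (coeff p j)" "ev g a" k]
      O rel k(1) \<open>k \<noteq> 0\<close> by auto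
  have "K.O_ac.integral (inverse (ev y a))" by (rule integral_unit[OF a int(1) uy])
  then have "K.O_ac.integral (inverse (ev y a) * (ev y a * ev g a))" using int(2) by (rule K.O_ac.integral_mult)
  moreover have "ev y a \<noteq> 0" using ev_eq_0_iff[OF a, of y] support[of y] uy by auto
  ultimately show ?thesis by (simp add: mult.assoc[symmetric])
qed

lemma unit_integral:
  assumes "ev F a = 0" "u g = 0"
  shows "K.O_ac.integral (ev g a)" "K.O_ac.integral (inverse (ev g a))"
  using nonneg_integral[of a g] integral_unit[of a g] assms by auto

text \<open>
  In an algebraic relation for \<open>g\<close> the least value is attained by two terms; comparing them gives a multiple of \<open>u g\<close> in
  the value group of \<open>K\<close>.
\<close>

lemma value_torsion:
  assumes a: "ev F a = 0" and g: "u g \<noteq> Infty"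
  obtains e s where "0 < e" "s \<noteq> 0" "e \<star> u g = \<mu> s"
proof -
  obtain p where p: "p \<noteq> 0" "u (pcompose p g) = Infty"
    using algebraic_relation[OF a, of g] by metis
  let ?d = "degree p"
  define c where "c i = coeff p i" for i
  obtain w where w: "u g = Val w" using g by (cases "u g") auto
  define t where "t j = u (smult (c j) (g ^ j))" for j
  have t: "t j = \<mu> (c j) + Val (j \<star> w)" for j
    unfolding t_def by (simp add: u_smult power w nmult_Val)
  obtain m where m: "m \<le> ?d" "\<And>i. i \<le> ?d \<Longrightarrow> t m \<le> t i"
    using arg_min_if_finite[of "{..?d}" t]
    by (metis atMost_iff empty_iff finite_atMost linorder_not_le order_refl)
  have "t ?d \<noteq> Infty" using p(1) by (simp add: t c_def)
  then have tm: "t m \<noteq> Infty" using m(2)[of ?d] by auto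
  have "\<exists>j\<le>?d. j \<noteq> m \<and> t j = t m"
  proof (rule ccontr)
    assume none: "\<not> ?thesis"
    have "u (\<Sum>j\<le>?d. smult (c j) (g ^ j)) = t m"
      unfolding t_def
    proof (rule sum_unique_min)
      fix j assume "j \<in> {..?d}" "j \<noteq> m"
      then have "t m \<le> t j" "t j \<noteq> t m" using m(2)[of j] none by auto
      then have "t m < t j" by simp
      then show "u (smult (c m) (g ^ m)) < u (smult (c j) (g ^ j))" unfolding t_def .
    qed (use m tm in \<open>auto simp: t_def\<close>)
    then show False using p(2) tm by (simp add: pcompose_sum c_def)
  qed
  then obtain j where j: "j \<noteq> m" "t j = t m" by blast
  have tie: "\<exists>e s. 0 < e \<and> s \<noteq> 0 \<and> e \<star> u g = \<mu> s" if ij: "i < j" and tij: "t i = t j" and ti: "t i \<noteq> Infty" for i j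
  proof -
    obtain x y where xy: "\<mu> (c i) = Val x" "\<mu> (c j) = Val y"
    proof -
      have "\<mu> (c i) \<noteq> Infty" using ti t[of i] by auto
      moreover have "\<mu> (c j) \<noteq> Infty" using ti tij t[of j] by auto
      ultimately show ?thesis using that by (cases "\<mu> (c i)"; cases "\<mu> (c j)") simp_all
    qed
    then have nz: "c i \<noteq> 0" "c j \<noteq> 0" by force+
    have "x + i \<star> w = y + j \<star> w" using tij xy by (simp add: t)
    moreover have "j \<star> w = (j - i) \<star> w + i \<star> w" using ij by (simp flip: nmult_add_left)
    ultimately have "(j - i) \<star> w = x - y" by (simp add: algebra_simps)
    moreover have "\<mu> (inverse (c j)) = Val (- y)"
      using K.value_inverse[OF nz(2)] xy(2)
      by (cases "\<mu> (inverse (c j))") (auto simp: zero_vval_def eq_neg_iff_add_eq_0 add.commute)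
    ultimately have "(j - i) \<star> u g = \<mu> (c i * inverse (c j))"
      using xy by (simp add: K.mult w nmult_Val)
    then show ?thesis using nz ij by (intro exI[of _ "j - i"] exI[of _ "c i * inverse (c j)"]) auto
  qed
  show ?thesis using tie[of j m] tie[of m j] j tm that by (metis linorder_neqE_nat)
qed

end

lemma linear_product: "poly (\<Prod>x\<in>#A. [:- x, 1:]) z = (\<Prod>x\<in>#A. z - x)" for z :: "'a::comm_ring_1"
  by (induction A) (simp_all add: algebra_simps)

lemma roots_in_closure:
  fixes F :: "'k::field poly"
  assumes "lead_coeff F = 1"
  obtains A where "size A = degree F" "\<And>z. ev F z = (\<Prod>x\<in>#A. z - x)" "\<And>x. x \<in># A \<Longrightarrow> ev F x = 0"
proof -
  have lc: "lead_coeff (map_poly to_ac F) = 1" using assms by simp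
  then have "map_poly to_ac F \<noteq> 0" by auto
  from alg_closed_imp_factorization[OF this]
  obtain A where A0: "size A = degree (map_poly to_ac F)"
    "map_poly to_ac F = smult (lead_coeff (map_poly to_ac F)) (\<Prod>x\<in>#A. [:- x, 1:])"
    by blast
  have A: "size A = degree F" using A0(1) by simp
  have A2: "map_poly to_ac F = (\<Prod>x\<in>#A. [:- x, 1:])" using A0(2) unfolding lc smult_1_left .
  have e: "ev F z = (\<Prod>x\<in>#A. z - x)" for z
    unfolding A2 by (rule linear_product)
  have "ev F x = 0" if "x \<in># A" for x
    using that unfolding e by (auto simp: prod_mset_zero_iff)
  then show ?thesis using that[OF A] e by blast
qed

text \<open>
  The resultant of \<open>F\<close> and \<open>G\<close> is, up to sign, the product \<open>R\<close> of the conjugates of \<open>G\<close> in \<open>K[x]/(F)\<close> and the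
  product \<open>S\<close> of the conjugates of \<open>F\<close> in \<open>K[x]/(G)\<close>. Multiples \<open>e u(G) = \<mu> s\<close> and \<open>f w(F) = \<mu> t\<close> lie in the value group
  of \<open>K\<close>. As \<open>G\<^sup>e / s\<close> has value \<open>0\<close>, its conjugates are units of the integral closure, and so is their product
  \<open>R\<^sup>e\<close> divided by \<open>s\<close> to the power \<open>deg F\<close>; likewise for \<open>S\<^sup>f\<close>, \<open>t\<close> and \<open>deg G\<close>. Eliminating \<open>R\<^sup>2 = S\<^sup>2\<close> leaves a unit of the integral closure in \<open>K\<close>, which
  has value \<open>0\<close>.
\<close>

lemma value_reciprocity:
  fixes \<mu> :: "'k::field \<Rightarrow> 'g::linordered_ab_group_add vval"
  assumes 1: "henselian_extension \<mu> u F" and 2: "henselian_extension \<mu> w G"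
    and monic: "lead_coeff F = 1" "lead_coeff G = 1"
    and fin: "u G \<noteq> Infty" "w F \<noteq> Infty"
  shows "degree F \<star> u G = degree G \<star> w F"
proof -
  interpret U: henselian_extension \<mu> u F by (rule 1)
  interpret W: henselian_extension \<mu> w G by (rule 2)
  let ?M = "degree F" and ?m = "degree G"
  obtain A where A: "size A = ?M" "\<And>z. ev F z = (\<Prod>x\<in>#A. z - x)" "\<And>x. x \<in># A \<Longrightarrow> ev F x = 0"
    using roots_in_closure[OF monic(1)] by blast
  obtain B where B: "size B = ?m" "\<And>z. ev G z = (\<Prod>x\<in>#B. z - x)" "\<And>x. x \<in># B \<Longrightarrow> ev G x = 0"
    using roots_in_closure[OF monic(2)] by blast
  have irr_deg: "0 < degree H" if "irreducible H" for H :: "'k poly"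
  proof -
    have "H \<noteq> 0" "\<not> H dvd 1" using that by (auto simp: Factorial_Ring.irreducible_def)
    then show ?thesis by (simp add: is_unit_iff_degree)
  qed
  have "A \<noteq> {#}" "B \<noteq> {#}" using A(1) B(1) irr_deg[OF U.F] irr_deg[OF W.F] by auto
  then obtain a b where ab: "a \<in># A" "b \<in># B" by blast
  obtain e s where es: "0 < e" "s \<noteq> 0" "e \<star> u G = \<mu> s"
    using U.value_torsion[OF A(3)[OF ab(1)] fin(1)] by metis
  obtain f t where ft: "0 < f" "t \<noteq> 0" "f \<star> w F = \<mu> t"
    using W.value_torsion[OF B(3)[OF ab(2)] fin(2)] by metis
  define R where "R = (\<Prod>x\<in>#A. ev G x)"
  define S where "S = (\<Prod>y\<in>#B. ev F y)"
  have R: "R = (\<Prod>x\<in>#A. \<Prod>y\<in>#B. x - y)" by (simp add: R_def B(2))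
  have S: "S = (\<Prod>x\<in>#A. \<Prod>y\<in>#B. y - x)" unfolding S_def A(2) by (rule prod_mset.swap)
  \<comment> \<open>Squares avoid the sign in the symmetry of the resultant.\<close>
  have sq: "(x - y) * (x - y) = (y - x) * (y - x)" for x y :: "'k alg_closure" by (simp add: algebra_simps)
  have "R * R = (\<Prod>x\<in>#A. \<Prod>y\<in>#B. (x - y) * (x - y))" by (simp only: R prod_mset.distrib)
  also have "\<dots> = (\<Prod>x\<in>#A. \<Prod>y\<in>#B. (y - x) * (y - x))" by (subst sq) (rule refl)
  also have "\<dots> = S * S" by (simp only: S prod_mset.distrib)
  finally have RS: "R * R = S * S" .
  have R0: "R \<noteq> 0"
  proof -
    have "ev G x \<noteq> 0" if "x \<in># A" for x
      using U.ev_eq_0_iff[OF A(3)[OF that], of G] U.support fin(1) by simp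
    then show ?thesis unfolding R_def by (auto simp: prod_mset_zero_iff)
  qed
  define Z where "Z = to_ac (inverse s) ^ ?M * R ^ e"
  define Y where "Y = to_ac (inverse t) ^ ?m * S ^ f"
  have pw: "(\<Prod>x\<in>#C. h x ^ n) = (\<Prod>x\<in>#C. h x) ^ n" for C :: "'k alg_closure multiset" and h n
    by (induction C) (auto simp: power_mult_distrib)
  have inv: "(\<Prod>x\<in>#C. inverse (h x)) = inverse (\<Prod>x\<in>#C. h x)" for C :: "'k alg_closure multiset" and h :: "_ \<Rightarrow> 'k alg_closure"
    by (induction C) auto
  have Z': "Z = (\<Prod>x\<in>#A. ev (smult (inverse s) (G ^ e)) x)"
    by (simp add: Z_def R_def prod_mset.distrib pw A(1))
  have Y': "Y = (\<Prod>x\<in>#B. ev (smult (inverse t) (F ^ f)) x)"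
    by (simp add: Y_def S_def prod_mset.distrib pw B(1))
  have uz: "u (smult (inverse s) (G ^ e)) = 0"
    using U.K.value_inverse[OF es(2)] es(3) by (simp add: U.u_smult U.power add.commute)
  have wy: "w (smult (inverse t) (F ^ f)) = 0"
    using U.K.value_inverse[OF ft(2)] ft(3) by (simp add: W.u_smult W.power add.commute)
  have Z: "U.K.O_ac.integral Z" "U.K.O_ac.integral (inverse Z)"
    unfolding Z' inv[symmetric] using U.unit_integral[OF A(3) uz]
    by (auto intro!: U.K.O_ac.integral_prod_mset simp del: ev_simps)
  have Y: "U.K.O_ac.integral Y" "U.K.O_ac.integral (inverse Y)"
    unfolding Y' inv[symmetric] using W.unit_integral[OF B(3) wy]
    by (auto intro!: U.K.O_ac.integral_prod_mset simp del: ev_simps)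
  define q where "q = inverse s ^ (?M * (2 * f)) * t ^ (?m * (2 * e))"
  have RSp: "R ^ (e * (2 * f)) = S ^ (f * (2 * e))"
  proof -
    have "e * (2 * f) = 2 * (e * f)" "f * (2 * e) = 2 * (e * f)" by auto
    then show ?thesis using RS by (simp only: power_mult[of _ 2] power2_eq_square)
  qed
  have "S \<noteq> 0" using RS R0 by auto
  then have q: "to_ac q = Z ^ (2 * f) * inverse Y ^ (2 * e)"
  proof -
    have gen: "(c ^ k * r ^ l) ^ n = c ^ (k * n) * r ^ (l * n)" for c r :: "'k alg_closure" and k l n
      by (simp add: power_mult_distrib power_mult)
    have "Z ^ (2 * f) = to_ac (inverse s) ^ (?M * (2 * f)) * R ^ (e * (2 * f))"
      unfolding Z_def by (rule gen)
    moreover have "inverse Y ^ (2 * e) = inverse (to_ac (inverse t) ^ (?m * (2 * e)) * S ^ (f * (2 * e)))"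
      unfolding power_inverse Y_def gen ..
    moreover have "\<dots> = to_ac t ^ (?m * (2 * e)) * inverse (S ^ (f * (2 * e)))"
      by (simp only: to_ac_inverse power_inverse inverse_mult_distrib inverse_inverse_eq)
    moreover have "to_ac q = to_ac (inverse s) ^ (?M * (2 * f)) * to_ac t ^ (?m * (2 * e))"
      by (simp only: q_def to_ac_mult to_ac_power)
    moreover have "x * w * (y * inverse w) = x * y" if "w \<noteq> 0" for x y w :: "'k alg_closure"
      using that by simp
    then have "to_ac (inverse s) ^ (?M * (2 * f)) * S ^ (f * (2 * e)) *
        (to_ac t ^ (?m * (2 * e)) * inverse (S ^ (f * (2 * e))))
      = to_ac (inverse s) ^ (?M * (2 * f)) * to_ac t ^ (?m * (2 * e))"
      using \<open>S \<noteq> 0\<close> by (metis power_not_zero)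
    ultimately show ?thesis unfolding RSp by presburger
  qed
  have "U.K.O_ac.integral (to_ac q)"
    unfolding q using Z Y by (intro U.K.O_ac.integral_mult U.K.O_ac.integral_power)
  then have q1: "0 \<le> \<mu> q" by (rule U.K.integral_base)
  have "to_ac (inverse q) = inverse Z ^ (2 * f) * Y ^ (2 * e)"
    by (simp add: q power_inverse)
  then have "U.K.O_ac.integral (to_ac (inverse q))"
    using Z Y by (metis U.K.O_ac.integral_mult U.K.O_ac.integral_power)
  then have "0 \<le> \<mu> (inverse q)" by (rule U.K.integral_base)
  moreover have "q \<noteq> 0" using es ft by (simp add: q_def)
  ultimately have q0: "\<mu> q = 0" using q1 U.K.integral_inverse_iff by (meson antisym)
  obtain x y where xy: "u G = Val x" "w F = Val y" using fin by (metis vval.exhaust)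
  have ms: "\<mu> (inverse s) = Val (- (e \<star> x))"
    using U.K.value_inverse[OF es(2)] es(3)[symmetric] xy(1)
    by (cases "\<mu> (inverse s)") (auto simp: zero_vval_def nmult_Val eq_neg_iff_add_eq_0 add.commute)
  have "\<mu> q = Val ((?M * (2 * f)) \<star> (- (e \<star> x)) + (?m * (2 * e)) \<star> (f \<star> y))"
    unfolding q_def U.K.mult U.K.power ms ft(3)[symmetric] xy(2) nmult_Val by simp
  then have bal: "(?m * (2 * e)) \<star> (f \<star> y) = (?M * (2 * f)) \<star> (e \<star> x)"
    using q0 nmult_minus[of "?M * (2 * f)" 0 "e \<star> x"] by (simp add: zero_vval_def)
  have "(2 * e * f) \<star> (?m \<star> y) = (2 * e * f) \<star> (?M \<star> x)"
  proof -
    have "2 * e * f * ?m = ?m * (2 * e) * f" "2 * e * f * ?M = ?M * (2 * f) * e" by auto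
    moreover have "(?m * (2 * e) * f) \<star> y = (?M * (2 * f) * e) \<star> x"
      using bal unfolding nmult_mult .
    ultimately show ?thesis unfolding nmult_mult[symmetric] by metis
  qed
  then have "?m \<star> y = ?M \<star> x" using es(1) ft(1) nmult_left_cancel[of "2 * e * f"] by simp
  then show ?thesis by (simp add: xy nmult_Val)
qed

section \<open>Families of key polynomials\<close>

locale key_family = pseudo_valuation v P
  for v :: "'k::field poly \<Rightarrow> 'g::linordered_ab_group_add vval" and P :: "'k poly" +
  fixes \<Lambda> :: index and Q :: "index \<Rightarrow> 'k poly"
  assumes P_monic: "lead_coeff P = 1"
    and key_polys: "key_polynomials v \<Lambda> Q"
begin

abbreviation tr :: "index \<Rightarrow> 'k poly \<Rightarrow> 'g vval" where
  "tr i \<equiv> truncation v (Q i)"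

abbreviation m :: "index \<Rightarrow> nat" where
  "m i \<equiv> degree (Q i)"

lemma first_le: "(0, 1) \<le> \<Lambda>" and Q_first: "Q (0, 1) = [:0, 1:]"
  and value_finite: "(0, 1) \<le> i \<Longrightarrow> i < \<Lambda> \<Longrightarrow> v (Q i) \<noteq> Infty"
  and value_last: "v (Q \<Lambda>) = Infty"
proof -
  note kp = key_polys[unfolded key_polynomials_def]
  show "(0, 1) \<le> \<Lambda>" using kp by (rule conjunct1)
  note kp = kp[THEN conjunct2]
  show "Q (0, 1) = [:0, 1:]" using kp by (rule conjunct1)
  note kp = kp[THEN conjunct2]
  show "(0, 1) \<le> i \<Longrightarrow> i < \<Lambda> \<Longrightarrow> v (Q i) \<noteq> Infty" using kp[THEN conjunct1, rule_format, of i] by simp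
  show "v (Q \<Lambda>) = Infty" using kp[THEN conjunct2] by (rule conjunct1)
qed

lemmas key_polys_step = key_polys[unfolded key_polynomials_def, THEN conjunct2, THEN conjunct2,
    THEN conjunct2, THEN conjunct2]

lemma successor:
  assumes "(0, 1) \<le> (a, i)" "(a, i) < \<Lambda>"
  shows "tr (a, i) (Q (a, Suc i)) < v (Q (a, Suc i))" "lead_coeff (Q (a, Suc i)) = 1"
    "tr (a, i) f < v f \<Longrightarrow> m (a, Suc i) \<le> degree f"
    "expansion (Q (a, i)) (Q (a, Suc i)) (key_alpha Q (a, Suc i)) = 1"
    "expansion (Q (a, i)) (Q (a, Suc i)) j \<noteq> 0 \<Longrightarrow>
       term_value v (Q (a, i)) (Q (a, Suc i)) j = key_alpha Q (a, Suc i) \<star> v (Q (a, i))"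
proof -
  note s = key_polys_step[THEN conjunct1, rule_format, OF conjI[OF assms]]
  have "least_degree_monic_in {f. tr (a, i) f < v f} (Q (a, Suc i))"
    and e: "expansion (Q (a, i)) (Q (a, Suc i)) (key_alpha Q (a, Suc i)) = 1"
    and t: "\<forall>j. expansion (Q (a, i)) (Q (a, Suc i)) j \<noteq> 0 \<longrightarrow>
         term_value v (Q (a, i)) (Q (a, Suc i)) j
             = (\<Sum>_<key_alpha Q (a, Suc i). v (Q (a, i)))"
    using s by blast+
  then show "tr (a, i) (Q (a, Suc i)) < v (Q (a, Suc i))" "lead_coeff (Q (a, Suc i)) = 1"
    "tr (a, i) f < v f \<Longrightarrow> m (a, Suc i) \<le> degree f"
    by (auto simp: least_degree_monic_in_def)
  show "expansion (Q (a, i)) (Q (a, Suc i)) (key_alpha Q (a, Suc i)) = 1"  by (rule e)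
  show "expansion (Q (a, i)) (Q (a, Suc i)) j \<noteq> 0 \<Longrightarrow>
       term_value v (Q (a, i)) (Q (a, Suc i)) j = key_alpha Q (a, Suc i) \<star> v (Q (a, i))"
    using t unfolding nmult_def by blast
qed

lemma limit:
  assumes "(Suc a, 0) \<le> \<Lambda>"
  shows "(0, 1) \<le> i \<Longrightarrow> i < (Suc a, 0) \<Longrightarrow> tr i (Q (Suc a, 0)) < v (Q (Suc a, 0))"
    "lead_coeff (Q (Suc a, 0)) = 1"
    "(\<And>i. (0, 1) \<le> i \<Longrightarrow> i < (Suc a, 0) \<Longrightarrow> tr i f < v f) \<Longrightarrow> m (Suc a, 0) \<le> degree f"
proof -
  have "least_degree_monic_in
          {f. \<forall>i. (0, 1) \<le> i \<and> i < (Suc a, 0) \<longrightarrow> tr i f < v f} (Q (Suc a, 0))"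
    using key_polys_step[THEN conjunct2, THEN conjunct1, rule_format, OF assms] .
  then show "(0, 1) \<le> i \<Longrightarrow> i < (Suc a, 0) \<Longrightarrow> tr i (Q (Suc a, 0)) < v (Q (Suc a, 0))"
    "lead_coeff (Q (Suc a, 0)) = 1"
    "(\<And>i. (0, 1) \<le> i \<Longrightarrow> i < (Suc a, 0) \<Longrightarrow> tr i f < v f) \<Longrightarrow> m (Suc a, 0) \<le> degree f"
    unfolding least_degree_monic_in_def by blast+
qed

lemma P_degree_pos: "0 < degree P"
  using P_not_unit P_monic by (metis gr0I is_unit_iff_degree leading_coeff_0_iff zero_neq_one)

text \<open>
  The statement of the transfinite induction. Its last part, that the truncation at \<open>Q\<^sub>i\<close> gives the right value wherever
  an earlier one does, is needed at limits, where the defining set refers to all earlier indices.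
\<close>

definition admissible :: "index \<Rightarrow> bool" where
  "admissible i \<longleftrightarrow> key_poly (Q i) \<and> m i \<le> degree P
     \<and> (i < \<Lambda> \<longrightarrow> (\<forall>k f. (0, 1) \<le> k \<longrightarrow> k < i \<longrightarrow> tr k f = v f \<longrightarrow> tr i f = v f))"

lemma admissible_truncation:
  assumes "admissible i" "(0, 1) \<le> i" "i < \<Lambda>"
  shows "pseudo_valuation (tr i) 0" "tr i f \<le> v f" "degree f < m i \<Longrightarrow> tr i f = v f"
    "tr i f = Infty \<longleftrightarrow> f = 0"
proof -
  have i: "key_poly (Q i)" "m i \<le> degree P" using assms(1) unfolding admissible_def by auto
  show pv: "pseudo_valuation (tr i) 0"
    by (rule truncation_pseudo_valuation[OF i(1) value_finite[OF assms(2,3)] i(2)])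
  show "tr i f \<le> v f" by (rule truncation_le_val[OF key_polyD(2)[OF i(1)]])
  show "degree f < m i \<Longrightarrow> tr i f = v f"
    using truncation_small[of "Q i" v, OF key_polyD(2)[OF i(1)] zero] by simp
  show "tr i f = Infty \<longleftrightarrow> f = 0"
    using ring_valuation.support[OF pseudo_valuation.axioms(1)[OF pv]] by simp
qed

lemma truncation_mono_step:
  assumes i: "admissible i" "(0, 1) \<le> i" "i < \<Lambda>" and j: "tr i (Q j) < v (Q j)" "0 < m j"
    and f: "tr i f = v f" "\<And>l. tr i (expansion (Q j) f l) = v (expansion (Q j) f l)"
  shows "tr j f = v f"
proof (rule antisym)
  show "tr j f \<le> v f" by (rule truncation_le_val[OF j(2)])
  show "v f \<le> tr j f"
    using truncation_ge[OF admissible_truncation(1,2)[OF i] j f(2)] f(1) by simp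
qed

lemma admissible_first: "admissible (0, 1)"
proof -
  have "key_poly [:0, 1:]"
    unfolding key_poly_def
  proof (intro conjI allI impI)
    fix f g :: "'k poly"
    assume "degree f < degree [:0, 1 :: 'k:]" "degree g < degree [:0, 1 :: 'k:]"
    then obtain b c where "f = [:b:]" "g = [:c:]" by (metis One_nat_def degree_eq_zeroE degree_pCons_eq_if less_one one_neq_zero pCons_eq_0_iff degree_0)
    then show "v ((f * g) mod [:0, 1:]) = v (f * g)" by (simp add: mod_poly_less)
  qed auto
  moreover have "\<not> (0, 1) \<le> k" if "k < (0, 1)" for k :: index using that by simp
  ultimately show ?thesis using P_degree_pos unfolding admissible_def Q_first by auto
qed

text \<open>
  Below the degree of the next key polynomial the truncation at \<open>Q\<^sub>i\<close> is \<open>v\<close>, so \<open>key_polyI\<close> applies with this single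
  truncation.
\<close>

lemma admissible_successor:
  assumes i: "admissible (a, i)" "(0, 1) \<le> (a, i)" "(a, i) < \<Lambda>"
  shows "admissible (a, Suc i)"
proof -
  let ?i = "(a, i)" and ?j = "(a, Suc i)"
  note s = successor[OF i(2,3)] and g = admissible_truncation[OF i]
  have small: "tr ?i f = v f" if "degree f < m ?j" for f
    using s(3)[of f] g(2)[of f] that by (metis leD order_less_le)
  have mi: "m ?i \<le> m ?j" using g(3)[of "Q ?j"] s(1) by (metis less_irrefl not_le)
  have pos: "0 < m ?j" using mi i(1) key_polyD(2) unfolding admissible_def by (metis order_less_le_trans)
  have key_poly: "key_poly (Q ?j)"
    using s(1,2) g(1,2) small pos by (intro key_polyI) blast+
  have P: "m ?j \<le> degree P"
    using s(3)[of P] g(4)[of P] support[of P] P_monic by auto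
  have le: "k < ?j \<longleftrightarrow> k < ?i \<or> k = ?i" for k by (cases k) auto
  have mono: "tr ?i f = v f" if "(0, 1) \<le> k" "k < ?j" "tr k f = v f" for k f
  proof (cases "k = ?i")
    case False
    then have "k < ?i" using that(2) unfolding le by blast
    then show ?thesis using that i(1,3) unfolding admissible_def by blast
  qed (use that in simp)
  show ?thesis
    unfolding admissible_def
  proof (intro conjI allI impI key_poly P)
    fix k f assume k: "?j < \<Lambda>" "(0, 1) \<le> k" "k < ?j" "tr k f = v f"
    show "tr ?j f = v f"
      using truncation_mono_step[OF i s(1) pos mono[OF k(2-4)]] small[OF expansion_degree_bound[OF pos]] by blast
  qed
qed

text \<open>
  Every polynomial of degree less than the limit key polynomial has its value attained by some earlier truncation, hence
  by all truncations at \<open>Q\<^sub>\<omega>\<^sub>a\<^sub>+\<^sub>n\<close> with \<open>n\<close> large. So finitely many such polynomials are treated by one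
  truncation.
\<close>

lemma admissible_limit:
  assumes l: "(Suc a, 0) \<le> \<Lambda>" and IH: "\<And>k. (0, 1) \<le> k \<Longrightarrow> k < (Suc a, 0) \<Longrightarrow> admissible k"
  shows "admissible (Suc a, 0)"
    and "finite F \<Longrightarrow> (\<And>f. f \<in> F \<Longrightarrow> degree f < m (Suc a, 0)) \<Longrightarrow>
      \<exists>N. \<forall>n\<ge>N. \<forall>f\<in>F. tr (a, n) f = v f"
proof -
  let ?j = "(Suc a, 0::nat)"
  note s = limit[OF l]
  have ltL: "k < \<Lambda>" if "k < ?j" for k using that l by simp
  have up: "\<exists>N\<ge>1. \<forall>n\<ge>N. tr (a, n) f = v f" if k: "(0, 1) \<le> k" "k < ?j" "tr k f = v f" for k f
  proof -
    obtain b i where bi: "k = (b, i)" by (cases k)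
    have "b \<le> a" using k(2) bi by (auto split: if_splits)
    have "tr (a, n) f = v f" if "n \<ge> Suc i" for n
    proof -
      have lt: "k < (a, n)" "(0, 1) \<le> (a, n)" "(a, n) < ?j" using that bi \<open>b \<le> a\<close> by auto
      then show ?thesis using IH[of "(a, n)"] ltL[of "(a, n)"] k unfolding admissible_def by blast
    qed
    then show ?thesis by (intro exI[of _ "Suc i"]) auto
  qed
  have le_v: "tr k f \<le> v f" if "(0, 1) \<le> k" "k < ?j" for k f
    using admissible_truncation(2)[OF IH] that ltL by blast
  have single: "\<exists>N\<ge>1. \<forall>n\<ge>N. tr (a, n) f = v f" if "degree f < m ?j" for f
    using s(3)[of f] up[of _ f] le_v[of _ f] that by (metis leD order_less_le)
  have fin: "\<exists>N\<ge>1. \<forall>n\<ge>N. \<forall>f\<in>F. tr (a, n) f = v f"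
    if "finite F" "\<And>f. f \<in> F \<Longrightarrow> degree f < m ?j" for F
    using that
  proof (induction F rule: finite_induct)
    case (insert f F)
    then obtain N where N: "N \<ge> 1" "\<forall>n\<ge>N. \<forall>f\<in>F. tr (a, n) f = v f" by auto
    obtain N' where "\<forall>n\<ge>N'. tr (a, n) f = v f" using single[of f] insert.prems by auto
    then show ?case using N by (intro exI[of _ "max N N'"]) auto
  qed auto
  show "finite F \<Longrightarrow> (\<And>f. f \<in> F \<Longrightarrow> degree f < m ?j) \<Longrightarrow> \<exists>N. \<forall>n\<ge>N. \<forall>f\<in>F. tr (a, n) f = v f"
    using fin by blast
  have an: "(0, 1) \<le> (a, n)" "(a, n) < ?j" "(a, n) < \<Lambda>" if "n \<ge> 1" for n
    using that ltL[of "(a, n)"] by auto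
  have pos: "0 < m ?j"
  proof (rule ccontr)
    assume "\<not> ?thesis"
    then have "Q ?j = 1" using s(2) by (metis degree_eq_zeroE gr0I lead_coeff_pCons(2) one_pCons)
    moreover have "0 < m (0, 1)" by (subst Q_first) simp
    ultimately show False
      using s(1)[of "(0, 1)"] truncation_small[of "Q (0, 1)" v 1] by auto
  qed
  have key_poly: "key_poly (Q ?j)"
  proof (rule key_polyI[OF s(2) pos])
    fix F :: "'k poly set"
    assume F: "finite F" "\<And>f. f \<in> F \<Longrightarrow> degree f < m ?j"
    obtain N where N: "N \<ge> 1" "\<forall>f\<in>F. tr (a, N) f = v f" using fin[OF F] by auto
    show "\<exists>w. pseudo_valuation w 0 \<and> (\<forall>f. w f \<le> v f) \<and> w (Q ?j) < v (Q ?j) \<and> (\<forall>f\<in>F. w f = v f)"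
      using admissible_truncation(1,2)[OF IH[OF an(1,2)] an(1,3), OF N(1) N(1) N(1) N(1)] s(1)[OF an(1,2), OF N(1) N(1)]
        N(2)
      by (intro exI[of _ "tr (a, N)"]) simp
  qed
  have P: "m ?j \<le> degree P"
  proof (rule s(3))
    fix k assume "(0, 1) \<le> k" "k < ?j"
    then show "tr k P < v P" using admissible_truncation(4)[OF IH, of k P] ltL support[of P] P_monic by auto
  qed
  show "admissible ?j"
    unfolding admissible_def
  proof (intro conjI allI impI key_poly P)
    fix k f assume k: "?j < \<Lambda>" "(0, 1) \<le> k" "k < ?j" "tr k f = v f"
    obtain N where N: "\<forall>n\<ge>N. tr (a, n) f = v f" using up[OF k(2-4)] by blast
    obtain N' where N': "N' \<ge> 1" "\<forall>n\<ge>N'. \<forall>e \<in> expansion (Q ?j) f ` {..degree f}. tr (a, n) e = v e"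
      using fin[of "expansion (Q ?j) f ` {..degree f}"] expansion_degree_bound[OF pos] by auto
    define n where "n = max N N'"
    have n: "n \<ge> 1" "tr (a, n) f = v f" using N N' by (auto simp: n_def)
    have e: "tr (a, n) (expansion (Q ?j) f l) = v (expansion (Q ?j) f l)" for l
    proof (cases "l \<le> degree f")
      case True
      then show ?thesis using N'(2) by (auto simp: n_def)
    next
      case False
      then have "expansion (Q ?j) f l = 0" using expansion_bound[OF pos] by simp
      then show ?thesis using admissible_truncation(4)[OF IH[OF an(1,2)] an(1,3), OF n(1) n(1) n(1) n(1), of 0] by simp
    qed
    show "tr ?j f = v f"
      by (rule truncation_mono_step[OF IH[OF an(1,2)] an(1,3) s(1)[OF an(1,2)] pos n(2) e]) (use n in auto)
  qed
qed

lemma admissible: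
  assumes "(0, 1) \<le> i" "i \<le> \<Lambda>"
  shows "admissible i"
  using assms
proof (induction i rule: less_induct)
  case (less i)
  obtain a n where i: "i = (a, n)" by (cases i)
  show ?case
  proof (cases n)
    case 0
    then obtain b where "a = Suc b" using less.prems(1) i by (cases a) auto
    then show ?thesis using admissible_limit(1)[of b] less 0 i by auto
  next
    case (Suc k)
    show ?thesis
    proof (cases "a = 0 \<and> k = 0")
      case True
      then show ?thesis using admissible_first i Suc by simp
    next
      case False
      then have k: "(0, 1) \<le> (a, k)" "(a, k) < i" by (auto simp: i Suc)
      then have L: "(a, k) < \<Lambda>" using less.prems(2) by simp
      have "admissible (a, k)" using less.IH[OF k(2) k(1)] L by simp
      then show ?thesis using admissible_successor[of a k] k L by (simp add: i Suc)
    qed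
  qed
qed

lemma key_poly_Q: "(0, 1) \<le> i \<Longrightarrow> i \<le> \<Lambda> \<Longrightarrow> key_poly (Q i)"
  and degree_le_P: "(0, 1) \<le> i \<Longrightarrow> i \<le> \<Lambda> \<Longrightarrow> m i \<le> degree P"
  and degree_pos: "(0, 1) \<le> i \<Longrightarrow> i \<le> \<Lambda> \<Longrightarrow> 0 < m i"
  using admissible[of i] key_polyD(2) unfolding admissible_def by auto

lemma truncation_at:
  assumes "(0, 1) \<le> i" "i < \<Lambda>"
  shows "pseudo_valuation (tr i) 0" "tr i f \<le> v f" "degree f < m i \<Longrightarrow> tr i f = v f"
    "tr i f = Infty \<longleftrightarrow> f = 0"
  using admissible_truncation[OF admissible[OF assms(1) order_less_imp_le[OF assms(2)]] assms] by auto

lemma limit_stable: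
  assumes "(Suc a, 0) \<le> \<Lambda>" "degree f < m (Suc a, 0)"
  shows "\<exists>N. \<forall>n\<ge>N. tr (a, n) f = v f"
  using admissible_limit(2)[OF assms(1) admissible, of "{f}"] assms by (simp add: order_less_le_trans order_less_imp_le)

text \<open>
  \<open>P\<close> divides \<open>Q\<^sub>\<Lambda>\<close>, and \<open>deg Q\<^sub>\<Lambda> \<le> deg P\<close> since \<open>P\<close> gains value over all truncations.
\<close>

lemma last_eq_P: "Q \<Lambda> = P"
proof -
  have L: "key_poly (Q \<Lambda>)" "m \<Lambda> \<le> degree P" using key_poly_Q degree_le_P first_le by auto
  have "P dvd Q \<Lambda>" using support value_last by simp
  then obtain q where q: "Q \<Lambda> = P * q" by blast
  have nz: "P \<noteq> 0" "q \<noteq> 0" using P_monic key_polyD(1)[OF L(1)] q by auto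
  then have "degree q = 0" using L(2) by (simp add: q degree_mult_eq)
  then obtain c where c: "q = [:c:]" by (rule degree_eq_zeroE)
  have "c = 1" using key_polyD(1)[OF L(1)] P_monic nz(2) unfolding q c by (auto split: if_splits)
  then show ?thesis by (simp add: q c)
qed

end

section \<open>Limit key polynomials\<close>

lemma expansion_top:
  fixes Q f :: "'k::field poly"
  assumes Q: "lead_coeff Q = 1" "0 < degree Q" and f: "f \<noteq> 0"
  defines "d \<equiv> expansion_degree Q f"
  shows "expansion Q f d \<noteq> 0" "\<And>j. d < j \<Longrightarrow> expansion Q f j = 0"
    "degree f = degree (expansion Q f d) + d * degree Q"
    "lead_coeff (expansion Q f d) = lead_coeff f"
proof -
  let ?c = "expansion Q f" and ?q = "degree Q"
  have sub: "{j. ?c j \<noteq> 0} \<subseteq> {..degree f}"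
    using expansion_bound[OF Q(2), of f] by (auto simp: not_less[symmetric])
  then have fin: "finite {j. ?c j \<noteq> 0}" by (rule finite_subset) simp
  have "f = (\<Sum>j\<le>degree f. ?c j * Q ^ j)" by (rule expansion_sum_eq[OF Q(2)]) simp
  then have ne: "{j. ?c j \<noteq> 0} \<noteq> {}" using f by force
  show d: "?c d \<noteq> 0" unfolding d_def expansion_degree_def using Max_in[OF fin ne] by simp
  show up: "?c j = 0" if "d < j" for j
    using that Max_ge[OF fin, of j] unfolding d_def expansion_degree_def by fastforce
  define l where "l = (\<Sum>j<d. ?c j * Q ^ j)"
  have "d \<le> degree f" using d sub by auto
  then have "{..degree f} = {..<d} \<union> {d} \<union> {d<..degree f}" by auto
  then have "(\<Sum>j\<le>degree f. ?c j * Q ^ j)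
      = (\<Sum>j\<in>{..<d} \<union> {d}. ?c j * Q ^ j) + (\<Sum>j\<in>{d<..degree f}. ?c j * Q ^ j)"
    by (simp only:) (rule sum.union_disjoint, auto)
  also have "(\<Sum>j\<in>{d<..degree f}. ?c j * Q ^ j) = 0" using up by (intro sum.neutral) auto
  also have "(\<Sum>j\<in>{..<d} \<union> {d}. ?c j * Q ^ j) = l + ?c d * Q ^ d"
    unfolding l_def by (subst sum.union_disjoint) auto
  finally have eq: "f = ?c d * Q ^ d + l"
    using expansion_sum_eq[OF Q(2) order_refl, of f] by (simp add: add.commute)
  have dd: "degree (?c d * Q ^ d) = degree (?c d) + d * ?q"
    by (rule degree_monic_mult_power[OF Q(1) d])
  have lt: "l = 0 \<or> degree l < degree (?c d * Q ^ d)"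
  proof (cases "d = 0")
    case False
    have "degree l < d * ?q"
      unfolding l_def
    proof (rule degree_sum_less)
      show "0 < d * ?q" using False Q(2) by simp
      fix j assume "j \<in> {..<d}"
      then have "Suc j * ?q \<le> d * ?q" by (intro mult_le_mono1) auto
      moreover have "degree (?c j * Q ^ j) \<le> degree (?c j) + j * ?q"
        using degree_monic_mult_power[OF Q(1), of "?c j" j] by (cases "?c j = 0") auto
      ultimately show "degree (?c j * Q ^ j) < d * ?q"
        using expansion_degree_bound[OF Q(2), of f j] by simp
    qed
    then show ?thesis using dd by simp
  qed (simp add: l_def)
  then have deg: "degree f = degree (?c d * Q ^ d)"
  proof
    assume "l = 0" then show ?thesis using eq by (metis add.right_neutral)
  next
    assume "degree l < degree (?c d * Q ^ d)"
    then show ?thesis using eq by (metis degree_add_eq_left)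
  qed
  then show "degree f = degree (?c d) + d * ?q" using dd by simp
  have "coeff l (degree f) = 0" using lt deg by (auto intro: coeff_eq_0)
  then have "lead_coeff f = coeff (?c d * Q ^ d) (degree f)"
    by (subst (1) eq) simp
  also have "\<dots> = lead_coeff (?c d * Q ^ d)" by (simp add: deg)
  also have "\<dots> = lead_coeff (?c d)" using Q(1) by (simp add: lead_coeff_mult lead_coeff_power)
  finally show "lead_coeff (?c d) = lead_coeff f" by simp
qed

lemma expansion_top_monic:
  fixes Q f :: "'k::field poly"
  assumes Q: "lead_coeff Q = 1" "0 < degree Q" and f: "lead_coeff f = 1" "degree f = d * degree Q"
  shows "expansion_degree Q f = d" "expansion Q f d = 1" "\<And>j. d < j \<Longrightarrow> expansion Q f j = 0"
proof -
  have "f \<noteq> 0" using f(1) by auto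
  note top = expansion_top[OF Q this]
  let ?d = "expansion_degree Q f"
  have eq: "d * degree Q = degree (expansion Q f ?d) + ?d * degree Q" using top(3) f(2) by simp
  have "d = (d * degree Q) div degree Q" using Q(2) by simp
  also have "\<dots> = ?d" unfolding eq using expansion_degree_bound[OF Q(2), of f ?d] by simp
  finally show d: "?d = d" ..
  have "degree (expansion Q f d) = 0" using eq unfolding d by simp
  then show "expansion Q f d = 1"
    using top(4) f(1) unfolding d by (metis degree_eq_zeroE lead_coeff_pCons(2) one_pCons)
  show "\<And>j. d < j \<Longrightarrow> expansion Q f j = 0" using top(2) unfolding d .
qed

context key_family
begin

lemma Q_monic: "(0, 1) \<le> i \<Longrightarrow> i \<le> \<Lambda> \<Longrightarrow> lead_coeff (Q i) = 1"
  using key_poly_Q key_polyD(1) by blast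

lemma degree_successor:
  assumes i: "(0, 1) \<le> (a, i)" "(a, i) < \<Lambda>" "(a, Suc i) \<le> \<Lambda>"
  shows "m (a, Suc i) = key_alpha Q (a, Suc i) * m (a, i)" "1 \<le> key_alpha Q (a, Suc i)"
proof -
  have i': "(0, 1) \<le> (a, Suc i)" using i(1) by auto
  have nz: "Q (a, Suc i) \<noteq> 0" using degree_pos[OF i' i(3)] by auto
  have le: "(a, i) \<le> \<Lambda>" using i(2) by simp
  note t = expansion_top[OF Q_monic[OF i(1) le] degree_pos[OF i(1) le] nz]
  have "degree (expansion (Q (a, i)) (Q (a, Suc i)) (key_alpha Q (a, Suc i))) = 0"
    using successor(4)[OF i(1,2)] by simp
  then show e: "m (a, Suc i) = key_alpha Q (a, Suc i) * m (a, i)" using t(3) by simp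
  then show "1 \<le> key_alpha Q (a, Suc i)" using degree_pos[OF i' i(3)] by (cases "key_alpha Q (a, Suc i)") auto
qed

end

locale limit_index = key_family v P \<Lambda> Q
  for v :: "'k::field poly \<Rightarrow> 'g::linordered_ab_group_add vval" and P \<Lambda> Q +
  fixes a :: nat
  assumes limit_le: "(Suc a, 0) \<le> \<Lambda>"
begin

lemma below: "1 \<le> n \<Longrightarrow> (0, 1) \<le> (a, n)" "(a, n) < \<Lambda>" "(a, n) \<le> \<Lambda>" "(a, n) < (Suc a, 0)"
proof -
  show l: "(a, n) < (Suc a, 0)" by simp
  then show "(a, n) < \<Lambda>" using limit_le by (rule order_less_le_trans)
  then show "(a, n) \<le> \<Lambda>" by simp
qed auto

lemma at_limit: "(0, 1) \<le> (Suc a, 0 :: nat)"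
  by simp

lemma degree_le_limit: "1 \<le> n \<Longrightarrow> m (a, n) \<le> m (Suc a, 0)"
proof (rule ccontr)
  assume n: "1 \<le> n" and "\<not> ?thesis"
  then have "tr (a, n) (Q (Suc a, 0)) = v (Q (Suc a, 0))"
    using truncation_at(3)[OF below(1)[OF n] below(2)] by simp
  then show False using limit(1)[OF limit_le below(1)[OF n] below(4)] by simp
qed

lemma degree_mono: "1 \<le> n \<Longrightarrow> m (a, n) \<le> m (a, Suc n)"
  using degree_successor[OF below(1) below(2) below(3), of n] by simp

lemma degrees_stable: "\<exists>N\<ge>1. \<forall>n\<ge>N. m (a, n) = m (a, N)"
proof -
  define s where "s = (\<lambda>n. m (a, Suc n))"
  have mono: "s n \<le> s (Suc n)" for n unfolding s_def by (rule degree_mono) simp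
  have bound: "s n \<le> m (Suc a, 0)" for n unfolding s_def by (rule degree_le_limit) simp
  have fin: "finite (range s)"
    by (rule finite_subset[of _ "{..m (Suc a, 0)}"]) (use bound in auto)
  obtain N where N: "s N = Max (range s)" using Max_in[OF fin] by auto
  have eq: "s n = s N" if "n \<ge> N" for n
  proof (rule antisym)
    show "s N \<le> s n" by (rule lift_Suc_mono_le[of s, OF mono that])
    show "s n \<le> s N" unfolding N by (rule Max_ge[OF fin]) simp
  qed
  have "m (a, n) = m (a, Suc N)" if n: "Suc N \<le> n" for n
  proof -
    obtain k where "n = Suc k" "N \<le> k" using n by (cases n) auto
    then show ?thesis using eq[of k] by (simp add: s_def)
  qed
  then show ?thesis by (intro exI[of _ "Suc N"] conjI allI impI) simp
qed

text \<open>
  A place from which on the key polynomials \<open>Q\<^sub>\<omega>\<^sub>a\<^sub>+\<^sub>n\<close> have constant degree. In particular the set of indices with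
  \<open>\<alpha> = 1\<close> is infinite for every limit index.
\<close>

definition N :: nat where
  "N = (SOME N. 1 \<le> N \<and> (\<forall>n\<ge>N. m (a, n) = m (a, N)))"

lemma N: "1 \<le> N" "N \<le> n \<Longrightarrow> m (a, n) = m (a, N)"
  using someI_ex[OF degrees_stable] unfolding N_def by blast+

lemma alpha_stable: "N \<le> n \<Longrightarrow> key_alpha Q (a, Suc n) = 1"
  using degree_successor(1)[OF below(1) below(2) below(3), of n] N(1) N(2)[of n] N(2)[of "Suc n"]
    degree_pos[OF below(1) below(3), of n] by auto

lemma infinite_alpha: "infinite {i. 1 \<le> i \<and> key_alpha Q (a, i) = 1}"
proof
  assume "finite {i. 1 \<le> i \<and> key_alpha Q (a, i) = 1}"
  then obtain b where b: "\<forall>i\<in>{i. 1 \<le> i \<and> key_alpha Q (a, i) = 1}. i \<le> b"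
    using finite_nat_set_iff_bounded_le by blast
  have "Suc (max N b) \<in> {i. 1 \<le> i \<and> key_alpha Q (a, i) = 1}" using alpha_stable[of "max N b"] by simp
  then show False using b by fastforce
qed

definition \<beta> :: "nat \<Rightarrow> 'g" where
  "\<beta> n = (THE b. v (Q (a, n)) = Val b)"

lemma value_Q: "1 \<le> n \<Longrightarrow> v (Q (a, n)) = Val (\<beta> n)"
  using value_finite[OF below(1) below(2), of n] unfolding \<beta>_def by (cases "v (Q (a, n))") auto

text \<open>
  Here \<open>\<alpha> = 1\<close>, that is \<open>Q\<^sub>n\<^sub>+\<^sub>1 = Q\<^sub>n + c\<close> with \<open>deg c < deg Q\<^sub>n\<close>. The two terms of this expansion have the same value, so
  the truncation of \<open>Q\<^sub>n\<^sub>+\<^sub>1\<close> has value \<open>\<beta>\<^sub>n\<close>, less than \<open>\<beta>\<^sub>n\<^sub>+\<^sub>1\<close>.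
\<close>

lemma stable_step:
  assumes n: "N \<le> n"
  shows "\<beta> n < \<beta> (Suc n)"
proof -
  have n1: "1 \<le> n" using n N(1) by simp
  have dp: "0 < m (a, n)" by (rule degree_pos[OF below(1)[OF n1] below(3)])
  define c where "c = Q (a, Suc n) - Q (a, n)"
  have c: "Q (a, Suc n) = c + Q (a, n) * 1" by (simp add: c_def)
  have lc: "lead_coeff (Q (a, n)) = 1" "lead_coeff (Q (a, Suc n)) = 1"
    using Q_monic[OF below(1) below(3)] n1 by auto
  have "degree c < m (a, n)"
  proof (rule degree_lessI)
    show "c \<noteq> 0 \<or> 0 < m (a, n)" using dp by simp
    show "\<forall>k\<ge>m (a, n). coeff c k = 0"
    proof (intro allI impI)
      fix k assume k: "m (a, n) \<le> k"
      show "coeff c k = 0"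
        using k lc N(2)[of n] N(2)[of "Suc n"] n unfolding c_def
        by (cases "k = m (a, n)") (auto simp: coeff_eq_0)
    qed
  qed
  note tr1 = truncation_step[of "Q (a, n)" v, OF dp zero this, of 1]
  note s = successor[OF below(1)[OF n1] below(2)]
  have t1: "tr (a, n) 1 = 0" using truncation_small[of "Q (a, n)" v 1, OF dp zero] dp one by simp
  have vc: "v c = v (Q (a, n)) \<or> c = 0"
  proof (cases "c = 0")
    case False
    have e0: "expansion (Q (a, n)) (Q (a, Suc n)) 0 = c"
      using \<open>degree c < m (a, n)\<close> unfolding expansion_0[OF dp] c by (rule adic_mod[OF dp])
    then show ?thesis using s(5)[of 0] False alpha_stable[OF n]
      by (simp add: term_value_def)
  qed simp
  then have "tr (a, n) (Q (a, Suc n)) = v (Q (a, n))"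
    using tr1 t1 unfolding c[symmetric] by auto
  then have "v (Q (a, n)) < v (Q (a, Suc n))" using s(1) by simp
  then show ?thesis using value_Q n1 by simp
qed

lemma \<beta>_strict: "N \<le> i \<Longrightarrow> i < n \<Longrightarrow> \<beta> i < \<beta> n"
proof (induction n)
  case (Suc n)
  then show ?case using stable_step[of n] by (cases "i = n") auto
qed simp

lemma stable_diff:
  assumes "N \<le> i" "i < n"
  shows "degree (Q (a, n) - Q (a, i)) < m (a, i)" "v (Q (a, n) - Q (a, i)) = Val (\<beta> i)"
proof -
  have n1: "1 \<le> i" "1 \<le> n" using assms N(1) by auto
  have dp: "0 < m (a, i)" by (rule degree_pos[OF below(1)[OF n1(1)] below(3)])
  have lc: "lead_coeff (Q (a, i)) = 1" "lead_coeff (Q (a, n)) = 1"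
    using Q_monic[OF below(1) below(3)] n1 by auto
  show "degree (Q (a, n) - Q (a, i)) < m (a, i)"
  proof (rule degree_lessI)
    show "Q (a, n) - Q (a, i) \<noteq> 0 \<or> 0 < m (a, i)" using dp by simp
    show "\<forall>k\<ge>m (a, i). coeff (Q (a, n) - Q (a, i)) k = 0"
    proof (intro allI impI)
      fix k assume k: "m (a, i) \<le> k"
      show "coeff (Q (a, n) - Q (a, i)) k = 0"
        using k lc N(2)[of n] N(2)[of i] assms
        by (cases "k = m (a, i)") (auto simp: coeff_eq_0)
    qed
  qed
  show "v (Q (a, n) - Q (a, i)) = Val (\<beta> i)"
    using add_eq_left[of "- Q (a, i)" "Q (a, n)"] value_Q n1 \<beta>_strict[OF assms] by simp
qed

lemma truncation_later:
  assumes "N \<le> i" "i < n"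
  shows "tr (a, i) (Q (a, n)) = Val (\<beta> i)"
proof -
  have n1: "1 \<le> i" using assms N(1) by auto
  have dp: "0 < m (a, i)" by (rule degree_pos[OF below(1)[OF n1(1)] below(3)])
  have t1: "tr (a, i) 1 = 0" using truncation_small[of "Q (a, i)" v 1, OF dp zero] dp one by simp
  have "Q (a, n) = (Q (a, n) - Q (a, i)) + Q (a, i) * 1" by simp
  then have "tr (a, i) (Q (a, n)) = min (Val (\<beta> i)) (v (Q (a, i)) + tr (a, i) 1)"
    using truncation_step[of "Q (a, i)" v, OF dp zero stable_diff(1)[OF assms], of 1] stable_diff(2)[OF assms] by metis
  then show ?thesis using t1 value_Q[OF n1] by simp
qed

end

lemma pseudo_valuation_irreducible:
  assumes "pseudo_valuation u F" "F \<noteq> 0"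
  shows "irreducible F"
proof -
  interpret pseudo_valuation u F by (rule assms)
  have "prime_elem F" using assms(2) P_not_unit support_prime by (auto intro!: prime_elemI)
  then show ?thesis by (rule prime_elem_imp_irreducible)
qed

locale henselian_limit_index = limit_index v P \<Lambda> Q a + K: henselian_field \<mu>
  for v :: "'k::field poly \<Rightarrow> 'g::linordered_ab_group_add vval" and P \<Lambda> Q a
    and \<mu> :: "'k \<Rightarrow> 'g vval" +
  assumes const: "v [:c:] = \<mu> c"
begin

lemma residue_extension:
  assumes "(0, 1) \<le> i" "i \<le> \<Lambda>"
  shows "henselian_extension \<mu> (\<lambda>f. v (f mod Q i)) (Q i)"
proof -
  have pv: "pseudo_valuation (\<lambda>f. v (f mod Q i)) (Q i)"
    by (rule residue_pseudo_valuation[OF key_poly_Q[OF assms] degree_le_P[OF assms]])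
  have dp: "0 < m i" by (rule degree_pos[OF assms])
  have "irreducible (Q i)" using dp by (intro pseudo_valuation_irreducible[OF pv]) auto
  moreover have "v ([:c:] mod Q i) = \<mu> c" for c using dp const by (simp add: mod_poly_less)
  ultimately show ?thesis
    using pv K.henselian_field_axioms
    by (intro henselian_extension.intro henselian_extension_axioms.intro)
qed

abbreviation F :: "'k poly" where
  "F \<equiv> Q (Suc a, 0)"

abbreviation M :: nat where
  "M \<equiv> m (Suc a, 0)"

text \<open>
  \<open>value_reciprocity\<close> for \<open>F\<close> and \<open>Q\<^sub>n\<close>, whose residue rings are valued by \<open>v\<close>. It remains to see that \<open>Q\<^sub>n\<close> has value
  \<open>\<beta>\<^sub>n\<close> modulo \<open>F\<close>.
\<close>

lemma reciprocity:
  assumes n: "N \<le> n"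
  shows "M \<star> Val (\<beta> n) = m (a, N) \<star> v (F mod Q (a, n))"
proof -
  have n1: "1 \<le> n" using n N(1) by simp
  note b = below(1)[OF n1] below(2,3)[of n]
  have dp: "0 < m (a, n)" "0 < M" using degree_pos b limit_le by auto
  note tl = limit(1)[OF limit_le b(1) below(4)]
  note lc = Q_monic[OF b(1) b(3)] Q_monic[OF at_limit limit_le]
  have self: "tr (a, n) (Q (a, n)) = v (Q (a, n))"
    by (rule truncation_Q[of "Q (a, n)" v, OF dp(1) zero one])
  have 1: "v (Q (a, n) mod F) = Val (\<beta> n)"
  proof (cases "m (a, n) < M")
    case True
    then show ?thesis using value_Q[OF n1] by (simp add: mod_poly_less)
  next
    case False
    then have eq: "m (a, n) = M" using degree_le_limit[OF n1] by simp
    \<comment> \<open>\<open>F\<close> and \<open>Q\<^sub>n\<close> can have the same degree at the last limit index. Then \<open>F = Q\<^sub>n + c\<close>, and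
      \<open>v c = \<beta>\<^sub>n\<close> because \<open>F\<close> gains value over the truncation.\<close>
    define c where "c = F - Q (a, n)"
    have "degree c < m (a, n)"
    proof (rule degree_lessI)
      show "c \<noteq> 0 \<or> 0 < m (a, n)" using dp by simp
      show "\<forall>k\<ge>m (a, n). coeff c k = 0"
        using lc eq unfolding c_def by (auto simp: coeff_eq_0 order_le_less)
    qed
    have F: "F = c + Q (a, n) * 1" by (simp add: c_def)
    have t1: "tr (a, n) 1 = 0" using truncation_small[of "Q (a, n)" v 1, OF dp(1) zero] dp one by simp
    have tF: "tr (a, n) F = min (v c) (v (Q (a, n)))"
      using truncation_step[of "Q (a, n)" v, OF dp(1) zero \<open>degree c < m (a, n)\<close>, of 1] t1 F by simp
    have vc: "v c = v (Q (a, n))"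
      using add_eq_left[of c "Q (a, n)"] add_eq_left[of "Q (a, n)" c] tl tF F
      by (cases "v c" "v (Q (a, n))" rule: linorder_cases) (auto simp: add.commute)
    have "Q (a, n) = - c + F * 1" by (simp add: c_def)
    then have "Q (a, n) mod F = - c"
      using adic_mod[OF dp(2), of "- c" 1] \<open>degree c < m (a, n)\<close> eq by simp
    then show ?thesis using vc value_Q[OF n1] by simp
  qed
  interpret W: henselian_extension \<mu> "\<lambda>f. v (f mod Q (a, n))" "Q (a, n)"
    by (rule residue_extension[OF b(1,3)])
  interpret U: henselian_extension \<mu> "\<lambda>f. v (f mod F)" F
    by (rule residue_extension[OF at_limit limit_le])
  have 2: "v (F mod Q (a, n)) \<noteq> Infty"
  proof
    assume "v (F mod Q (a, n)) = Infty"
    then have "Q (a, n) dvd F" using W.support by simp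
    then obtain q where q: "F = Q (a, n) * q" by blast
    have "Q (a, n) dvd 1 \<or> q dvd 1" using Factorial_Ring.irreducibleD[OF U.F q] .
    then have "q dvd 1" using Factorial_Ring.irreducible_not_unit[OF W.F] by blast
    moreover have "q \<noteq> 0" using q dp by auto
    ultimately have "degree q = 0" by (simp add: is_unit_iff_degree)
    then obtain c where c: "q = [:c:]" by (rule degree_eq_zeroE)
    have "c = 1" using lc \<open>q \<noteq> 0\<close> unfolding q c by (auto split: if_splits)
    then have "F = Q (a, n)" by (simp add: q c)
    then show False using tl self by simp
  qed
  show ?thesis
    using value_reciprocity[OF U.henselian_extension_axioms W.henselian_extension_axioms lc(2,1)] 1 2 N(2)[OF n]
    by simp
qed

lemma F_nonzero: "F \<noteq> 0" and F_monic: "lead_coeff F = 1"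
  using Q_monic[OF at_limit limit_le] by auto

text \<open>
  Expand \<open>F = \<Sum> c\<^sub>j Q\<^sub>n\<^sup>j\<close> for one \<open>n\<close> much larger than \<open>i\<close> and read the truncations at all \<open>Q\<^sub>k\<close> with \<open>i \<le> k < n\<close> from this
  expansion: since \<open>Q\<^sub>n\<close> has value \<open>\<beta>\<^sub>k\<close> both in the truncation at \<open>Q\<^sub>k\<close> and modulo \<open>Q\<^sub>k\<close>, the term \<open>c\<^sub>j Q\<^sub>n\<^sup>j\<close> counts as \<open>g k j\<close>,
  the line of slope \<open>j\<close> at \<open>\<beta>\<^sub>k\<close>. Let \<open>mg k\<close> be the minimum of these lines at \<open>\<beta>\<^sub>k\<close> and \<open>E k\<close> the largest \<open>j\<close>
  attaining it. The slopes \<open>E k\<close> decrease in \<open>k\<close>, strictly after each \<open>k\<close> at which the minimum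
  is attained twice. There are at most \<open>M + 1\<close> such \<open>k\<close>, so among \<open>M + 3\<close> indices at least two, \<open>k < l\<close>, are left
  where the minimum is attained once. There \<open>mg k\<close> is the value of \<open>F\<close> modulo \<open>Q\<^sub>k\<close>, which by reciprocity is
  \<open>M / m \<cdot> \<beta>\<^sub>k\<close> with \<open>m = deg Q\<^sub>k\<close>. Comparing \<open>k\<close> and \<open>l\<close>, the slope \<open>E k\<close> is at least \<open>M / m\<close>, and no slope can be larger since
  \<open>deg F = M\<close>. So \<open>E k = M / m = d\<close>, the coefficient \<open>c\<^sub>d\<close> is \<open>1\<close>, and the line of slope \<open>d\<close> through the origin lies below all others
  at \<open>\<beta>\<^sub>k\<close>. All other slopes being smaller, this persists at the smaller abscissa \<open>\<beta>\<^sub>i\<close>.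
\<close>

lemma newton_polygon:
  assumes i: "N \<le> i"
  shows "\<exists>d. M = d * m (a, N) \<and> Val (d \<star> \<beta> i) \<le> tr (a, i) F"
proof -
  define n where "n = i + M + 3"
  define c where "c j = expansion (Q (a, n)) F j" for j
  have Nn: "N \<le> n" and n1: "1 \<le> n" using i N(1) by (auto simp: n_def)
  have dp: "0 < m (a, n)" by (rule degree_pos[OF below(1)[OF n1] below(3)])
  have mn: "m (a, n) = m (a, N)" using N(2)[OF Nn] .
  have F_eq: "F = (\<Sum>j\<le>M. c j * Q (a, n) ^ j)" unfolding c_def by (rule expansion_sum_eq[OF dp]) simp
  have dc: "degree (c j) < m (a, N)" for j
    using expansion_degree_bound[OF dp, of F j] mn by (simp add: c_def)
  define d where "d = expansion_degree (Q (a, n)) F"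
  note top = expansion_top[OF Q_monic[OF below(1)[OF n1] below(3)] dp F_nonzero, folded d_def c_def]
  have dM: "M = degree (c d) + d * m (a, N)" using top(3) mn by simp
  have dle: "d \<le> M" using dM degree_pos[OF below(1)[OF N(1)] below(3)] by (cases "m (a, N)") auto
  define g where "g k j = v (c j) + Val (j \<star> \<beta> k)" for k j
  define mg where "mg k = Min (g k ` {..M})" for k
  have mg_le: "mg k \<le> g k j" if "j \<le> M" for k j
    unfolding mg_def using that by (intro Min_le) auto
  have mg_in: "\<exists>j\<le>M. g k j = mg k" for k
  proof -
    have "mg k \<in> g k ` {..M}" unfolding mg_def by (rule Min_in) auto
    then show ?thesis by auto
  qed
  have cd_fin: "v (c d) \<noteq> Infty"
    using finite_value[OF top(1)] dc[of d] degree_le_P[OF below(1)[OF N(1)] below(3)] by simp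
  have mg_fin: "mg k \<noteq> Infty" for k
    using mg_le[OF dle, of k] cd_fin by (auto simp: g_def)
  define E where "E k = Max {j. j \<le> M \<and> g k j = mg k}" for k
  have E: "E k \<le> M" "g k (E k) = mg k" for k
    using Max_in[of "{j. j \<le> M \<and> g k j = mg k}"] mg_in[of k] unfolding E_def by auto
  have E_ge: "j \<le> E k" if "j \<le> M" "g k j = mg k" for k j
    unfolding E_def using that by (intro Max_ge) auto
  have drop: "E l \<le> j" if kl: "N \<le> k" "k < l" and j: "j \<le> M" "g k j = mg k" for k l j
  proof (rule ccontr)
    assume "\<not> E l \<le> j"
    then have less: "j < E l" by simp
    obtain x where x: "v (c j) = Val x" using j(2) mg_fin[of k] by (cases "v (c j)") (auto simp: g_def)
    obtain y where y: "v (c (E l)) = Val y" using E(2)[of l] mg_fin[of l] by (cases "v (c (E l))") (auto simp: g_def)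
    have b: "0 < \<beta> l - \<beta> k" using \<beta>_strict[OF kl] by simp
    have "x + j \<star> \<beta> k \<le> y + E l \<star> \<beta> k"
      using mg_le[OF E(1)[of l], of k] unfolding j(2)[symmetric] by (simp add: g_def x y)
    then have "x - y \<le> E l \<star> \<beta> k - j \<star> \<beta> k" by (simp add: algebra_simps)
    moreover have "y + E l \<star> \<beta> l \<le> x + j \<star> \<beta> l"
      using mg_le[OF j(1), of l] unfolding E(2)[of l, symmetric] by (simp add: g_def x y)
    then have "E l \<star> \<beta> l - j \<star> \<beta> l \<le> x - y" by (simp add: algebra_simps)
    ultimately have "E l \<star> \<beta> l - j \<star> \<beta> l \<le> E l \<star> \<beta> k - j \<star> \<beta> k" by (meson order_trans)
    then have "E l \<star> (\<beta> l - \<beta> k) \<le> j \<star> (\<beta> l - \<beta> k)"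
      unfolding nmult_minus by (simp add: algebra_simps)
    then show False using nmult_less[OF b less] by simp
  qed
  define bad where "bad k \<longleftrightarrow> (\<exists>j\<le>M. j \<noteq> E k \<and> g k j = mg k)" for k
  define B where "B = {k. i \<le> k \<and> k < n \<and> bad k}"
  have bad_drop: "E l < E k" if Nk: "N \<le> k" and kl: "k < l" and bk: "bad k" for k l
  proof -
    obtain j where j: "j \<le> M" "j \<noteq> E k" "g k j = mg k" using bk unfolding bad_def by blast
    then show ?thesis using drop[OF Nk kl j(1,3)] E_ge[OF j(1,3)] by simp
  qed
  have inj: "inj_on E B"
  proof (rule linorder_inj_onI)
    fix k l assume "k < l" "k \<in> B" "l \<in> B"
    then show "E k \<noteq> E l" using bad_drop[of k l] i unfolding B_def by auto
  qed auto
  have finB: "finite B" by (rule finite_subset[of _ "{..<n}"]) (auto simp: B_def)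
  have "card B = card (E ` B)" using card_image[OF inj] by simp
  also have "\<dots> \<le> card {..M}" by (rule card_mono) (use E(1) in auto)
  finally have cB: "card B \<le> M + 1" by simp
  have "card {i..<n} = M + 3" by (simp add: n_def)
  then have "\<not> card ({i..<n} - B) \<le> Suc 0"
    using cB diff_card_le_card_Diff[OF finB, of "{i..<n}"] by simp
  then have "\<exists>k\<in>{i..<n} - B. \<exists>l\<in>{i..<n} - B. k \<noteq> l"
    by (subst (asm) card_le_Suc0_iff_eq) auto
  then obtain k l where kl: "k < l" "k \<in> {i..<n} - B" "l \<in> {i..<n} - B"
    by (meson linorder_neqE_nat)
  have tangent: "M \<star> Val (\<beta> k) = m (a, N) \<star> mg k" if k: "k \<in> {i..<n} - B" for k
  proof -
    have k': "N \<le> k" "k < n" "\<not> bad k" "1 \<le> k" using k i N(1) by (auto simp: B_def)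
    interpret u: pseudo_valuation "\<lambda>f. v (f mod Q (a, k))" "Q (a, k)"
      by (rule residue_pseudo_valuation[OF key_poly_Q degree_le_P])
        (use below k'(4) in \<open>auto simp: below(3)\<close>)
    have dk: "m (a, k) = m (a, N)" "0 < m (a, k)" using N(2)[OF k'(1)] degree_pos[OF below(1)[OF k'(4)] below(3)] by auto
    have uQ: "v (Q (a, n) mod Q (a, k)) = Val (\<beta> k)"
    proof -
      have "Q (a, n) = (Q (a, n) - Q (a, k)) + Q (a, k) * 1" by simp
      then have "Q (a, n) mod Q (a, k) = Q (a, n) - Q (a, k)"
        using adic_mod[OF dk(2) stable_diff(1)[OF k'(1,2)], of 1] by metis
      then show ?thesis using stable_diff(2)[OF k'(1,2)] by simp
    qed
    have tv: "v ((c j * Q (a, n) ^ j) mod Q (a, k)) = g k j" for j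
      using dc[of j] dk by (simp add: u.mult u.power uQ nmult_Val g_def mod_poly_less)
    have "v (F mod Q (a, k)) = v ((\<Sum>j\<le>M. c j * Q (a, n) ^ j) mod Q (a, k))"      by (rule arg_cong[OF F_eq, of "\<lambda>f. v (f mod Q (a, k))"])
    also have "\<dots> = v ((c (E k) * Q (a, n) ^ E k) mod Q (a, k))"
    proof (rule u.sum_unique_min)
      show "v ((c (E k) * Q (a, n) ^ E k) mod Q (a, k)) \<noteq> Infty" using tv E(2) mg_fin by simp
      fix j assume j: "j \<in> {..M}" "j \<noteq> E k"
      then have "g k j \<noteq> mg k" using k'(3) unfolding bad_def by auto
      then have "mg k < g k j" using mg_le[of j k] j(1) by simp
      then show "v ((c (E k) * Q (a, n) ^ E k) mod Q (a, k)) < v ((c j * Q (a, n) ^ j) mod Q (a, k))"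
        unfolding tv E(2) .
    qed (use E(1) in auto)
    also have "\<dots> = mg k" unfolding tv E(2) ..
    finally show ?thesis using reciprocity[OF k'(1)] by simp
  qed
  define e where "e = E k"
  obtain y where y: "v (c e) = Val y" using E(2)[of k] mg_fin[of k] unfolding e_def by (cases "v (c (E k))") (auto simp: g_def)
  have kN: "N \<le> k" using kl(2) i by auto
  have b: "0 < \<beta> l - \<beta> k" using \<beta>_strict[OF kN kl(1)] by simp
  have mgk: "mg k = Val (y + e \<star> \<beta> k)"
    unfolding E(2)[of k, symmetric] e_def[symmetric] g_def y by simp
  have 1: "M \<star> \<beta> k = m (a, N) \<star> (y + e \<star> \<beta> k)"
    using tangent[OF kl(2)] unfolding mgk nmult_Val by simp
  have "M \<star> Val (\<beta> l) \<le> m (a, N) \<star> g l e"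
    unfolding tangent[OF kl(3)] using mg_le[OF E(1)[of k], of l] unfolding e_def by (rule nmult_mono_right)
  then have 2: "M \<star> \<beta> l \<le> m (a, N) \<star> (y + e \<star> \<beta> l)" using y by (simp add: g_def nmult_Val)
  have "M \<star> (\<beta> l - \<beta> k) \<le> m (a, N) \<star> (y + e \<star> \<beta> l) - m (a, N) \<star> (y + e \<star> \<beta> k)"
    unfolding nmult_minus 1 using 2 by simp
  also have "\<dots> = (m (a, N) * e) \<star> (\<beta> l - \<beta> k)"
    unfolding nmult_minus[symmetric] nmult_mult by (simp add: nmult_minus)
  finally have Me: "M \<le> m (a, N) * e" by (rule nmult_le_cancel_left[OF b])
  have ce: "c e \<noteq> 0" using y by auto
  have ed: "e \<le> d" using top(2)[of e] ce by (meson not_le)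
  have "e * m (a, N) \<le> d * m (a, N)" using ed by (rule mult_le_mono1)
  moreover have "M \<le> e * m (a, N)" using Me by (simp only: mult.commute)
  ultimately have Md: "M = d * m (a, N)" "degree (c d) = 0" and "d * m (a, N) \<le> e * m (a, N)"
    using dM by linarith+
  then have de: "d = e" using ed degree_pos[OF below(1)[OF N(1)] below(3)] by simp
  have cd1: "c d = 1"
    using top(4) F_monic Md(2) by (metis degree_eq_zeroE lead_coeff_pCons(2) one_pCons)
  have "y = 0" using y cd1 one unfolding de[symmetric] by (simp add: zero_vval_def)
  then have mgk: "mg k = Val (d \<star> \<beta> k)" using mgk de by simp
  have i1: "1 \<le> i" "i < n" using i N(1) by (auto simp: n_def)
  have low: "Val (d \<star> \<beta> i) \<le> g i j" if j: "j \<le> M" for j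
  proof (cases "c j = 0")
    case False
    then have jd: "j \<le> d" using top(2)[of j] by (meson not_le)
    obtain x where x: "v (c j) = Val x"
      using finite_value[OF False] dc[of j] degree_le_P[OF below(1)[OF N(1)] below(3)] by (cases "v (c j)") auto
    have ik: "0 \<le> \<beta> k - \<beta> i" using \<beta>_strict[OF i, of k] kl(2) by (cases "i = k") auto
    have 1: "d \<star> \<beta> k \<le> x + j \<star> \<beta> k" using mg_le[OF j, of k] mgk x by (simp add: g_def)
    have 2: "j \<star> \<beta> k - j \<star> \<beta> i \<le> d \<star> \<beta> k - d \<star> \<beta> i"
      using nmult_le[OF ik jd] unfolding nmult_minus .
    have "d \<star> \<beta> i \<le> x + j \<star> \<beta> i"
      using add_mono[OF 1 2] by (simp add: algebra_simps)
    then show ?thesis by (simp add: g_def x)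
  qed (simp add: g_def)
  have bi: "(0, 1) \<le> (a, i)" "(a, i) < \<Lambda>" "(a, i) \<le> \<Lambda>" using below i1 by auto
  have di: "m (a, i) = m (a, N)" "0 < m (a, i)" using N(2)[OF i] degree_pos[OF bi(1,3)] by auto
  interpret w: pseudo_valuation "tr (a, i)" 0 by (rule truncation_at(1)[OF bi(1,2)])
  have "Val (d \<star> \<beta> i) \<le> tr (a, i) F"
    unfolding arg_cong[OF F_eq, of "tr (a, i)"]
  proof (rule w.sum_ge)
    fix j assume j: "j \<in> {..M}"
    have "tr (a, i) (c j * Q (a, n) ^ j) = g i j"
      using truncation_at(3)[OF bi(1,2), of "c j"] dc[of j] di truncation_later[OF i i1(2)]
      by (simp add: w.mult w.power nmult_Val g_def)
    then show "Val (d \<star> \<beta> i) \<le> tr (a, i) (c j * Q (a, n) ^ j)" using low j by simp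
  qed
  then show ?thesis using Md(1) by blast
qed

text \<open>
  \<open>F\<close> has the leading term \<open>Q\<^sub>i\<^sup>d\<close>, whose value is the lower bound for the truncation just found. So the minimum is attained
  at the largest possible index.
\<close>

lemma effective_degree_limit:
  assumes i: "N \<le> i"
  shows "effective_degree v (Q (a, i)) F = M div m (a, N)" "m (a, N) dvd M"
proof -
  obtain d where d: "M = d * m (a, N)" "Val (d \<star> \<beta> i) \<le> tr (a, i) F" using newton_polygon[OF i] by blast
  have i1: "1 \<le> i" using i N(1) by simp
  have bi: "(0, 1) \<le> (a, i)" "(a, i) < \<Lambda>" "(a, i) \<le> \<Lambda>" using below i1 by auto
  have di: "m (a, i) = m (a, N)" "0 < m (a, i)" using N(2)[OF i] degree_pos[OF bi(1,3)] by auto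
  note top = expansion_top_monic[OF Q_monic[OF bi(1,3)] di(2) F_monic, of d]
  have "term_value v (Q (a, i)) F d = Val (d \<star> \<beta> i)"
    using top(2) d(1) di(1) value_Q[OF i1] one by (simp add: term_value_alt nmult_Val zero_vval_def)
  then have tr: "tr (a, i) F = term_value v (Q (a, i)) F d" "tr (a, i) F \<noteq> Infty"
    using d(2) truncation_le[of "Q (a, i)" v, OF di(2) zero, of F d] by auto
  moreover have "term_value v (Q (a, i)) F j \<noteq> tr (a, i) F" if "d < j" for j
    using top(3)[of j] that d(1) di(1) tr(2) by (simp add: term_value_def)
  ultimately have "d \<in> {j. term_value v (Q (a, i)) F j = tr (a, i) F}"
    "{j. term_value v (Q (a, i)) F j = tr (a, i) F} \<subseteq> {..d}"
    by (auto simp: not_less[symmetric])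
  then have "effective_degree v (Q (a, i)) F = d"
    unfolding effective_degree_def by (intro Max_eqI) (auto intro: finite_subset)
  then show "effective_degree v (Q (a, i)) F = M div m (a, N)" using d(1) di by simp
  show "m (a, N) dvd M" using d(1) by simp
qed

lemma limit_delta_eq: "M = limit_delta v Q (Suc a) * m (a, N)"
proof -
  have ev: "\<forall>\<^sub>F i in sequentially. effective_degree v (Q (a, i)) F = M div m (a, N)"
    unfolding eventually_sequentially using effective_degree_limit(1) by blast
  have "limit_delta v Q (Suc a) = M div m (a, N)"
    unfolding limit_delta_def eventual_value_def
  proof (rule the_equality)
    show "\<forall>\<^sub>F i in sequentially. effective_degree v (Q (Suc a - 1, i)) F = M div m (a, N)" using ev by simp
    fix x assume "\<forall>\<^sub>F i in sequentially. effective_degree v (Q (Suc a - 1, i)) F = x"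
    then have "\<forall>\<^sub>F i in sequentially. x = M div m (a, N)"
      using ev by eventually_elim simp
    then show "x = M div m (a, N)" by simp
  qed
  then show ?thesis using effective_degree_limit(2)[of N] by simp
qed

end

section \<open>Graded bases of a valued extension\<close>

lemma type_algebra_simps [simp]:
  "carrier (ring_of_type_algebra :: 'a::comm_ring_1 ring) = UNIV"
  "x \<otimes>\<^bsub>ring_of_type_algebra\<^esub> y = x * y" "\<one>\<^bsub>ring_of_type_algebra :: 'a ring\<^esub> = 1"
  "\<zero>\<^bsub>ring_of_type_algebra :: 'a ring\<^esub> = 0" "x \<oplus>\<^bsub>ring_of_type_algebra\<^esub> y = x + y"
  for x y :: "'a::comm_ring_1"
  by (simp_all add: ring_of_type_algebra_def)

lemma combine_type_algebra:
  "ring.combine (ring_of_type_algebra :: 'a::comm_ring_1 ring) ks us = sum_list (map2 (*) ks us)"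
proof -
  interpret R: ring "ring_of_type_algebra :: 'a ring" ..
  show ?thesis by (induction ks us rule: R.combine.induct) auto
qed

context ring
begin

lemma dim_eqI:
  assumes "subfield K R" "set us \<subseteq> carrier R"
    and indep: "\<And>ks. set ks \<subseteq> K \<Longrightarrow> combine ks us = \<zero> \<Longrightarrow> set (take (length us) ks) \<subseteq> {\<zero>}"
    and span: "\<And>x. x \<in> carrier R \<Longrightarrow> \<exists>ks. set ks \<subseteq> K \<and> x = combine ks us"
  shows "dim K (carrier R) = length us"
proof -
  have "independent K us"
    using assms(1,2) indep by (intro trivial_combine_imp_independent)
  moreover have "Span K us = carrier R"
  proof
    show "Span K us \<subseteq> carrier R" using Span_subgroup_props(1)[OF assms(1,2)] .
    show "carrier R \<subseteq> Span K us"
      unfolding Span_eq_combine_set[OF assms(1,2)] using span by blast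
  qed
  ultimately have "dimension (length us) K (carrier R)" using dimensionI[OF assms(1)] by blast
  then show ?thesis using dimI[OF assms(1)] by (simp add: over_def)
qed

end

context valued_field
begin

lemma valuation_ring_simps [simp]:
  "carrier (valuation_ring \<mu>) = integers \<mu>"
  "x \<otimes>\<^bsub>valuation_ring \<mu>\<^esub> y = x * y" "\<one>\<^bsub>valuation_ring \<mu>\<^esub> = 1"
  "\<zero>\<^bsub>valuation_ring \<mu>\<^esub> = 0" "x \<oplus>\<^bsub>valuation_ring \<mu>\<^esub> y = x + y"
  by (simp_all add: valuation_ring_def)

lemma valuation_ring_cring: "cring (valuation_ring \<mu>)"
proof (rule cringI)
  show "abelian_group (valuation_ring \<mu>)"
  proof (rule abelian_groupI)
    fix x assume "x \<in> carrier (valuation_ring \<mu>)"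
    then show "\<exists>y\<in>carrier (valuation_ring \<mu>). y \<oplus>\<^bsub>valuation_ring \<mu>\<^esub> x = \<zero>\<^bsub>valuation_ring \<mu>\<^esub>"
      using O.minus_in[of x] by (intro bexI[of _ "- x"]) auto
  qed (auto intro: O.add_in O.zero_in)
  show "Group.comm_monoid (valuation_ring \<mu>)"
    by (rule comm_monoidI) (auto intro: O.mult_in O.one_in)
qed (auto simp: algebra_simps)

lemma max_ideal_maximal: "maximalideal (max_ideal \<mu>) (valuation_ring \<mu>)"
proof -
  interpret R: cring "valuation_ring \<mu>" by (rule valuation_ring_cring)
  have sub: "max_ideal \<mu> \<subseteq> integers \<mu>" by (auto simp: max_ideal_def integers_def)
  have sg: "subgroup (max_ideal \<mu>) (add_monoid (valuation_ring \<mu>))"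
  proof (rule R.add.subgroupI)
    show "max_ideal \<mu> \<noteq> {}" by (auto simp: max_ideal_def intro!: exI[of _ 0])
    fix a assume a: "a \<in> max_ideal \<mu>"
    have "\<ominus>\<^bsub>valuation_ring \<mu>\<^esub> a = - a"
      using a sub O.minus_in by (intro R.minus_equality) auto
    then show "\<ominus>\<^bsub>valuation_ring \<mu>\<^esub> a \<in> max_ideal \<mu>"
      using a by (simp add: max_ideal_def)
    fix b assume "b \<in> max_ideal \<mu>"
    then show "a \<oplus>\<^bsub>valuation_ring \<mu>\<^esub> b \<in> max_ideal \<mu>"
      using a add_gr[of 0 a b] by (simp add: max_ideal_def)
  qed (use sub in auto)
  have mult_in: "x * a \<in> max_ideal \<mu>" if "a \<in> max_ideal \<mu>" "x \<in> integers \<mu>" for a x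
    using that by (auto simp: max_ideal_def integers_def mult intro: add_nonneg_pos)
  have id: "ideal (max_ideal \<mu>) (valuation_ring \<mu>)"
    using mult_in by (intro idealI R.ring_axioms sg) (auto simp: mult.commute)
  show ?thesis
  proof (rule maximalidealI[OF id])
    have "1 \<in> integers \<mu>" "1 \<notin> max_ideal \<mu>" by (auto simp: integers_def max_ideal_def one)
    then show "carrier (valuation_ring \<mu>) \<noteq> max_ideal \<mu>" by auto
    fix J assume J: "ideal J (valuation_ring \<mu>)" "max_ideal \<mu> \<subseteq> J" "J \<subseteq> carrier (valuation_ring \<mu>)"
    show "J = max_ideal \<mu> \<or> J = carrier (valuation_ring \<mu>)"
    proof (rule disjCI)
      assume "J \<noteq> carrier (valuation_ring \<mu>)"
      moreover have "J = carrier (valuation_ring \<mu>)" if x: "x \<in> J" "x \<notin> max_ideal \<mu>" for x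
      proof -
        have "\<mu> x = 0" using x J(3) by (force simp: max_ideal_def integers_def)
        then have "x \<noteq> 0" "inverse x \<in> carrier (valuation_ring \<mu>)"
          using value_inverse_0[of x] eq_Infty_iff[of x] by (auto simp: integers_def)
        then have "\<one>\<^bsub>valuation_ring \<mu>\<^esub> \<in> J"
          using ideal.I_l_closed[OF J(1) x(1), of "inverse x"] by simp
        then show ?thesis by (rule ideal.one_imp_carrier[OF J(1)])
      qed
      ultimately show "J = max_ideal \<mu>" using J(2) by blast
    qed
  qed
qed

lemma residue_field_field: "field (residue_field \<mu>)"
  unfolding residue_field_def
  by (rule maximalideal.quotient_is_field[OF max_ideal_maximal valuation_ring_cring])

lemma residue_class_hom: "residue_class \<mu> \<in> Ring.ring_hom (valuation_ring \<mu>) (residue_field \<mu>)"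
proof -
  interpret maximalideal "max_ideal \<mu>" "valuation_ring \<mu>" by (rule max_ideal_maximal)
  have "residue_class \<mu> = (+>\<^bsub>valuation_ring \<mu>\<^esub>) (max_ideal \<mu>)" by (auto simp: residue_class_def)
  then show ?thesis using rcos_ring_hom unfolding residue_field_def by simp
qed

lemma residue_class_carrier: "x \<in> integers \<mu> \<Longrightarrow> residue_class \<mu> x \<in> carrier (residue_field \<mu>)"
  using ring_hom_closed[OF residue_class_hom] by simp

lemma residue_class_add: "x \<in> integers \<mu> \<Longrightarrow> y \<in> integers \<mu> \<Longrightarrow>
    residue_class \<mu> (x + y) = residue_class \<mu> x \<oplus>\<^bsub>residue_field \<mu>\<^esub> residue_class \<mu> y"
  using ring_hom_add[OF residue_class_hom, of x y] by simp

lemma residue_class_mult: "x \<in> integers \<mu> \<Longrightarrow> y \<in> integers \<mu> \<Longrightarrow>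
    residue_class \<mu> (x * y) = residue_class \<mu> x \<otimes>\<^bsub>residue_field \<mu>\<^esub> residue_class \<mu> y"
  using ring_hom_mult[OF residue_class_hom, of x y] by simp

lemma residue_class_one: "residue_class \<mu> 1 = \<one>\<^bsub>residue_field \<mu>\<^esub>"
  using ring_hom_one[OF residue_class_hom] by simp

lemma residue_class_set: "residue_class \<mu> x = {h + x | h. h \<in> max_ideal \<mu>}"
  by (auto simp: residue_class_def a_r_coset_def' )

lemma residue_class_eq_iff: "residue_class \<mu> x = residue_class \<mu> y \<longleftrightarrow> x - y \<in> max_ideal \<mu>"
proof
  assume eq: "residue_class \<mu> x = residue_class \<mu> y"
  have "0 + x \<in> residue_class \<mu> x" unfolding residue_class_set by (auto simp: max_ideal_def)
  then show "x - y \<in> max_ideal \<mu>" unfolding eq unfolding residue_class_set by auto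
next
  have sub: "residue_class \<mu> x \<subseteq> residue_class \<mu> y" if "x - y \<in> max_ideal \<mu>" for x y
  proof
    fix z assume "z \<in> residue_class \<mu> x"
    then obtain h where h: "z = h + x" "h \<in> max_ideal \<mu>" unfolding residue_class_set by auto
    have "h + (x - y) \<in> max_ideal \<mu>" using h(2) that add_gr[of 0 h "x - y"] by (simp add: max_ideal_def)
    then show "z \<in> residue_class \<mu> y"
      unfolding residue_class_set h(1) by (intro CollectI exI[of _ "h + (x - y)"]) simp
  qed
  assume "x - y \<in> max_ideal \<mu>"
  moreover then have "y - x \<in> max_ideal \<mu>" using minus[of "x - y"] by (simp add: max_ideal_def)
  ultimately show "residue_class \<mu> x = residue_class \<mu> y" using sub by blast
qed

lemma residue_class_zero: "residue_class \<mu> 0 = \<zero>\<^bsub>residue_field \<mu>\<^esub>"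
proof -
  interpret R: field "residue_field \<mu>" by (rule residue_field_field)
  have c: "residue_class \<mu> 0 \<in> carrier (residue_field \<mu>)" by (rule residue_class_carrier[OF O.zero_in])
  have "residue_class \<mu> 0 \<oplus>\<^bsub>residue_field \<mu>\<^esub> residue_class \<mu> 0 = residue_class \<mu> 0"
    using residue_class_add[OF O.zero_in O.zero_in] by simp
  then show ?thesis using c R.add.l_cancel_one'[OF c c] by auto
qed

lemma residue_class_eq_zero_iff: "residue_class \<mu> x = \<zero>\<^bsub>residue_field \<mu>\<^esub> \<longleftrightarrow> 0 < \<mu> x"
  using residue_class_eq_iff[of x 0] by (simp add: residue_class_zero max_ideal_def)

lemma residue_carrier_eq: "carrier (residue_field \<mu>) = residue_class \<mu> ` integers \<mu>"
  unfolding residue_field_def FactRing_def A_RCOSETS_def' residue_class_def by auto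

lemma combine_residue_class:
  assumes "set ks \<subseteq> integers \<mu>" "set us \<subseteq> integers \<mu>"
  shows "ring.combine (residue_field \<mu>) (map (residue_class \<mu>) ks) (map (residue_class \<mu>) us)
      = residue_class \<mu> (sum_list (map2 (*) ks us))"
    and "sum_list (map2 (*) ks us) \<in> integers \<mu>"
proof -
  interpret R: field "residue_field \<mu>" by (rule residue_field_field)
  have "R.combine (map (residue_class \<mu>) ks) (map (residue_class \<mu>) us)
      = residue_class \<mu> (sum_list (map2 (*) ks us)) \<and> sum_list (map2 (*) ks us) \<in> integers \<mu>"
    using assms
  proof (induction ks arbitrary: us)
    case Nil
    then show ?case by (simp add: residue_class_zero O.zero_in)
  next
    case (Cons k ks)
    show ?case
    proof (cases us)
      case Nil
      then show ?thesis by (simp add: residue_class_zero O.zero_in)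
    next
      case (Cons u us')
      then show ?thesis using Cons.IH[of us'] Cons.prems
        by (auto simp: residue_class_add residue_class_mult O.mult_in O.add_in)
    qed
  qed
  then show "ring.combine (residue_field \<mu>) (map (residue_class \<mu>) ks) (map (residue_class \<mu>) us)
      = residue_class \<mu> (sum_list (map2 (*) ks us))"
    and "sum_list (map2 (*) ks us) \<in> integers \<mu>" by auto
qed

end

locale valued_extension = K: valued_field \<mu> + L: valued_field \<nu>
  for \<mu> :: "'k::field \<Rightarrow> 'g::linordered_ab_group_add vval" and \<nu> :: "'l::field \<Rightarrow> 'g vval" +
  fixes \<phi> :: "'k \<Rightarrow> 'l"
  assumes hom: "\<phi> (a + b) = \<phi> a + \<phi> b" "\<phi> (a * b) = \<phi> a * \<phi> b" "\<phi> 1 = 1"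
    and extends: "\<nu> (\<phi> a) = \<mu> a"
begin

lemma hom_0 [simp]: "\<phi> 0 = 0"
  using hom(1)[of 0 0] by (metis add.right_neutral add_left_cancel)

lemma hom_minus: "\<phi> (- a) = - \<phi> a"
  using hom(1)[of a "- a"] by (simp add: eq_neg_iff_add_eq_0 add.commute)

lemma hom_eq_0_iff [simp]: "\<phi> a = 0 \<longleftrightarrow> a = 0"
  using extends[of a] L.eq_Infty_iff[of "\<phi> a"] K.eq_Infty_iff[of a] by simp

lemma hom_integers: "a \<in> integers \<mu> \<longleftrightarrow> \<phi> a \<in> integers \<nu>"
  by (simp add: integers_def extends)

definition k_image :: "'l set set" where
  "k_image = (\<lambda>a. residue_class \<nu> (\<phi> a)) ` integers \<mu>"

lemma k_image_subfield: "subfield k_image (residue_field \<nu>)"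
proof -
  interpret R: field "residue_field \<nu>" by (rule L.residue_field_field)
  show ?thesis
  proof (rule R.subfieldI')
    show "subring k_image (residue_field \<nu>)"
    proof (rule R.subringI)
      show "k_image \<subseteq> carrier (residue_field \<nu>)"
        unfolding k_image_def using L.residue_class_carrier hom_integers by auto
      show "\<one>\<^bsub>residue_field \<nu>\<^esub> \<in> k_image"
        unfolding k_image_def using L.residue_class_one K.O.one_in hom(3) by (metis image_eqI)
      fix x assume "x \<in> k_image"
      then obtain a where a: "a \<in> integers \<mu>" "x = residue_class \<nu> (\<phi> a)" unfolding k_image_def by blast
      have "residue_class \<nu> (\<phi> (- a)) \<oplus>\<^bsub>residue_field \<nu>\<^esub> x = residue_class \<nu> (\<phi> (- a) + \<phi> a)"
        unfolding a(2) using a(1) K.O.minus_in[OF a(1)] by (subst L.residue_class_add) (auto simp flip: hom_integers)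
      then have "\<ominus>\<^bsub>residue_field \<nu>\<^esub> x = residue_class \<nu> (\<phi> (- a))"
        using a K.O.minus_in[OF a(1)]
        by (intro R.minus_equality) (auto simp: hom_minus L.residue_class_zero intro!: L.residue_class_carrier simp flip: hom_integers,
            metis hom_integers hom_minus K.O.minus_in)
      then show "\<ominus>\<^bsub>residue_field \<nu>\<^esub> x \<in> k_image" unfolding k_image_def using K.O.minus_in[OF a(1)] by blast
      fix y assume "y \<in> k_image"
      then obtain b where b: "b \<in> integers \<mu>" "y = residue_class \<nu> (\<phi> b)" unfolding k_image_def by blast
      have "x \<otimes>\<^bsub>residue_field \<nu>\<^esub> y = residue_class \<nu> (\<phi> (a * b))"
        unfolding a(2) b(2) hom using a b hom_integers by (simp add: L.residue_class_mult)
      then show "x \<otimes>\<^bsub>residue_field \<nu>\<^esub> y \<in> k_image" unfolding k_image_def using K.O.mult_in[OF a(1) b(1)] by blast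
      have "x \<oplus>\<^bsub>residue_field \<nu>\<^esub> y = residue_class \<nu> (\<phi> (a + b))"
        unfolding a(2) b(2) hom using a b hom_integers by (simp add: L.residue_class_add)
      then show "x \<oplus>\<^bsub>residue_field \<nu>\<^esub> y \<in> k_image" unfolding k_image_def using K.O.add_in[OF a(1) b(1)] by blast
    qed
    fix x assume x: "x \<in> k_image - {\<zero>\<^bsub>residue_field \<nu>\<^esub>}"
    then obtain a where a: "a \<in> integers \<mu>" "x = residue_class \<nu> (\<phi> a)" unfolding k_image_def by blast
    have "\<mu> a = 0" using x a by (force simp: L.residue_class_eq_zero_iff extends integers_def)
    then have i: "a \<noteq> 0" "inverse a \<in> integers \<mu>"
      using K.value_inverse_0[of a] K.eq_Infty_iff[of a] by (auto simp: integers_def)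
    have "x \<otimes>\<^bsub>residue_field \<nu>\<^esub> residue_class \<nu> (\<phi> (inverse a)) = \<one>\<^bsub>residue_field \<nu>\<^esub>"
      unfolding a(2) using a(1) i hom_integers
      by (subst L.residue_class_mult[symmetric]) (auto simp: hom(2)[symmetric] hom(3) L.residue_class_one)
    then have "inv\<^bsub>residue_field \<nu>\<^esub> x = residue_class \<nu> (\<phi> (inverse a))"
      using a i hom_integers by (intro R.comm_inv_char) (auto intro!: L.residue_class_carrier)
    then show "inv\<^bsub>residue_field \<nu>\<^esub> x \<in> k_image" unfolding k_image_def using i(2) by blast
  qed
qed

text \<open>
  As the value of a sum is at least the least value of its terms, the third condition says that it is equal to it.
\<close>

definition graded_basis :: "'l set \<Rightarrow> bool" where
  "graded_basis S \<longleftrightarrow> finite S \<and> 0 \<notin> S \<and>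
     (\<forall>c. \<forall>s\<in>S. \<nu> (\<Sum>t\<in>S. \<phi> (c t) * t) \<le> \<nu> (\<phi> (c s) * s)) \<and>
     (\<forall>y. y \<noteq> 0 \<longrightarrow> (\<exists>c. \<nu> y < \<nu> (y - (\<Sum>s\<in>S. \<phi> (c s) * s))))"

text \<open>
  The elements of \<open>S\<close> whose values lie in the coset of \<open>\<nu> t\<close> modulo the value group of \<open>\<mu>\<close>. Rescaling by elements of \<open>K\<close> moves their values to
  that of \<open>t\<close>.
\<close>

definition fibre :: "'l set \<Rightarrow> 'l \<Rightarrow> 'l set" where
  "fibre S t = {s \<in> S. \<exists>a. a \<noteq> 0 \<and> \<nu> (\<phi> a * s) = \<nu> t}"

context
  fixes S :: "'l set"
  assumes S: "graded_basis S"
begin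

lemma S_finite: "finite S" and S_nonzero: "0 \<notin> S"
  and S_min: "s \<in> S \<Longrightarrow> \<nu> (\<Sum>t\<in>S. \<phi> (c t) * t) \<le> \<nu> (\<phi> (c s) * s)"
  and S_approx: "y \<noteq> 0 \<Longrightarrow> \<exists>c. \<nu> y < \<nu> (y - (\<Sum>s\<in>S. \<phi> (c s) * s))"
  using S unfolding graded_basis_def by auto

lemma approx_terms:
  assumes y: "\<nu> y < \<nu> (y - (\<Sum>s\<in>S. \<phi> (c s) * s))" and s: "s \<in> S"
  shows "\<nu> y \<le> \<nu> (\<phi> (c s) * s)" "s \<notin> fibre S y \<Longrightarrow> \<nu> y < \<nu> (\<phi> (c s) * s)"
proof -
  let ?z = "\<Sum>s\<in>S. \<phi> (c s) * s"
  have "\<nu> y \<le> \<nu> (y - (y - ?z))" using y by (rule L.diff_ge[OF order_refl order_less_imp_le])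
  then show le: "\<nu> y \<le> \<nu> (\<phi> (c s) * s)" using S_min[OF s, of c] by simp
  assume "s \<notin> fibre S y"
  moreover have "c s \<noteq> 0" if "\<nu> (\<phi> (c s) * s) = \<nu> y" using that y by (intro notI) auto
  ultimately have "\<nu> (\<phi> (c s) * s) \<noteq> \<nu> y" using s unfolding fibre_def by blast
  then show "\<nu> y < \<nu> (\<phi> (c s) * s)" using le by simp
qed

lemma fibre_nonempty:
  assumes "y \<noteq> 0"
  shows "fibre S y \<noteq> {}"
proof
  assume e: "fibre S y = {}"
  obtain c where c: "\<nu> y < \<nu> (y - (\<Sum>s\<in>S. \<phi> (c s) * s))" using S_approx[OF assms] by blast
  have "\<nu> y < \<nu> (\<Sum>s\<in>S. \<phi> (c s) * s)"
    using approx_terms(2)[OF c] e assms by (intro L.sum_gr) auto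
  from L.add_gr[OF c this] show False by simp
qed

text \<open>
  After rescaling the elements \<open>s\<close> of the fibre to the value of \<open>t\<close>, the residue classes of the quotients \<open>u s\<close> of \<open>s\<close> by \<open>t\<close> form a
  basis of the residue field. A relation among them would lift to a sum of value larger than that of its terms, and
  approximating \<open>y t\<close> by a combination of \<open>S\<close> expresses the residue class of a unit \<open>y\<close>; the elements
  outside the fibre contribute only terms of larger value.
\<close>

lemma card_fibre:
  assumes t: "t \<noteq> 0"
  shows "card (fibre S t) = residue_degree \<phi> \<mu> \<nu>"
proof -
  interpret R: field "residue_field \<nu>" by (rule L.residue_field_field)
  have "\<forall>s\<in>fibre S t. \<exists>a. a \<noteq> 0 \<and> \<nu> (\<phi> a * s) = \<nu> t" unfolding fibre_def by blast
  then obtain a where a: "\<And>s. s \<in> fibre S t \<Longrightarrow> a s \<noteq> 0" "\<And>s. s \<in> fibre S t \<Longrightarrow> \<nu> (\<phi> (a s) * s) = \<nu> t"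
    by metis
  have sub: "fibre S t \<subseteq> S" unfolding fibre_def by blast
  have fin: "finite (fibre S t)" using sub S_finite by (rule finite_subset)
  obtain ss where ss: "distinct ss" "set ss = fibre S t" using finite_distinct_list[OF fin] by blast
  define n where "n = length ss"
  have n: "n = card (fibre S t)" using ss distinct_card n_def by metis
  have bij: "bij_betw (\<lambda>i. ss ! i) {..<n} (fibre S t)"
    using bij_betw_nth[OF ss(1) _ ss(2)[symmetric]] n_def by blast
  have ssi: "ss ! i \<in> fibre S t" if "i < n" for i using that ss(2) n_def by (metis nth_mem)
  define u where "u s = \<phi> (a s) * s / t" for s
  have ut: "u s * t = \<phi> (a s) * s" for s using t by (simp add: u_def)
  have u0: "\<nu> (u s) = 0" if "s \<in> fibre S t" for s
  proof -
    have "\<nu> t + \<nu> (u s) = \<nu> t + 0" using ut[of s] a(2)[OF that] L.mult[of "u s" t] by (simp add: add.commute)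
    then show ?thesis using vval_add_left_cancel(3)[of "\<nu> t" "\<nu> (u s)" 0] t by simp
  qed
  have uO: "u s \<in> integers \<nu>" if "s \<in> fibre S t" for s using u0[OF that] by (simp add: integers_def)
  define us where "us = map u ss"
  have usO: "set us \<subseteq> integers \<nu>" using uO ss(2) by (auto simp: us_def)
  have lus: "length us = n" by (simp add: us_def n_def)
  have sums: "sum_list (map2 (*) (map \<phi> ks) us)
      = (\<Sum>i<n. \<phi> (if i < length ks then ks ! i else 0) * u (ss ! i))" for ks
  proof -
    have "sum_list (map2 (*) (map \<phi> ks) us) = (\<Sum>i<min (length ks) n. \<phi> (ks ! i) * u (ss ! i))"
      unfolding sum_list_sum_nth by (simp add: us_def n_def atLeast0LessThan)
    also have "\<dots> = (\<Sum>i<n. \<phi> (if i < length ks then ks ! i else 0) * u (ss ! i))"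
      by (rule sum.mono_neutral_cong_left) auto
    finally show ?thesis .
  qed
  have indep: "set (take (length (map (residue_class \<nu>) us)) Ks) \<subseteq> {\<zero>\<^bsub>residue_field \<nu>\<^esub>}"
    if Ks: "set Ks \<subseteq> k_image" "R.combine Ks (map (residue_class \<nu>) us) = \<zero>\<^bsub>residue_field \<nu>\<^esub>" for Ks
  proof -
    have "\<exists>ks. set ks \<subseteq> integers \<mu> \<and> Ks = map (\<lambda>a. residue_class \<nu> (\<phi> a)) ks"
      using Ks(1)
    proof (induction Ks)
      case (Cons K Ks)
      then obtain ks where "set ks \<subseteq> integers \<mu>" "Ks = map (\<lambda>a. residue_class \<nu> (\<phi> a)) ks" by auto
      moreover obtain k where "k \<in> integers \<mu>" "K = residue_class \<nu> (\<phi> k)"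
        using Cons.prems unfolding k_image_def by auto
      ultimately show ?case by (intro exI[of _ "k # ks"]) auto
    qed simp
    then obtain ks where ks: "set ks \<subseteq> integers \<mu>" "Ks = map (residue_class \<nu>) (map \<phi> ks)" by auto
    define k' where "k' i = (if i < length ks then ks ! i else 0)" for i
    have kO: "set (map \<phi> ks) \<subseteq> integers \<nu>" using ks(1) hom_integers by auto
    have "0 < \<nu> (sum_list (map2 (*) (map \<phi> ks) us))"
      using Ks(2) unfolding ks(2) L.combine_residue_class(1)[OF kO usO] L.residue_class_eq_zero_iff .
    then have pos: "0 < \<nu> (\<Sum>i<n. \<phi> (k' i) * u (ss ! i))" unfolding sums k'_def .
    define c where "c s = (if s \<in> fibre S t then k' (the_inv_into {..<n} (\<lambda>i. ss ! i) s) * a s else 0)" for s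
    have inv: "the_inv_into {..<n} (\<lambda>i. ss ! i) (ss ! i) = i" if "i < n" for i
      using bij that by (intro the_inv_into_f_f) (auto simp: bij_betw_def)
    have cs: "\<phi> (c (ss ! i)) * ss ! i = \<phi> (k' i) * u (ss ! i) * t" if "i < n" for i
      using ssi[OF that] inv[OF that] by (simp add: c_def hom(2) mult.assoc ut)
    have "(\<Sum>s\<in>S. \<phi> (c s) * s) = (\<Sum>s\<in>fibre S t. \<phi> (c s) * s)"
      using sub S_finite by (intro sum.mono_neutral_right) (auto simp: c_def)
    also have "\<dots> = (\<Sum>i<n. \<phi> (c (ss ! i)) * ss ! i)" by (rule sum.reindex_bij_betw[OF bij, symmetric])
    also have "\<dots> = (\<Sum>i<n. \<phi> (k' i) * u (ss ! i)) * t" unfolding sum_distrib_right using cs by (intro sum.cong) auto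
    finally have sum: "(\<Sum>s\<in>S. \<phi> (c s) * s) = (\<Sum>i<n. \<phi> (k' i) * u (ss ! i)) * t" .
    have small: "0 < \<mu> (k' i)" if i: "i < n" for i
    proof -
      have "\<nu> t + 0 < \<nu> t + \<nu> (\<Sum>i<n. \<phi> (k' i) * u (ss ! i))"
        using pos t vval_add_left_cancel(2)[of "\<nu> t" 0] by simp
      also have "\<dots> = \<nu> (\<Sum>s\<in>S. \<phi> (c s) * s)" unfolding sum by (simp add: L.mult add.commute)
      also have "\<dots> \<le> \<nu> (\<phi> (c (ss ! i)) * ss ! i)" using ssi[OF i] sub by (intro S_min) auto
      also have "\<dots> = \<nu> t + \<mu> (k' i)" unfolding cs[OF i] using u0[OF ssi[OF i]] by (simp add: L.mult extends add.commute)
      finally show ?thesis using t vval_add_left_cancel(2)[of "\<nu> t" 0] by simp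
    qed
    show ?thesis
    proof
      fix x assume "x \<in> set (take (length (map (residue_class \<nu>) us)) Ks)"
      then obtain i where i: "i < n" "i < length ks" "x = residue_class \<nu> (\<phi> (ks ! i))"
        unfolding ks(2) in_set_conv_nth by (auto simp: lus)
      then show "x \<in> {\<zero>\<^bsub>residue_field \<nu>\<^esub>}"
        using small[OF i(1)] by (simp add: k'_def L.residue_class_eq_zero_iff extends)
    qed
  qed
  have span: "\<exists>Ks. set Ks \<subseteq> k_image \<and> x = R.combine Ks (map (residue_class \<nu>) us)"
    if x: "x \<in> carrier (residue_field \<nu>)" for x
  proof -
    obtain y where y: "y \<in> integers \<nu>" "x = residue_class \<nu> y" using x unfolding L.residue_carrier_eq by blast
    have "\<exists>ks. set ks \<subseteq> integers \<mu> \<and> 0 < \<nu> (y - sum_list (map2 (*) (map \<phi> ks) us))"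
    proof (cases "\<nu> y = 0")
      case False
      then have "0 < \<nu> y" using y(1) by (simp add: integers_def order_less_le)
      then show ?thesis by (intro exI[of _ "[]"]) simp
    next
      case True
      have "y \<noteq> 0" using True L.eq_Infty_iff[of y] by auto
      then have yt: "y * t \<noteq> 0" using t by simp
      have vyt: "\<nu> (y * t) = \<nu> t" using True by (simp add: L.mult)
      have fib: "fibre S (y * t) = fibre S t" unfolding fibre_def vyt ..
      obtain c where c: "\<nu> (y * t) < \<nu> (y * t - (\<Sum>s\<in>S. \<phi> (c s) * s))" using S_approx[OF yt] by blast
      define ks where "ks = map (\<lambda>s. c s * inverse (a s)) ss"
      have ki: "\<phi> (ks ! i) * u (ss ! i) * t = \<phi> (c (ss ! i)) * ss ! i" if "i < n" for i
        using that a(1)[OF ssi[OF that]]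
        by (simp add: ks_def n_def hom(2) mult.assoc ut) (simp add: mult.assoc[symmetric] hom(2)[symmetric] hom(3))
      have "\<nu> t + 0 \<le> \<nu> t + \<mu> (ks ! i)" if i: "i < n" for i
      proof -
        have "\<nu> t \<le> \<nu> (\<phi> (c (ss ! i)) * ss ! i)"
          using approx_terms(1)[OF c] ssi[OF i] sub vyt by auto
        then show ?thesis unfolding ki[OF i, symmetric] using u0[OF ssi[OF i]] by (simp add: L.mult extends add.commute)
      qed
      then have kO: "set ks \<subseteq> integers \<mu>"
        using t vval_add_left_cancel(1)[of "\<nu> t" 0] unfolding integers_def set_conv_nth
        by (auto simp: ks_def n_def)
      have lk: "length ks = n" by (simp add: ks_def n_def)
      have S_split: "(\<Sum>s\<in>S. \<phi> (c s) * s) = (\<Sum>s\<in>fibre S t. \<phi> (c s) * s) + (\<Sum>s\<in>S - fibre S t. \<phi> (c s) * s)"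
        using sum.subset_diff[OF sub S_finite] by (simp add: add.commute)
      have rest: "\<nu> (y * t) < \<nu> (\<Sum>s\<in>S - fibre S t. \<phi> (c s) * s)"
        using approx_terms(2)[OF c] yt fib by (intro L.sum_gr) auto
      have main: "(\<Sum>s\<in>fibre S t. \<phi> (c s) * s) = sum_list (map2 (*) (map \<phi> ks) us) * t"
      proof -
        have "(\<Sum>s\<in>fibre S t. \<phi> (c s) * s) = (\<Sum>i<n. \<phi> (c (ss ! i)) * ss ! i)"
          by (rule sum.reindex_bij_betw[OF bij, symmetric])
        also have "\<dots> = (\<Sum>i<n. \<phi> (if i < length ks then ks ! i else 0) * u (ss ! i)) * t"
          unfolding sum_distrib_right using ki lk by (intro sum.cong) auto
        finally show ?thesis unfolding sums .
      qed
      have "\<nu> (y * t) < \<nu> ((y * t - (\<Sum>s\<in>S. \<phi> (c s) * s)) + (\<Sum>s\<in>S - fibre S t. \<phi> (c s) * s))"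
        by (rule L.add_gr[OF c rest])
      also have "(y * t - (\<Sum>s\<in>S. \<phi> (c s) * s)) + (\<Sum>s\<in>S - fibre S t. \<phi> (c s) * s)
          = (y - sum_list (map2 (*) (map \<phi> ks) us)) * t"
        unfolding S_split main by (simp add: algebra_simps)
      finally have "\<nu> t + 0 < \<nu> t + \<nu> (y - sum_list (map2 (*) (map \<phi> ks) us))"
        unfolding vyt by (simp add: L.mult add.commute)
      then show ?thesis using kO t vval_add_left_cancel(2)[of "\<nu> t" 0] by auto
    qed
    then obtain ks where ks: "set ks \<subseteq> integers \<mu>" "0 < \<nu> (y - sum_list (map2 (*) (map \<phi> ks) us))" by blast
    have kO: "set (map \<phi> ks) \<subseteq> integers \<nu>" using ks(1) hom_integers by auto
    have "x = R.combine (map (residue_class \<nu>) (map \<phi> ks)) (map (residue_class \<nu>) us)"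
      unfolding y(2) L.combine_residue_class(1)[OF kO usO] L.residue_class_eq_iff
      using ks(2) by (simp add: max_ideal_def)
    moreover have "set (map (residue_class \<nu>) (map \<phi> ks)) \<subseteq> k_image" using ks(1) by (auto simp: k_image_def)
    ultimately show ?thesis by blast
  qed
  have "R.dim k_image (carrier (residue_field \<nu>)) = length (map (residue_class \<nu>) us)"
    using usO L.residue_class_carrier by (intro R.dim_eqI[OF k_image_subfield _ indep span]) auto
  then show ?thesis unfolding residue_degree_def k_image_def using lus n by simp
qed

text \<open>
  The fibres partition \<open>S\<close>; there is one for each coset, and none is empty, since an element of any given value can be
  approximated.
\<close>

theorem card_graded_basis:
  "card S = group_index (value_group \<nu>) (value_group \<mu>) * residue_degree \<phi> \<mu> \<nu>"
    "0 < group_index (value_group \<nu>) (value_group \<mu>)" "0 < residue_degree \<phi> \<mu> \<nu>"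
proof -
  define cls where "cls g = (+) g ` value_group \<mu>" for g
  define ev where "ev s = (THE g. \<nu> s = Val g)" for s
  have ev: "\<nu> s = Val (ev s)" if "s \<noteq> 0" for s
    using that L.eq_Infty_iff[of s] unfolding ev_def by (cases "\<nu> s") auto
  have cls_eq: "cls (ev s) = cls (ev t) \<longleftrightarrow> (\<exists>a. a \<noteq> 0 \<and> \<nu> (\<phi> a * s) = \<nu> t)" if st: "s \<noteq> 0" "t \<noteq> 0" for s t
  proof
    assume eq: "cls (ev s) = cls (ev t)"
    have "0 \<in> value_group \<mu>" using K.one unfolding value_group_def zero_vval_def by blast
    then have "ev t \<in> cls (ev s)" unfolding eq by (auto simp: cls_def)
    then obtain a where a: "ev t = ev s + a" "a \<in> value_group \<mu>" by (auto simp: cls_def)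
    then obtain x where x: "\<mu> x = Val a" by (auto simp: value_group_def)
    have "\<nu> (\<phi> x * s) = \<nu> t" using a x ev st by (simp add: L.mult extends add.commute)
    moreover have "x \<noteq> 0" using x by auto
    ultimately show "\<exists>a. a \<noteq> 0 \<and> \<nu> (\<phi> a * s) = \<nu> t" by blast
  next
    assume "\<exists>a. a \<noteq> 0 \<and> \<nu> (\<phi> a * s) = \<nu> t"
    then obtain x where x: "x \<noteq> 0" "\<nu> (\<phi> x * s) = \<nu> t" by blast
    obtain h where h: "\<mu> x = Val h" using x(1) K.eq_Infty_iff[of x] by (cases "\<mu> x") auto
    have hi: "\<mu> (inverse x) = Val (- h)"
      using K.value_inverse[OF x(1)] h
      by (cases "\<mu> (inverse x)") (auto simp: zero_vval_def eq_neg_iff_add_eq_0 add.commute)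
    have th: "ev t = ev s + h" using x(2) ev st h by (simp add: L.mult extends add.commute)
    have shift: "g + h' \<in> value_group \<mu>" if g: "g \<in> value_group \<mu>" and z: "\<mu> z = Val h'" for g h' z
    proof -
      obtain w where "\<mu> w = Val g" using g by (auto simp: value_group_def)
      then have "\<mu> (w * z) = Val (g + h')" using z by (simp add: K.mult)
      then show ?thesis by (auto simp: value_group_def)
    qed
    show "cls (ev s) = cls (ev t)"
    proof
      show "cls (ev s) \<subseteq> cls (ev t)"
        unfolding cls_def th
      proof
        fix r assume "r \<in> (+) (ev s) ` value_group \<mu>"
        then obtain g where g: "r = ev s + g" "g \<in> value_group \<mu>" by blast
        have "r = ev s + h + (g + - h)" by (simp add: g(1))
        then show "r \<in> (+) (ev s + h) ` value_group \<mu>" using shift[OF g(2) hi] by blast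
      qed
      show "cls (ev t) \<subseteq> cls (ev s)"
        unfolding cls_def th
      proof
        fix r assume "r \<in> (+) (ev s + h) ` value_group \<mu>"
        then obtain g where g: "r = ev s + h + g" "g \<in> value_group \<mu>" by blast
        have "r = ev s + (g + h)" by (simp add: g(1) algebra_simps)
        then show "r \<in> (+) (ev s) ` value_group \<mu>" using shift[OF g(2) h] by blast
      qed
    qed
  qed
  define CC where "CC = cls ` value_group \<nu>"
  have CC: "CC = (\<lambda>s. cls (ev s)) ` (UNIV - {0})"
  proof
    show "CC \<subseteq> (\<lambda>s. cls (ev s)) ` (UNIV - {0})"
    proof
      fix C assume "C \<in> CC"
      then obtain x g where x: "\<nu> x = Val g" "C = cls g" unfolding CC_def value_group_def by blast
      have "x \<noteq> 0" using x(1) by auto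
      moreover have "ev x = g" using ev[OF calculation] x(1) by simp
      ultimately show "C \<in> (\<lambda>s. cls (ev s)) ` (UNIV - {0})" using x(2) by blast
    qed
    show "(\<lambda>s. cls (ev s)) ` (UNIV - {0}) \<subseteq> CC"
      using ev unfolding CC_def value_group_def by blast
  qed
  have fib: "{s \<in> S. cls (ev s) = cls (ev t)} = fibre S t" if "t \<noteq> 0" for t
    unfolding fibre_def using cls_eq[OF _ that] S_nonzero by (intro Collect_cong) metis
  have sub: "CC \<subseteq> (\<lambda>s. cls (ev s)) ` S"
  proof
    fix C assume "C \<in> CC"
    then obtain t where t: "t \<noteq> 0" "C = cls (ev t)" unfolding CC by blast
    obtain s where "s \<in> {s \<in> S. cls (ev s) = cls (ev t)}"
      using fibre_nonempty[OF t(1)] unfolding fib[OF t(1)] by blast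
    then show "C \<in> (\<lambda>s. cls (ev s)) ` S" unfolding t(2) by (auto intro: rev_image_eqI)
  qed
  have fin: "finite CC" using sub S_finite by (meson finite_imageI finite_subset)
  have "(\<lambda>s. cls (ev s)) ` S \<subseteq> CC" using S_nonzero unfolding CC by blast
  then have "card S = (\<Sum>C\<in>CC. card {s \<in> S. cls (ev s) = C})"
    using sum.group[OF S_finite fin, of "\<lambda>s. cls (ev s)" "\<lambda>_. 1::nat"] by simp
  also have "\<dots> = (\<Sum>C\<in>CC. residue_degree \<phi> \<mu> \<nu>)"
  proof (rule sum.cong[OF refl])
    fix C assume "C \<in> CC"
    then obtain t where t: "t \<noteq> 0" "C = cls (ev t)" unfolding CC by blast
    then show "card {s \<in> S. cls (ev s) = C} = residue_degree \<phi> \<mu> \<nu>" using fib card_fibre by simp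
  qed
  finally show "card S = group_index (value_group \<nu>) (value_group \<mu>) * residue_degree \<phi> \<mu> \<nu>"
    unfolding group_index_def CC_def cls_def by simp
  have "CC \<noteq> {}" unfolding CC by (metis Diff_iff UNIV_I empty_is_image empty_iff singletonD zero_neq_one)
  then show "0 < group_index (value_group \<nu>) (value_group \<mu>)"
    using fin unfolding group_index_def CC_def cls_def by (simp add: card_gt_0_iff)
  have "fibre S 1 \<noteq> {}" "finite (fibre S 1)"
    using fibre_nonempty[of 1] finite_subset[OF _ S_finite, of "fibre S 1"] by (auto simp: fibre_def)
  then show "0 < residue_degree \<phi> \<mu> \<nu>" using card_fibre[of 1] by (metis card_gt_0_iff zero_neq_one)
qed

end

end

section \<open>Graded bases along a family of key polynomials\<close>

lemma expansion_of_sum: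
  fixes Q :: "'k::field poly"
  assumes Q: "0 < degree Q" and c: "\<And>j. degree (c j) < degree Q"
  shows "expansion Q (\<Sum>j<n. c j * Q ^ j) l = (if l < n then c l else 0)"
proof -
  let ?c = "\<lambda>j. if j < n then c j else 0"
  have sub: "{j. ?c j \<noteq> 0} \<subseteq> {..<n}" by auto
  have "(\<Sum>j<n. c j * Q ^ j) = (\<Sum>j<n. ?c j * Q ^ j)" by (rule sum.cong) auto
  also have "\<dots> = (\<Sum>j | ?c j \<noteq> 0. ?c j * Q ^ j)"
    by (rule sum.mono_neutral_right) (use sub in auto)
  finally have "is_expansion Q (\<Sum>j<n. c j * Q ^ j) ?c"
    unfolding is_expansion_def using c Q finite_subset[OF sub] by auto
  from is_expansion_unique[OF Q this, of l] show ?thesis unfolding expansion_eq[OF Q] by simp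
qed

context pseudo_valuation
begin

text \<open>
  The notion of a graded basis for the image in \<open>L\<close> of the polynomials of degree less than \<open>n\<close>, where the bound on the degree
  is visible.
\<close>

definition poly_graded_basis :: "nat \<Rightarrow> 'k poly set \<Rightarrow> bool" where
  "poly_graded_basis n S \<longleftrightarrow> finite S \<and> 0 \<notin> S \<and> (\<forall>s\<in>S. degree s < n) \<and>
     (\<forall>c. \<forall>s\<in>S. v (\<Sum>t\<in>S. smult (c t) t) \<le> v (smult (c s) s)) \<and>
     (\<forall>f. degree f < n \<longrightarrow> f \<noteq> 0 \<longrightarrow> (\<exists>c. v f < v (f - (\<Sum>s\<in>S. smult (c s) s))))"

lemma poly_graded_basisD:
  assumes "poly_graded_basis n S"
  shows "finite S" "0 \<notin> S" "s \<in> S \<Longrightarrow> degree s < n"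
    "s \<in> S \<Longrightarrow> v (\<Sum>t\<in>S. smult (c t) t) \<le> v (smult (c s) s)"
    "degree f < n \<Longrightarrow> f \<noteq> 0 \<Longrightarrow> \<exists>c. v f < v (f - (\<Sum>s\<in>S. smult (c s) s))"
  using assms unfolding poly_graded_basis_def by auto

lemma poly_graded_basis_one:
  assumes "0 < degree P"
  shows "poly_graded_basis 1 {1}"
  unfolding poly_graded_basis_def
proof (intro conjI allI impI)
  fix f :: "'k poly" assume f: "degree f < 1" "f \<noteq> 0"
  obtain b where b: "f = [:b:]" using f(1) by (metis degree_eq_zeroE less_one)
  have "v f \<noteq> Infty" using finite_value[OF f(2)] f(1) assms by simp
  then show "\<exists>c. v f < v (f - (\<Sum>s\<in>{1}. smult (c s) s))"
    by (intro exI[of _ "\<lambda>_. b"]) (simp add: b one_pCons)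
qed (auto simp: assms)

text \<open>
  Since \<open>v\<close> is the truncation at \<open>Q\<close> in the relevant degrees, the coefficients of different powers of \<open>Q\<close> do not interfere,
  and both conditions can be checked coefficientwise.
\<close>

lemma poly_graded_basis_step:
  assumes S: "poly_graded_basis (degree Q) S"
    and Q: "lead_coeff Q = 1" "0 < degree Q" "v Q \<noteq> Infty"
    and P: "\<alpha> * degree Q \<le> degree P"
    and trunc: "\<And>f. degree f < \<alpha> * degree Q \<Longrightarrow> truncation v Q f = v f"
  shows "\<exists>S'. poly_graded_basis (\<alpha> * degree Q) S' \<and> card S' = \<alpha> * card S"
proof -
  let ?q = "degree Q"
  define p where "p = (\<lambda>(s, j). s * Q ^ j)"
  define S' where "S' = p ` (S \<times> {..<\<alpha>})"
  note SD = poly_graded_basisD[OF S]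
  have Q0: "Q \<noteq> 0" using Q(2) by auto
  have dp: "degree (s * Q ^ j) = degree s + j * ?q" if "s \<in> S" for s j
    using degree_monic_mult_power[OF Q(1), of s] SD(2) that by metis
  have inj: "inj_on p (S \<times> {..<\<alpha>})"
  proof (rule inj_onI)
    fix x y assume xy: "x \<in> S \<times> {..<\<alpha>}" "y \<in> S \<times> {..<\<alpha>}" "p x = p y"
    obtain s j t k where x: "x = (s, j)" "s \<in> S" and y: "y = (t, k)" "t \<in> S" using xy(1,2) by auto
    have eq: "s * Q ^ j = t * Q ^ k" using xy(3) x y by (simp add: p_def)
    have "degree s + j * ?q = degree t + k * ?q"
      using dp[OF x(2), of j] dp[OF y(2), of k] eq by simp
    then have "(degree s + j * ?q) div ?q = (degree t + k * ?q) div ?q" by simp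
    then have "j = k" using SD(3)[OF x(2)] SD(3)[OF y(2)] by simp
    then show "x = y" using eq Q0 x y by simp
  qed
  have fin: "finite S'" unfolding S'_def using SD(1) by simp
  have sums: "(\<Sum>t\<in>S'. smult (c t) t) = (\<Sum>j<\<alpha>. (\<Sum>s\<in>S. smult (c (s * Q ^ j)) s) * Q ^ j)" for c
  proof -
    have "(\<Sum>t\<in>S'. smult (c t) t) = (\<Sum>x\<in>S \<times> {..<\<alpha>}. smult (c (p x)) (p x))"
      unfolding S'_def by (simp add: sum.reindex[OF inj])
    also have "\<dots> = (\<Sum>s\<in>S. \<Sum>j<\<alpha>. smult (c (s * Q ^ j)) (s * Q ^ j))"
      by (simp add: sum.cartesian_product p_def split_beta)
    also have "\<dots> = (\<Sum>j<\<alpha>. \<Sum>s\<in>S. smult (c (s * Q ^ j)) (s * Q ^ j))" by (rule sum.swap)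
    finally show ?thesis by (simp add: sum_distrib_right)
  qed
  have deg_sum: "degree (\<Sum>s\<in>S. smult (d s) s) < ?q" for d
    using SD(3) Q(2) by (intro degree_sum_less) (auto intro: order_le_less_trans[OF degree_smult_le])
  have deg_big: "degree (\<Sum>j<\<alpha>. f j * Q ^ j) < \<alpha> * ?q"
    if "0 < \<alpha>" "\<And>j. degree (f j) < ?q" for f
  proof (rule degree_sum_less)
    show "0 < \<alpha> * ?q" using that(1) Q(2) by simp
    fix j assume "j \<in> {..<\<alpha>}"
    then have "Suc j * ?q \<le> \<alpha> * ?q" by (intro mult_le_mono1) auto
    moreover have "degree (f j * Q ^ j) \<le> degree (f j) + j * ?q"
      using degree_monic_mult_power[OF Q(1), of "f j" j] by (cases "f j = 0") auto
    ultimately show "degree (f j * Q ^ j) < \<alpha> * ?q" using that(2)[of j] by simp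
  qed
  have "poly_graded_basis (\<alpha> * ?q) S'"
    unfolding poly_graded_basis_def
  proof (intro conjI ballI allI impI)
    show "finite S'" by (rule fin)
    show "0 \<notin> S'" using SD(2) Q0 by (auto simp: S'_def p_def)
  next
    fix t assume "t \<in> S'"
    then obtain s j where t: "t = s * Q ^ j" "s \<in> S" "j < \<alpha>" by (auto simp: S'_def p_def)
    have "Suc j * ?q \<le> \<alpha> * ?q" using t(3) by (intro mult_le_mono1) auto
    then show "degree t < \<alpha> * ?q" using dp[OF t(2), of j] SD(3)[OF t(2)] by (simp add: t(1))
  next
    fix c :: "'k poly \<Rightarrow> 'k" and t assume "t \<in> S'"
    then obtain s j where t: "t = s * Q ^ j" "s \<in> S" "j < \<alpha>" by (auto simp: S'_def p_def)
    define f where "f j = (\<Sum>s\<in>S. smult (c (s * Q ^ j)) s)" for j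
    have df: "degree (f j) < ?q" for j unfolding f_def by (rule deg_sum)
    let ?z = "\<Sum>j<\<alpha>. f j * Q ^ j"
    have z: "(\<Sum>t\<in>S'. smult (c t) t) = ?z" unfolding sums f_def ..
    have "v ?z = truncation v Q ?z" using trunc[OF deg_big[of f]] df t(3) by simp
    also have "\<dots> \<le> term_value v Q ?z j" by (rule truncation_le[of Q v, OF Q(2) zero])
    also have "\<dots> = j \<star> v Q + v (f j)"
      unfolding term_value_alt expansion_of_sum[OF Q(2) df] using t(3) by simp
    also have "\<dots> \<le> j \<star> v Q + v (smult (c (s * Q ^ j)) s)"
      unfolding f_def by (intro add_left_mono SD(4)[OF t(2), of "\<lambda>s. c (s * Q ^ j)"])
    also have "\<dots> = v (smult (c t) t)"
      unfolding t(1) using mult[of "smult (c (s * Q ^ j)) s" "Q ^ j"] by (simp add: power add.commute)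
    finally show "v (\<Sum>t\<in>S'. smult (c t) t) \<le> v (smult (c t) t)" unfolding z .
  next
    fix f :: "'k poly" assume f: "degree f < \<alpha> * ?q" "f \<noteq> 0"
    define g where "g j = expansion Q f j" for j
    have dg: "degree (g j) < ?q" for j unfolding g_def by (rule expansion_degree_bound[OF Q(2)])
    note top = expansion_top[OF Q(1,2) f(2)]
    have "expansion_degree Q f * ?q < \<alpha> * ?q" using top(3) f(1) by linarith
    then have da: "expansion_degree Q f < \<alpha>" by simp
    have f_eq: "f = (\<Sum>j<\<alpha>. g j * Q ^ j)"
    proof -
      have "f = (\<Sum>j\<le>degree f + \<alpha>. g j * Q ^ j)"
        unfolding g_def by (rule expansion_sum_eq[OF Q(2)]) simp
      also have "\<dots> = (\<Sum>j<\<alpha>. g j * Q ^ j)"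
        using top(2) da by (intro sum.mono_neutral_right) (auto simp: g_def)
      finally show ?thesis .
    qed
    have vf: "v f \<noteq> Infty" using finite_value[OF f(2)] f(1) P by simp
    have vg: "v f \<le> v (g j * Q ^ j)" for j
      using truncation_le[of Q v, OF Q(2) zero, of f j] trunc[OF f(1)]
      by (simp add: term_value_alt g_def mult power add.commute)
    have "\<exists>d. v f < v ((g j - (\<Sum>s\<in>S. smult (d s) s)) * Q ^ j)" for j
    proof (cases "g j = 0")
      case True
      then show ?thesis using vf by (intro exI[of _ "\<lambda>_. 0"]) simp
    next
      case False
      then obtain d where d: "v (g j) < v (g j - (\<Sum>s\<in>S. smult (d s) s))" using SD(5)[OF dg] by blast
      have "v (g j * Q ^ j) < v ((g j - (\<Sum>s\<in>S. smult (d s) s)) * Q ^ j)"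
        unfolding mult using Q(3) by (intro vval_add_less_le_mono(1)[OF d]) (auto simp: power)
      then show ?thesis using vg[of j] by (intro exI[of _ d]) simp
    qed
    then obtain d where d: "\<And>j. v f < v ((g j - (\<Sum>s\<in>S. smult (d j s) s)) * Q ^ j)" by metis
    define c where "c t = (case inv_into (S \<times> {..<\<alpha>}) p t of (s, j) \<Rightarrow> d j s)" for t
    have c: "c (s * Q ^ j) = d j s" if "s \<in> S" "j < \<alpha>" for s j
      using inv_into_f_f[OF inj, of "(s, j)"] that by (simp add: c_def p_def)
    have "f - (\<Sum>t\<in>S'. smult (c t) t) = (\<Sum>j<\<alpha>. g j * Q ^ j) - (\<Sum>j<\<alpha>. (\<Sum>s\<in>S. smult (d j s) s) * Q ^ j)"
      unfolding sums using c by (subst (1) f_eq) (auto intro!: sum.cong)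
    also have "\<dots> = (\<Sum>j<\<alpha>. (g j - (\<Sum>s\<in>S. smult (d j s) s)) * Q ^ j)"
      by (simp add: sum_subtractf left_diff_distrib)
    finally show "\<exists>c. v f < v (f - (\<Sum>t\<in>S'. smult (c t) t))"
      using sum_gr[OF vf d] by (intro exI[of _ c]) simp
  qed
  moreover have "card S' = \<alpha> * card S"
    unfolding S'_def card_image[OF inj] card_cartesian_product by simp
  ultimately show ?thesis by blast
qed

end

context limit_index
begin

text \<open>
  Choose \<open>n\<close> such that the truncation at \<open>Q\<^sub>n\<close> has the right value at \<open>f\<close>, and let \<open>c\<close> be the remainder of \<open>f\<close> modulo \<open>Q\<^sub>n\<^sub>+\<^sub>1\<close>. Then
  \<open>f - c\<close> is a multiple of \<open>Q\<^sub>n\<^sub>+\<^sub>1\<close>, so its value increases from the truncation at \<open>Q\<^sub>n\<close>, where it is at least \<open>v f\<close>, to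
  \<open>v\<close>.
\<close>

lemma initial_coefficient:
  assumes f: "degree f < m (Suc a, 0)" "f \<noteq> 0"
  shows "\<exists>c. degree c < m (a, N) \<and> v f < v (f - c)"
proof -
  obtain K where K: "\<forall>n\<ge>K. tr (a, n) f = v f" using limit_stable[OF limit_le f(1)] by blast
  define n where "n = max N K"
  have n: "N \<le> n" "N \<le> Suc n" "1 \<le> n" using N(1) by (auto simp: n_def)
  have trf: "tr (a, n) f = v f" using K by (simp add: n_def)
  let ?Q = "Q (a, Suc n)"
  have dq: "m (a, Suc n) = m (a, N)" "m (a, n) = m (a, N)" by (rule N(2)[OF n(2)], rule N(2)[OF n(1)])
  have pos: "0 < m (a, Suc n)" using degree_pos[OF below(1) below(3), of "Suc n"] by simp
  interpret w: pseudo_valuation "tr (a, n)" 0 by (rule truncation_at(1)[OF below(1)[OF n(3)] below(2)])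
  note le = truncation_at(2)[OF below(1)[OF n(3)] below(2)]
  have wQ: "tr (a, n) ?Q < v ?Q"
    using successor(1)[OF below(1)[OF n(3)] below(2)] .
  define c h where "c = f mod ?Q" and "h = f div ?Q"
  have f_eq: "f = c + ?Q * h" by (simp add: c_def h_def)
  have dc: "degree c < m (a, Suc n)" unfolding c_def by (rule degree_mod_less_nz[OF pos])
  have vf: "v f \<noteq> Infty"
    using finite_value[OF f(2)] f(1) degree_le_P[OF at_limit limit_le] by simp
  have wc: "tr (a, n) c = v c"
    using truncation_at(3)[OF below(1)[OF n(3)] below(2)] dc dq by simp
  have "v f < v (?Q * h)"
  proof (cases "h = 0")
    case False
    have "tr (a, n) f \<le> tr (a, n) c"
      using remainder_value[OF w.pseudo_valuation_axioms le wQ wc, of h] f_eq by simp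
    then have "tr (a, n) f \<le> tr (a, n) (f - c)" by (intro w.diff_ge) auto
    then have "v f \<le> tr (a, n) (?Q * h)" using trf f_eq by simp
    also have "\<dots> < v (?Q * h)"
      unfolding w.mult mult using False w.support[of h] by (intro vval_add_less_le_mono(1)[OF wQ le]) simp
    finally show ?thesis .
  qed (use vf in simp)
  then have "v f < v (f - c)" using f_eq by simp
  then show ?thesis using dc dq by auto
qed

lemma poly_graded_basis_limit:
  assumes S: "poly_graded_basis (m (a, N)) S"
  shows "poly_graded_basis (m (Suc a, 0)) S"
  unfolding poly_graded_basis_def
proof (intro conjI ballI allI impI)
  note SD = poly_graded_basisD[OF S]
  show "finite S" "0 \<notin> S" by (fact SD)+
  show "degree s < m (Suc a, 0)" if "s \<in> S" for s
    using SD(3)[OF that] degree_le_limit[OF N(1)] by simp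
  show "v (\<Sum>t\<in>S. smult (c t) t) \<le> v (smult (c s) s)" if "s \<in> S" for c s by (rule SD(4)[OF that])
  fix f :: "'k poly" assume f: "degree f < m (Suc a, 0)" "f \<noteq> 0"
  obtain c where c: "degree c < m (a, N)" "v f < v (f - c)" using initial_coefficient[OF f] by blast
  have "v (c - f) = v (f - c)" using minus[of "f - c"] by simp
  then have vc: "v c = v f" using add_eq_left[of f "c - f"] c(2) by simp
  have "c \<noteq> 0" using c(2) by auto
  then obtain d where d: "v c < v (c - (\<Sum>s\<in>S. smult (d s) s))" using SD(5)[OF c(1)] by blast
  have "v f < v ((f - c) + (c - (\<Sum>s\<in>S. smult (d s) s)))" using c(2) d vc by (intro add_gr) auto
  then show "\<exists>c. v f < v (f - (\<Sum>s\<in>S. smult (c s) s))" by (intro exI[of _ d]) simp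
qed

end

locale henselian_key_family = key_family v P \<Lambda> Q + K: henselian_field \<mu>
  for v :: "'k::field poly \<Rightarrow> 'g::linordered_ab_group_add vval" and P \<Lambda> Q
    and \<mu> :: "'k \<Rightarrow> 'g vval" +
  assumes const: "v [:c:] = \<mu> c"
begin

text \<open>
  As \<open>(a, n)\<close> stands for \<open>\<omega>a + n\<close>, the first component counts the limit indices up to \<open>i\<close>.
\<close>

definition degree_splits :: "index \<Rightarrow> bool" where
  "degree_splits i \<longleftrightarrow> (\<exists>S. poly_graded_basis (m i) S \<and> m i = card S * (\<Prod>j=1..fst i. limit_delta v Q j))"

lemma degree_splits_successor:
  assumes "(0, 1) \<le> (a, i)" "(a, Suc i) \<le> \<Lambda>" "degree_splits (a, i)"
  shows "degree_splits (a, Suc i)"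
proof -
  have L: "(a, i) < \<Lambda>" "(a, i) \<le> \<Lambda>"
  proof -
    have "(a, i) < (a, Suc i)" by simp
    then show "(a, i) < \<Lambda>" using assms(2) by (rule order_less_le_trans)
    then show "(a, i) \<le> \<Lambda>" by simp
  qed
  let ?\<alpha> = "key_alpha Q (a, Suc i)"
  have ds: "m (a, Suc i) = ?\<alpha> * m (a, i)" by (rule degree_successor(1)[OF assms(1) L(1) assms(2)])
  obtain S where S: "poly_graded_basis (m (a, i)) S" "m (a, i) = card S * (\<Prod>j=1..a. limit_delta v Q j)"
    using assms(3) unfolding degree_splits_def by auto
  have s1: "(0, 1) \<le> (a, Suc i)" using assms(1) by auto
  have tr: "tr (a, i) f = v f" if "degree f < ?\<alpha> * m (a, i)" for f
    using successor(3)[OF assms(1) L(1), of f] truncation_at(2)[OF assms(1) L(1), of f] that unfolding ds[symmetric] by (metis leD order_le_less)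
  obtain S' where S': "poly_graded_basis (?\<alpha> * m (a, i)) S'" "card S' = ?\<alpha> * card S"
    using poly_graded_basis_step[OF S(1) Q_monic[OF assms(1) L(2)] degree_pos[OF assms(1) L(2)]
        value_finite[OF assms(1) L(1)] _ tr] degree_le_P[OF s1 assms(2)] ds by auto
  then show ?thesis unfolding degree_splits_def ds using S(2) by (intro exI[of _ S']) simp
qed

lemma degree_splits_first: "degree_splits (0, 1)"
  unfolding degree_splits_def
  by (intro exI[of _ "{1}"]) (use poly_graded_basis_one[OF P_degree_pos] in \<open>simp add: Q_first[unfolded One_nat_def]\<close>)

lemma degree_splits_limit:
  assumes l: "(Suc a, 0) \<le> \<Lambda>" and IH: "\<And>n. 1 \<le> n \<Longrightarrow> degree_splits (a, n)"
  shows "degree_splits (Suc a, 0)"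
proof -
  interpret henselian_limit_index v P \<Lambda> Q a \<mu>
    by unfold_locales (use l const in auto)
  obtain S where S: "poly_graded_basis (m (a, N)) S" "m (a, N) = card S * (\<Prod>j=1..a. limit_delta v Q j)"
    using IH[OF N(1)] unfolding degree_splits_def by auto
  show ?thesis
    unfolding degree_splits_def using poly_graded_basis_limit[OF S(1)] limit_delta_eq S(2)
    by (intro exI[of _ S]) (simp add: mult.commute mult.assoc)
qed

lemma degree_splits_all: "(0, 1) \<le> (a, i) \<Longrightarrow> (a, i) \<le> \<Lambda> \<Longrightarrow> degree_splits (a, i)"
proof (induction a arbitrary: i)
  case 0
  then show ?case
  proof (induction i)
    case (Suc i)
    show ?case
    proof (cases i)
      case 0
      then show ?thesis using degree_splits_first by simp
    next
      case (Suc k)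
      have "(0, i) < (0::nat, Suc i)" by simp
      then have "(0, i) \<le> \<Lambda>" using Suc.prems(2) by (meson order_less_imp_le order_less_le_trans)
      then show ?thesis using Suc.IH Suc.prems degree_splits_successor[of 0 i] Suc by simp
    qed
  qed simp
next
  case (Suc a)
  have base: "degree_splits (Suc a, 0)" if l: "(Suc a, 0) \<le> \<Lambda>"
  proof (rule degree_splits_limit[OF l])
    fix n :: nat assume "1 \<le> n"
    moreover have "(a, n) < (Suc a, 0)" by simp
    then have "(a, n) \<le> \<Lambda>" using l by (meson order_less_imp_le order_less_le_trans)
    ultimately show "degree_splits (a, n)" by (intro Suc.IH) auto
  qed
  show ?case using Suc.prems(2)
  proof (induction i)
    case 0
    then show ?case by (rule base)
  next
    case (Suc i)
    have "(Suc a, i) < (Suc a, Suc i)" by simp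
    then have "(Suc a, i) \<le> \<Lambda>" using Suc.prems by (meson order_less_imp_le order_less_le_trans)
    then show ?case using Suc degree_splits_successor[of "Suc a" i] by simp
  qed
qed

lemma limit_count_eq: "limit_count \<Lambda> = (if snd \<Lambda> = 0 then fst \<Lambda> else Suc (fst \<Lambda>))"
proof -
  obtain a i where L: "\<Lambda> = (a, i)" by (cases \<Lambda>)
  have f: "0 < a \<or> 0 < i" using first_le L by auto
  show ?thesis
    unfolding limit_count_def L using f by (intro Least_equality) (auto split: if_splits)
qed

lemma prod_limit_d: "(\<Prod>j = 1..limit_count \<Lambda>. limit_d v \<Lambda> Q j) = (\<Prod>j=1..fst \<Lambda>. limit_delta v Q j)"
proof -
  obtain a i where L: "\<Lambda> = (a, i)" by (cases \<Lambda>)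
  show ?thesis
  proof (cases "i = 0")
    case True
    then have n: "limit_count \<Lambda> = a" using limit_count_eq L by simp
    have "a \<noteq> 0" using first_le L True by auto
    then obtain b where b: "a = Suc b" by (cases a) auto
    interpret limit_index v P \<Lambda> Q b by unfold_locales (use L True b in simp)
    have *: "limit_d v \<Lambda> Q j = limit_delta v Q j" if "j \<in> {1..a}" for j
      using that infinite_alpha L True b n unfolding limit_d_def by (cases "j = a") auto
    have "fst \<Lambda> = a" using L by simp
    then show ?thesis unfolding n using * by (simp only:) (rule prod.cong[OF refl])
  next
    case False
    then have n: "limit_count \<Lambda> = Suc a" using limit_count_eq L by simp
    have *: "limit_d v \<Lambda> Q j = limit_delta v Q j" if "j \<in> {1..a}" for j
      using that n unfolding limit_d_def by auto
    have last: "limit_d v \<Lambda> Q (Suc a) = 1" using False L n unfolding limit_d_def by simp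
    have "(\<Prod>j = 1..Suc a. limit_d v \<Lambda> Q j) = (\<Prod>j = 1..a. limit_d v \<Lambda> Q j)"
      using last by simp
    also have "\<dots> = (\<Prod>j = 1..a. limit_delta v Q j)" using * by (rule prod.cong[OF refl])
    finally have eq: "(\<Prod>j = 1..Suc a. limit_d v \<Lambda> Q j) = (\<Prod>j = 1..a. limit_delta v Q j)" .
    have "fst \<Lambda> = a" using L by simp
    then show ?thesis unfolding n using eq by (simp only:)
  qed
qed

theorem degree_formula:
  "\<exists>S. poly_graded_basis (degree P) S \<and>
     degree P = card S * (\<Prod>j = 1..limit_count \<Lambda>. limit_d v \<Lambda> Q j)"
  using degree_splits_all[of "fst \<Lambda>" "snd \<Lambda>"] first_le unfolding prod_limit_d degree_splits_def prod.collapse last_eq_P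
  by auto

end

locale simple_extension =
  fixes P :: "'k::field poly" and \<pi> :: "'k poly \<Rightarrow> 'l::field"
  assumes P: "lead_coeff P = 1" and pres: "presents_quotient P \<pi>"
begin

lemma pi_add: "\<pi> (f + g) = \<pi> f + \<pi> g" and pi_mult: "\<pi> (f * g) = \<pi> f * \<pi> g" and pi_one: "\<pi> 1 = 1"
  and pi_surj: "\<exists>f. \<pi> f = y" and pi_zero_iff: "\<pi> f = 0 \<longleftrightarrow> P dvd f"
  using pres unfolding presents_quotient_def surj_def by metis+

lemma pi_0 [simp]: "\<pi> 0 = 0"
  by (simp add: pi_zero_iff)

lemma pi_diff: "\<pi> (f - g) = \<pi> f - \<pi> g"
  using pi_add[of "f - g" g] by simp

lemma pi_sum: "\<pi> (\<Sum>i\<in>I. F i) = (\<Sum>i\<in>I. \<pi> (F i))"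
  by (induction I rule: infinite_finite_induct) (auto simp: pi_add)

lemma pi_smult: "\<pi> (smult c f) = \<pi> [:c:] * \<pi> f"
  using pi_mult[of "[:c:]" f] by simp

lemma P_degree_pos: "0 < degree P"
proof (rule ccontr)
  assume "\<not> ?thesis"
  then have "P dvd 1" using P by (metis gr0I is_unit_iff_degree leading_coeff_0_iff zero_neq_one)
  then show False using pi_zero_iff[of 1] pi_one by simp
qed

lemma pi_surj_small: "\<exists>f. degree f < degree P \<and> \<pi> f = y"
proof -
  obtain f where f: "\<pi> f = y" using pi_surj by blast
  have "f = P * (f div P) + f mod P" by simp
  then have "\<pi> f = \<pi> (P * (f div P)) + \<pi> (f mod P)" using pi_add by metis
  also have "\<pi> (P * (f div P)) = 0" by (simp add: pi_zero_iff)
  finally show ?thesis using f degree_mod_less_nz[OF P_degree_pos] by (intro exI[of _ "f mod P"]) simp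
qed

lemma pi_inj_small:
  assumes "degree f < degree P" "\<pi> f = 0"
  shows "f = 0"
  using assms pi_zero_iff dvd_imp_degree_le[of P f] by (meson leD)

lemma extension_degree_eq: "extension_degree (\<lambda>a. \<pi> [:a:]) = degree P"
proof -
  interpret R: field "ring_of_type_algebra :: 'l ring" ..
  let ?\<phi> = "\<lambda>a. \<pi> [:a:]"
  let ?n = "degree P"
  have \<phi>_hom: "?\<phi> (a + b) = ?\<phi> a + ?\<phi> b" "?\<phi> (a * b) = ?\<phi> a * ?\<phi> b" "?\<phi> 1 = 1" for a b
    using pi_add[of "[:a:]" "[:b:]"] pi_mult[of "[:a:]" "[:b:]"] pi_one by (simp_all add: one_pCons mult.commute)
  have sf: "subfield (range ?\<phi>) (ring_of_type_algebra :: 'l ring)"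
  proof (rule R.subfieldI')
    show "subring (range ?\<phi>) (ring_of_type_algebra :: 'l ring)"
    proof (rule R.subringI)
      show "\<one>\<^bsub>ring_of_type_algebra\<^esub> \<in> range ?\<phi>" using \<phi>_hom(3) by (auto intro!: rev_image_eqI)
      fix x assume "x \<in> range ?\<phi>"
      then obtain a where a: "x = ?\<phi> a" by blast
      have "?\<phi> (- a) + x = 0" unfolding a using \<phi>_hom(1)[of "- a" a] by simp
      then have "\<ominus>\<^bsub>ring_of_type_algebra\<^esub> x = ?\<phi> (- a)" by (intro R.minus_equality) auto
      then show "\<ominus>\<^bsub>ring_of_type_algebra\<^esub> x \<in> range ?\<phi>" by blast
      fix y assume "y \<in> range ?\<phi>"
      then obtain b where b: "y = ?\<phi> b" by blast
      show "x \<otimes>\<^bsub>ring_of_type_algebra\<^esub> y \<in> range ?\<phi>" "x \<oplus>\<^bsub>ring_of_type_algebra\<^esub> y \<in> range ?\<phi>"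
        unfolding a b type_algebra_simps \<phi>_hom[symmetric] by blast+
    qed simp
    fix x assume x: "x \<in> range ?\<phi> - {\<zero>\<^bsub>ring_of_type_algebra\<^esub>}"
    then obtain a where a: "x = ?\<phi> a" by blast
    have "a \<noteq> 0" using x a by auto
    then have "x * ?\<phi> (inverse a) = 1" unfolding a using \<phi>_hom(2)[of a "inverse a"] \<phi>_hom(3) by simp
    then have "inv\<^bsub>ring_of_type_algebra\<^esub> x = ?\<phi> (inverse a)" by (intro R.comm_inv_char) auto
    then show "inv\<^bsub>ring_of_type_algebra\<^esub> x \<in> range ?\<phi>" by blast
  qed
  define us where "us = map (\<lambda>i. \<pi> (monom 1 i)) [0..<?n]"
  have lus: "length us = ?n" by (simp add: us_def)
  define f where "f ks = (\<Sum>i<min (length ks) ?n. monom (ks ! i) i)" for ks :: "'k list"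
  have comb: "R.combine (map ?\<phi> ks) us = \<pi> (f ks)" for ks
  proof -
    have "R.combine (map ?\<phi> ks) us = (\<Sum>i<min (length ks) ?n. ?\<phi> (ks ! i) * \<pi> (monom 1 i))"
      unfolding combine_type_algebra sum_list_sum_nth by (simp add: us_def atLeast0LessThan)
    also have "\<dots> = (\<Sum>i<min (length ks) ?n. \<pi> (monom (ks ! i) i))"
      by (simp add: pi_mult[symmetric] smult_monom)
    finally show ?thesis by (simp add: f_def pi_sum)
  qed
  have deg: "degree (f ks) < ?n" for ks
    unfolding f_def using P_degree_pos
    by (intro degree_sum_less) (auto intro: order_le_less_trans[OF degree_monom_le])
  have cf: "coeff (f ks) i = ks ! i" if "i < length ks" "i < ?n" for ks i
    using that unfolding f_def coeff_sum by (simp add: coeff_monom if_distrib cong: if_cong)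
  have "R.dim (range ?\<phi>) (carrier ring_of_type_algebra) = length us"
  proof (rule R.dim_eqI[OF sf])
    fix Ks assume Ks: "set Ks \<subseteq> range ?\<phi>" "R.combine Ks us = \<zero>\<^bsub>ring_of_type_algebra\<^esub>"
    have "\<exists>ks. Ks = map ?\<phi> ks" using Ks(1)
    proof (induction Ks)
      case (Cons K Ks)
      then obtain ks k where "Ks = map ?\<phi> ks" "K = ?\<phi> k" by auto
      then show ?case by (intro exI[of _ "k # ks"]) simp
    qed simp
    then obtain ks where ks: "Ks = map ?\<phi> ks" by blast
    have "f ks = 0" using Ks(2) unfolding ks comb by (intro pi_inj_small[OF deg]) simp
    then have z: "ks ! i = 0" if "i < length ks" "i < ?n" for i using cf[OF that] by simp
    show "set (take (length us) Ks) \<subseteq> {\<zero>\<^bsub>ring_of_type_algebra\<^esub>}"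
    proof
      fix x assume "x \<in> set (take (length us) Ks)"
      then obtain i where "i < ?n" "i < length ks" "x = ?\<phi> (ks ! i)"
        unfolding ks in_set_conv_nth by (auto simp: lus)
      then show "x \<in> {\<zero>\<^bsub>ring_of_type_algebra\<^esub>}" using z by simp
    qed
  next
    fix x :: 'l
    obtain g where g: "degree g < ?n" "\<pi> g = x" using pi_surj_small by blast
    define ks where "ks = map (coeff g) [0..<?n]"
    have "f ks = g"
    proof (rule poly_eqI)
      fix i show "coeff (f ks) i = coeff g i"
      proof (cases "i < ?n")
        case True
        then show ?thesis using cf[of i ks] by (simp add: ks_def)
      next
        case False
        then show ?thesis using deg[of ks] g(1) by (simp add: coeff_eq_0)
      qed
    qed
    then have "x = R.combine (map ?\<phi> ks) us" using comb g(2) by simp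
    then show "\<exists>Ks. set Ks \<subseteq> range ?\<phi> \<and> x = R.combine Ks us" by (intro exI[of _ "map ?\<phi> ks"]) auto
  qed simp
  then show ?thesis unfolding extension_degree_def lus by simp
qed

end

theorem corollary4p3:
  fixes \<mu> :: "'k::field \<Rightarrow> 'g::linordered_ab_group_add vval"
    and \<mu>' :: "'l::field \<Rightarrow> 'g vval"
    and P :: "'k poly" and \<pi> :: "'k poly \<Rightarrow> 'l"
    and \<Lambda> :: index and Q :: "index \<Rightarrow> 'k poly"
  assumes "valuation \<mu>" and "henselian \<mu>"
    and "monic P" and "Factorial_Ring.irreducible P"
    and "presents_quotient P \<pi>"
    and "valuation \<mu>'" and "\<forall>a. \<mu>' (\<pi> [:a:]) = \<mu> a"
    and "key_polynomials (\<mu>' \<circ> \<pi>) \<Lambda> Q"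
    and "n\<^sub>0 = limit_count \<Lambda>"
  shows "of_nat (\<Prod>j = 1..n\<^sub>0. limit_d (\<mu>' \<circ> \<pi>) \<Lambda> Q j) = defect (\<lambda>a. \<pi> [:a:]) \<mu> \<mu>'"
proof -
  interpret S: simple_extension P \<pi> using assms(3,5) by unfold_locales
  interpret L: valued_field \<mu>' using assms(6) by unfold_locales
  have v_const: "(\<mu>' \<circ> \<pi>) [:c:] = \<mu> c" for c using assms(7) by simp
  interpret F: henselian_key_family "\<mu>' \<circ> \<pi>" P \<Lambda> Q \<mu>
  proof unfold_locales
    show "valuation \<mu>" "henselian \<mu>" by fact+
    show "key_polynomials (\<mu>' \<circ> \<pi>) \<Lambda> Q" by fact
    show "lead_coeff P = 1" by fact
    show "(\<mu>' \<circ> \<pi>) [:c:] = \<mu> c" for c by (rule v_const)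
  qed (auto simp: S.pi_mult S.pi_add S.pi_one L.mult L.one S.pi_zero_iff intro: L.add)
  interpret E: valued_extension \<mu> \<mu>' "\<lambda>a. \<pi> [:a:]"
  proof unfold_locales
    fix a b
    show "\<pi> [:a + b:] = \<pi> [:a:] + \<pi> [:b:]" using S.pi_add[of "[:a:]" "[:b:]"] by simp
    show "\<pi> [:a * b:] = \<pi> [:a:] * \<pi> [:b:]" using S.pi_mult[of "[:a:]" "[:b:]"] by (simp add: mult.commute)
    show "\<pi> [:1:] = 1" using S.pi_one by (simp add: one_pCons)
    show "\<mu>' (\<pi> [:a:]) = \<mu> a" using assms(7) by simp
  qed
  obtain B where B: "F.poly_graded_basis (degree P) B"
    "degree P = card B * (\<Prod>j = 1..limit_count \<Lambda>. limit_d (\<mu>' \<circ> \<pi>) \<Lambda> Q j)"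
    using F.degree_formula by blast
  note BD = F.poly_graded_basisD[OF B(1)]
  have inj: "inj_on \<pi> B"
  proof (rule inj_onI)
    fix f g assume fg: "f \<in> B" "g \<in> B" "\<pi> f = \<pi> g"
    have "degree (f - g) < degree P" using BD(3) fg by (intro degree_diff_less)
    then have "f - g = 0" using fg(3) by (intro S.pi_inj_small) (auto simp: S.pi_diff)
    then show "f = g" by simp
  qed
  have sums: "(\<Sum>t\<in>\<pi> ` B. \<pi> [:c t:] * t) = \<pi> (\<Sum>s\<in>B. smult (c (\<pi> s)) s)" for c
    by (simp add: sum.reindex[OF inj] S.pi_sum S.pi_smult)
  have "E.graded_basis (\<pi> ` B)"
    unfolding E.graded_basis_def
  proof (intro conjI allI ballI impI)
    show "finite (\<pi> ` B)" using BD(1) by simp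
    show "0 \<notin> \<pi> ` B" using BD(2,3) S.pi_inj_small by force
  next
    fix c :: "'l \<Rightarrow> 'k" and s assume "s \<in> \<pi> ` B"
    then obtain f where f: "f \<in> B" "s = \<pi> f" by blast
    show "\<mu>' (\<Sum>t\<in>\<pi> ` B. \<pi> [:c t:] * t) \<le> \<mu>' (\<pi> [:c s:] * s)"
      unfolding sums f(2) S.pi_smult[symmetric] using BD(4)[OF f(1), of "\<lambda>s. c (\<pi> s)"] by simp
  next
    fix y :: 'l assume y: "y \<noteq> 0"
    obtain f where f: "degree f < degree P" "\<pi> f = y" using S.pi_surj_small by blast
    then have "f \<noteq> 0" using y by auto
    then obtain c where c: "(\<mu>' \<circ> \<pi>) f < (\<mu>' \<circ> \<pi>) (f - (\<Sum>s\<in>B. smult (c s) s))" using BD(5)[OF f(1)] by blast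
    \<comment> \<open>The coefficients are indexed by \<open>B\<close> on one side and by its image in \<open>L\<close> on the other.\<close>
    have "(\<Sum>s\<in>B. smult (c (inv_into B \<pi> (\<pi> s))) s) = (\<Sum>s\<in>B. smult (c s) s)"
      using inj by (intro sum.cong) auto
    then show "\<exists>c. \<mu>' y < \<mu>' (y - (\<Sum>s\<in>\<pi> ` B. \<pi> [:c s:] * s))"
      unfolding sums using c f(2) by (intro exI[of _ "\<lambda>t. c (inv_into B \<pi> t)"]) (simp add: S.pi_diff)
  qed
  note e_f = E.card_graded_basis[OF this]
  have cB: "card B = group_index (value_group \<mu>') (value_group \<mu>) * residue_degree (\<lambda>a. \<pi> [:a:]) \<mu> \<mu>'"
    using e_f(1) card_image[OF inj] by simp
  show ?thesis
    unfolding defect_def S.extension_degree_eq assms(9) B(2) cB using e_f(2,3) by simp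
qed

end
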